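(* For every integer $n\geq 12$, $$\mathrm{PL}(n)^2\geq \mathrm{PL}(n-1)\,\mathrm{PL}(n+1).$$ That is, the plane partition function $\mathrm{PL}(n)$ is log-concave for all $n\geq 12$.
   Context: A plane partition of size $n$ is an array $\pi=(\pi_{i,j})$ of non-negative integers with weakly decreasing rows and columns and $\sum_{i,j}\pi_{i,j}=n$. $\mathrm{PL}(n)$ denotes the number of plane partitions of size $n$; equivalently (MacMahon), $\sum_{n\ge 0}\mathrm{PL}(n)x^n=\prod_{n\ge 1}(1-x^n)^{-n}=1+x+3x^2+6x^3+13x^4+\cdots$. A real sequence $\{\alpha(n)\}$ is log-concave at $n$ if $\alpha(n)^2\geq\alpha(n-1)\alpha(n+1)$. *)

theory Defs
  imports Complex_Main
begin

text \<open>An array \<open>\<pi>\<close> is indexed by \<open>i, j \<ge> 0\<close>; a size is only defined for arrays with finitely many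
  nonzero entries.\<close>

definition is_plane_partition :: "nat \<Rightarrow> (nat \<Rightarrow> nat \<Rightarrow> nat) \<Rightarrow> bool" where
  "is_plane_partition n \<pi> \<longleftrightarrow>
     (\<forall>i j. \<pi> i (Suc j) \<le> \<pi> i j) \<and>
     (\<forall>i j. \<pi> (Suc i) j \<le> \<pi> i j) \<and>
     finite {(i, j). \<pi> i j \<noteq> 0} \<and>
     (\<Sum>(i, j)\<in>{(i, j). \<pi> i j \<noteq> 0}. \<pi> i j) = n"

definition PL :: "nat \<Rightarrow> nat" where
  "PL n = card {\<pi>. is_plane_partition n \<pi>}"

text \<open>Since \<open>card\<close> of an infinite set is \<open>0\<close>, the definition of \<open>PL\<close> relies on the finiteness
  shown in \<open>finite_plane_partitions\<close> below.\<close>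

lemma is_plane_partition_entry_le:
  assumes "is_plane_partition n \<pi>"
  shows "\<pi> i j \<le> n"
proof (cases "\<pi> i j = 0")
  case False
  have "(case (i, j) of (i, j) \<Rightarrow> \<pi> i j) \<le> (\<Sum>(i, j)\<in>{(i, j). \<pi> i j \<noteq> 0}. \<pi> i j)"
    by (rule member_le_sum) (use assms False in \<open>auto simp: is_plane_partition_def\<close>)
  then show ?thesis
    using assms by (simp add: is_plane_partition_def)
qed simp

lemma is_plane_partition_card_support:
  assumes "is_plane_partition n \<pi>"
  shows "card {(i, j). \<pi> i j \<noteq> 0} \<le> n"
proof -
  have "card {(i, j). \<pi> i j \<noteq> 0} = (\<Sum>p\<in>{(i, j). \<pi> i j \<noteq> 0}. 1)"
    by simp
  also have "\<dots> \<le> (\<Sum>(i, j)\<in>{(i, j). \<pi> i j \<noteq> 0}. \<pi> i j)"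
    by (rule sum_mono) auto
  finally show ?thesis
    using assms by (simp add: is_plane_partition_def)
qed

lemma is_plane_partition_support:
  assumes "is_plane_partition n \<pi>"
  shows "{(i, j). \<pi> i j \<noteq> 0} \<subseteq> {..<n} \<times> {..<n}"
proof safe
  fix i j
  assume nz: "0 < \<pi> i j"
  have fin: "finite {(i, j). \<pi> i j \<noteq> 0}"
    using assms by (simp add: is_plane_partition_def)
  have row: "\<pi> i j \<le> \<pi> i j'" if "j' \<le> j" for j'
    by (rule lift_Suc_antimono_le[of "\<lambda>j. \<pi> i j", OF _ that])
      (use assms in \<open>simp add: is_plane_partition_def\<close>)
  have col: "\<pi> i j \<le> \<pi> i' j" if "i' \<le> i" for i'
    by (rule lift_Suc_antimono_le[of "\<lambda>i. \<pi> i j", OF _ that])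
      (use assms in \<open>simp add: is_plane_partition_def\<close>)
  have colnz: "0 < \<pi> i' j" if "i' \<le> i" for i'
    using col[OF that] nz by linarith
  have rownz: "0 < \<pi> i j'" if "j' \<le> j" for j'
    using row[OF that] nz by linarith
  have "card ({..i} \<times> {j}) \<le> card {(i, j). \<pi> i j \<noteq> 0}"
    using colnz by (intro card_mono[OF fin]) auto
  then show "i < n"
    using is_plane_partition_card_support[OF assms] by (simp add: card_cartesian_product)
  have "card ({i} \<times> {..j}) \<le> card {(i, j). \<pi> i j \<noteq> 0}"
    using rownz by (intro card_mono[OF fin]) auto
  then show "j < n"
    using is_plane_partition_card_support[OF assms] by (simp add: card_cartesian_product)
qed

lemma finite_plane_partitions: "finite {\<pi>. is_plane_partition n \<pi>}"
proof -
  let ?F = "{f :: nat \<times> nat \<Rightarrow> nat. \<forall>p. (p \<in> {..<n} \<times> {..<n} \<longrightarrow> f p \<in> {..n}) \<and>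
              (p \<notin> {..<n} \<times> {..<n} \<longrightarrow> f p = 0)}"
  have "finite ?F"
    by (rule finite_set_of_finite_funs) auto
  moreover have "{\<pi>. is_plane_partition n \<pi>} \<subseteq> curry ` ?F"
  proof
    fix \<pi> assume "\<pi> \<in> {\<pi>. is_plane_partition n \<pi>}"
    then have pp: "is_plane_partition n \<pi>"
      by simp
    have "\<pi> i j = 0" if "(i, j) \<notin> {..<n} \<times> {..<n}" for i j
      using is_plane_partition_support[OF pp] that by blast
    then have "case_prod \<pi> \<in> ?F"
      using is_plane_partition_entry_le[OF pp] by (simp add: split_paired_all)
    then have "curry (case_prod \<pi>) \<in> curry ` ?F"
      by (rule imageI)
    then show "\<pi> \<in> curry ` ?F"
      by (simp only: curry_case_prod)
  qed
  ultimately show ?thesis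
    using finite_surj by blast
qed

end

theory Submission
  imports Defs "HOL-Complex_Analysis.Complex_Analysis"
begin

text \<open>
  By the inequality of arithmetic and geometric means, log-concavity at \<open>n\<close> follows as soon as a single
  \<open>q > 0\<close> satisfies \<open>PL (n - 1) * q ^ (n - 1) + PL (n + 1) * q ^ (n + 1) \<le> 2 * PL n * q ^ n\<close>.
  This inequality is linear in \<open>PL\<close>, so Cauchy's formula turns it into the nonnegativity of one real
  integral over the circle of radius \<open>q\<close>, with the kernel \<open>1 - cos \<theta>\<close>. The main term of this integral dominates
  the error terms, whereas the main terms of \<open>PL\<close> at three neighbouring indices would cancel.

  The generating function is \<open>F z = exp (\<Sum>k. sigma2 k / k * z ^ k)\<close>, where \<open>sigma2 k\<close> is the sum of the
  squares of the divisors of \<open>k\<close>. This is MacMahon's product formula \<open>\<Prod>k. 1 / (1 - z ^ k) ^ k\<close>, and all that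
  is used of it is the recurrence \<open>PL_recurrence\<close>, which says \<open>z * F' z = (\<Sum>k. sigma2 k * z ^ k) * F z\<close>.
  The recurrence is proved bijectively: reverse plane partitions of a shape correspond to arbitrary arrays on the
  same shape, where the sum along a diagonal becomes the sum over a rectangle (\<open>ex_diagonal_bij\<close>). The bijection
  grows the shape one corner at a time and toggles the diagonal of the new corner. Summing over all diagonals
  of a square weights each box by its hook length, and counting weighted arrays is easy.

  For large \<open>n\<close> the radius \<open>q = exp (- t)\<close> is the saddle point, so that
  \<open>F (q * cis \<theta>) * cis (- n * \<theta>) = F q * exp (- decay) * cis phase\<close> with a \<open>decay\<close> of about \<open>3.6 * \<theta>\<^sup>2 / t ^ 4\<close>
  and a \<open>phase\<close> of at most about \<open>4.8 * \<theta> ^ 3 / t ^ 5\<close>. The integrand \<open>exp (- decay) * cos phase * (1 - cos \<theta>)\<close>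
  therefore lives on the scale \<open>\<theta> ~ t\<^sup>2\<close>, where the phase has size \<open>t\<close>; the positive part of the integral has order
  \<open>t ^ 6\<close>. The integrand is nonnegative until the phase reaches \<open>pi / 2\<close>, and from there on \<open>decay\<close> is so large
  that the remaining integral is smaller (\<open>saddle_integral_nonneg\<close>). Because \<open>k\<^sup>2 \<le> sigma2 k\<close>, the decay is bounded
  below by \<open>\<Sum>k. k * q ^ k * (1 - cos (k * \<theta>))\<close>, which has a closed form and is large on the whole
  circle away from \<open>\<theta> = 0\<close>.

  These estimates work for \<open>t \<le> 1/5\<close>, which holds for \<open>n \<ge> 301\<close>. The remaining values are tabulated, and the
  table is certified by the same recurrence.
\<close>

section \<open>Reverse plane partitions and arrays on the same shape\<close>

text \<open>Young diagrams, with rows and columns numbered from 1. Index 0 serves as the boundary row and column on which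
  every filling vanishes, so the inequalities at the rim of a diagram need no case distinction.\<close>
definition ideal :: "(nat \<times> nat) set \<Rightarrow> bool" where
  "ideal L \<longleftrightarrow> finite L \<and> (\<forall>(i, j) \<in> L. 0 < i \<and> 0 < j) \<and>
     (\<forall>(i, j) \<in> L. \<forall>i' j'. 0 < i' \<and> i' \<le> i \<and> 0 < j' \<and> j' \<le> j \<longrightarrow> (i', j') \<in> L)"

definition arrays :: "(nat \<times> nat) set \<Rightarrow> (nat \<Rightarrow> nat \<Rightarrow> nat) set" where
  "arrays L = {f. \<forall>i j. (i, j) \<notin> L \<longrightarrow> f i j = 0}"

definition rpp :: "(nat \<times> nat) set \<Rightarrow> (nat \<Rightarrow> nat \<Rightarrow> nat) set" where
  "rpp L = {p \<in> arrays L. \<forall>(i, j) \<in> L. p (i - 1) j \<le> p i j \<and> p i (j - 1) \<le> p i j}"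

fun diagonal_sum :: "(nat \<Rightarrow> nat \<Rightarrow> nat) \<Rightarrow> nat \<Rightarrow> nat \<Rightarrow> nat" where
  "diagonal_sum p 0 j = 0"
| "diagonal_sum p (Suc i) 0 = 0"
| "diagonal_sum p (Suc i) (Suc j) = p (Suc i) (Suc j) + diagonal_sum p i j"

definition rect_sum :: "(nat \<Rightarrow> nat \<Rightarrow> nat) \<Rightarrow> nat \<Rightarrow> nat \<Rightarrow> nat" where
  "rect_sum f i j = (\<Sum>i'\<in>{1..i}. \<Sum>j'\<in>{1..j}. f i' j')"

text \<open>On the diagonal of the box \<open>(a, b)\<close>, strictly before that box, each entry is reflected inside the interval
  that its four neighbours leave to it. The neighbours lie on the two adjacent diagonals and stay fixed, so
  reflecting twice gives the entry back.\<close>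
definition toggle :: "nat \<Rightarrow> nat \<Rightarrow> (nat \<Rightarrow> nat \<Rightarrow> nat) \<Rightarrow> nat \<Rightarrow> nat \<Rightarrow> nat" where
  "toggle a b p i j =
     (if 0 < i \<and> 0 < j \<and> i < a \<and> i + b = j + a
      then min (p (Suc i) j) (p i (Suc j)) + max (p (i - 1) j) (p i (j - 1)) - p i j
      else p i j)"

definition put :: "nat \<Rightarrow> nat \<Rightarrow> nat \<Rightarrow> (nat \<Rightarrow> nat \<Rightarrow> nat) \<Rightarrow> nat \<Rightarrow> nat \<Rightarrow> nat" where
  "put a b v p i j = (if i = a \<and> j = b then v else p i j)"

lemma diagonal_sum_0 [simp]: "diagonal_sum p i 0 = 0"
  by (cases i) auto

lemma rect_sum_0 [simp]: "rect_sum f 0 j = 0" "rect_sum f i 0 = 0"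
  by (simp_all add: rect_sum_def)

text \<open>Inclusion and exclusion for rectangles; the toggles below are designed so that diagonal sums satisfy the same
  relation.\<close>
lemma rect_sum_Suc:
  "rect_sum f (Suc i) (Suc j) + rect_sum f i j = f (Suc i) (Suc j) + rect_sum f i (Suc j) + rect_sum f (Suc i) j"
  by (simp add: rect_sum_def sum.distrib)

lemma diagonal_sum_cong:
  assumes "\<And>i' j'. i' \<le> i \<Longrightarrow> j' \<le> j \<Longrightarrow> i' + j = j' + i \<Longrightarrow> p i' j' = p' i' j'"
  shows "diagonal_sum p i j = diagonal_sum p' i j"
  using assms
proof (induction p i j rule: diagonal_sum.induct)
  case (3 p i j)
  have "diagonal_sum p i j = diagonal_sum p' i j"
    by (rule 3) (use 3(2) in auto)
  moreover have "p (Suc i) (Suc j) = p' (Suc i) (Suc j)"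
    by (rule 3) auto
  ultimately show ?case by simp
qed auto

lemma rect_sum_cong:
  assumes "\<And>i' j'. i' \<le> i \<Longrightarrow> j' \<le> j \<Longrightarrow> f i' j' = g i' j'"
  shows "rect_sum f i j = rect_sum g i j"
  unfolding rect_sum_def using assms by (intro sum.cong refl) auto

lemma arrays_zero: "p \<in> arrays L \<Longrightarrow> (i, j) \<notin> L \<Longrightarrow> p i j = 0"
  by (simp add: arrays_def)

lemma idealD:
  assumes "ideal L" "(i, j) \<in> L"
  shows "0 < i" "0 < j" "\<And>i' j'. 0 < i' \<Longrightarrow> i' \<le> i \<Longrightarrow> 0 < j' \<Longrightarrow> j' \<le> j \<Longrightarrow> (i', j') \<in> L"
  using assms unfolding ideal_def by blast+

lemma idealI:
  assumes "finite L" "\<And>i j. (i, j) \<in> L \<Longrightarrow> 0 < i \<and> 0 < j"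
    and "\<And>i j i' j'. (i, j) \<in> L \<Longrightarrow> 0 < i' \<Longrightarrow> i' \<le> i \<Longrightarrow> 0 < j' \<Longrightarrow> j' \<le> j \<Longrightarrow> (i', j') \<in> L"
  shows "ideal L"
  using assms unfolding ideal_def by blast

lemma ideal_not_zero: "ideal L \<Longrightarrow> (0, j) \<notin> L" "ideal L \<Longrightarrow> (i, 0) \<notin> L"
  by (auto dest: idealD)

lemma rppD:
  assumes "p \<in> rpp L" "(i, j) \<in> L"
  shows "p (i - 1) j \<le> p i j" "p i (j - 1) \<le> p i j"
  using assms unfolding rpp_def by auto

lemma rpp_Suc:
  assumes "p \<in> rpp L"
  shows "(Suc i, j) \<in> L \<Longrightarrow> p i j \<le> p (Suc i) j" "(i, Suc j) \<in> L \<Longrightarrow> p i j \<le> p i (Suc j)"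
  using rppD[OF assms, of "Suc i" j] rppD[OF assms, of i "Suc j"] by auto

text \<open>The invariant of the construction. It is required only on diagonals that end at \<open>(i, j)\<close>, that is, at rim boxes:
  these are all the diagonals of the shape, and adding a corner changes the end of just one of them.\<close>
definition diagonal_bij :: "(nat \<times> nat) set \<Rightarrow> ((nat \<Rightarrow> nat \<Rightarrow> nat) \<Rightarrow> nat \<Rightarrow> nat \<Rightarrow> nat) \<Rightarrow> bool" where
  "diagonal_bij M \<Phi> \<longleftrightarrow> bij_betw \<Phi> (rpp M) (arrays M) \<and>
     (\<forall>p\<in>rpp M. \<forall>i j. (i, j) \<in> M \<longrightarrow> (Suc i, Suc j) \<notin> M \<longrightarrow> diagonal_sum p i j = rect_sum (\<Phi> p) i j)"

lemma rpp_zero: "ideal L \<Longrightarrow> p \<in> rpp L \<Longrightarrow> p 0 j = 0" "ideal L \<Longrightarrow> p \<in> rpp L \<Longrightarrow> p i 0 = 0"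
  using ideal_not_zero[of L] by (auto simp: rpp_def arrays_def)

text \<open>One step of the construction: a new corner \<open>(a, b)\<close> is added to \<open>L\<close>. In a reverse plane partition of the larger
  shape, the corner entry is bounded below by its two neighbours and unbounded above; its excess over that bound is a
  free natural number, the array entry at the corner.\<close>
context
  fixes L :: "(nat \<times> nat) set" and a0 b0 a b :: nat
  assumes L: "ideal L" and L': "ideal (insert (a, b) L)" and new: "(a, b) \<notin> L"
    and a: "a = Suc a0" and b: "b = Suc b0"
begin

definition on_diag :: "nat \<Rightarrow> nat \<Rightarrow> bool" where
  "on_diag i j \<longleftrightarrow> 0 < i \<and> 0 < j \<and> i < a \<and> i + b = j + a"

lemma on_diag_mem:
  assumes "on_diag i j"
  shows "(i, j) \<in> L" "(Suc i, j) \<in> L" "(i, Suc j) \<in> L"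
    "\<not> on_diag (Suc i) j" "\<not> on_diag i (Suc j)" "\<not> on_diag (i - 1) j" "\<not> on_diag i (j - 1)"
proof -
  have pos: "0 < i" "0 < j" "i < a" "j < b" "i + b = j + a"
    using assms unfolding on_diag_def by linarith+
  have mem: "(i', j') \<in> L" if "0 < i'" "i' \<le> a" "0 < j'" "j' \<le> b" "i' < a \<or> j' < b" for i' j'
    using idealD(3)[OF L', of a b i' j'] that by auto
  show "(i, j) \<in> L" "(Suc i, j) \<in> L" "(i, Suc j) \<in> L"
    using pos by (auto intro!: mem)
  show "\<not> on_diag (Suc i) j" "\<not> on_diag i (Suc j)" "\<not> on_diag (i - 1) j" "\<not> on_diag i (j - 1)"
    using pos unfolding on_diag_def by linarith+
qed

lemma toggle_diag: "on_diag i j \<Longrightarrow>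
   toggle a b p i j = min (p (Suc i) j) (p i (Suc j)) + max (p (i - 1) j) (p i (j - 1)) - p i j"
  by (simp add: toggle_def on_diag_def)

lemma toggle_off: "\<not> on_diag i j \<Longrightarrow> toggle a b p i j = p i j"
  by (auto simp: toggle_def on_diag_def)

lemma rpp_diag_bounds:
  assumes "on_diag i j" "p \<in> rpp L \<or> p \<in> rpp (insert (a, b) L)"
  shows "max (p (i - 1) j) (p i (j - 1)) \<le> p i j" "p i j \<le> min (p (Suc i) j) (p i (Suc j))"
proof -
  from assms(2) obtain M where M: "p \<in> rpp M" "L \<subseteq> M"
    by blast
  have mem: "(i, j) \<in> M" "(Suc i, j) \<in> M" "(i, Suc j) \<in> M"
    using on_diag_mem(1-3)[OF assms(1)] M(2) by blast+
  show "max (p (i - 1) j) (p i (j - 1)) \<le> p i j" "p i j \<le> min (p (Suc i) j) (p i (Suc j))"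
    using rppD[OF M(1) mem(1)] rpp_Suc(1)[OF M(1) mem(2)] rpp_Suc(2)[OF M(1) mem(3)] by simp_all
qed

lemma toggle_bounds:
  assumes "on_diag i j" "p \<in> rpp L \<or> p \<in> rpp (insert (a, b) L)"
  shows "max (p (i - 1) j) (p i (j - 1)) \<le> toggle a b p i j"
    "toggle a b p i j \<le> min (p (Suc i) j) (p i (Suc j))"
  using rpp_diag_bounds[OF assms] unfolding toggle_diag[OF assms(1)] by linarith+

lemma diag_not_corner: "\<not> on_diag a b" "\<not> on_diag a0 b" "\<not> on_diag a b0"
  unfolding on_diag_def using a b by linarith+

text \<open>An inequality between adjacent boxes involves at most one box of the toggled diagonal, and the reflected entry
  respects the bounds given by its neighbours.\<close>
lemma toggle_mono:
  assumes p: "p \<in> rpp L \<or> p \<in> rpp (insert (a, b) L)" and ij: "(i, j) \<in> L"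
  shows "toggle a b p (i - 1) j \<le> toggle a b p i j" "toggle a b p i (j - 1) \<le> toggle a b p i j"
proof -
  note pos = idealD(1,2)[OF L ij]
  have le: "p (i - 1) j \<le> p i j" "p i (j - 1) \<le> p i j"
    using p ij rppD[of p L i j] rppD[of p "insert (a, b) L" i j] by blast+
  show "toggle a b p (i - 1) j \<le> toggle a b p i j"
  proof (cases "on_diag i j")
    case True
    then show ?thesis
      using toggle_bounds[OF True p] on_diag_mem[OF True] by (simp add: toggle_off)
  next
    case False
    show ?thesis
    proof (cases "on_diag (i - 1) j")
      case True
      then show ?thesis
        using toggle_bounds(2)[OF True p] False pos by (simp add: toggle_off)
    qed (use False le in \<open>simp add: toggle_off\<close>)
  qed
  show "toggle a b p i (j - 1) \<le> toggle a b p i j"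
  proof (cases "on_diag i j")
    case True
    then show ?thesis
      using toggle_bounds[OF True p] on_diag_mem[OF True] by (simp add: toggle_off)
  next
    case False
    show ?thesis
    proof (cases "on_diag i (j - 1)")
      case True
      then show ?thesis
        using toggle_bounds(2)[OF True p] False pos by (simp add: toggle_off)
    qed (use False le in \<open>simp add: toggle_off\<close>)
  qed
qed

lemma toggle_involution:
  assumes "p \<in> rpp L \<or> p \<in> rpp (insert (a, b) L)"
    and "\<And>i j. (i, j) \<noteq> (a, b) \<Longrightarrow> p' i j = toggle a b p i j" "(i, j) \<noteq> (a, b)"
  shows "toggle a b p' i j = p i j"
proof (cases "on_diag i j")
  case True
  have nc: "(Suc i, j) \<noteq> (a, b)" "(i, Suc j) \<noteq> (a, b)" "(i - 1, j) \<noteq> (a, b)" "(i, j - 1) \<noteq> (a, b)"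
    using True by (auto simp: on_diag_def)
  let ?c = "min (p (Suc i) j) (p i (Suc j)) + max (p (i - 1) j) (p i (j - 1))"
  have "toggle a b p' i j = ?c - p' i j"
    using on_diag_mem[OF True] nc by (simp add: assms(2) toggle_diag[OF True] toggle_off)
  also have "p' i j = ?c - p i j"
    using assms(3) by (simp add: assms(2) toggle_diag[OF True])
  also have "?c - (?c - p i j) = p i j"
    by (rule diff_diff_cancel) (use rpp_diag_bounds[OF True assms(1)] in linarith)
  finally show ?thesis .
next
  case False
  then show ?thesis
    using assms by (simp add: toggle_off)
qed

definition remove_corner :: "(nat \<Rightarrow> nat \<Rightarrow> nat) \<Rightarrow> nat \<Rightarrow> nat \<Rightarrow> nat" where
  "remove_corner p = put a b 0 (toggle a b p)"

definition excess :: "(nat \<Rightarrow> nat \<Rightarrow> nat) \<Rightarrow> nat" where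
  "excess p = p a b - max (p a0 b) (p a b0)"

definition add_corner :: "(nat \<Rightarrow> nat \<Rightarrow> nat) \<Rightarrow> nat \<Rightarrow> nat \<Rightarrow> nat \<Rightarrow> nat" where
  "add_corner p m = put a b (max (p a0 b) (p a b0) + m) (toggle a b p)"

lemma pred_corner: "a - 1 = a0" "b - 1 = b0" "a0 \<noteq> a" "b0 \<noteq> b"
  by (simp_all add: a b)

lemma add_corner_at: "add_corner p m a b = max (p a0 b) (p a b0) + m"
    "add_corner p m a0 b = p a0 b" "add_corner p m a b0 = p a b0"
  using diag_not_corner pred_corner by (simp_all add: add_corner_def put_def toggle_off)

lemma remove_corner_at: "remove_corner p a b = 0"
    "remove_corner p a0 b = p a0 b" "remove_corner p a b0 = p a b0"
  using diag_not_corner pred_corner by (simp_all add: remove_corner_def put_def toggle_off)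

lemma excess_add_corner: "excess (add_corner p m) = m"
  by (simp add: excess_def add_corner_at)

lemma corner_maximal: "(i, j) \<in> L \<Longrightarrow> \<not> (a \<le> i \<and> b \<le> j)"
  using idealD(3)[OF L, of i j a b] new a b by auto

lemma toggle_arrays:
  assumes "p \<in> arrays (insert (a, b) L)" "(i, j) \<notin> insert (a, b) L"
  shows "toggle a b p i j = 0"
  using assms on_diag_mem(1)[of i j] by (cases "on_diag i j") (auto simp: toggle_off arrays_zero)

lemma remove_corner_rpp:
  assumes "p \<in> rpp (insert (a, b) L)"
  shows "remove_corner p \<in> rpp L"
proof -
  have arr: "p \<in> arrays (insert (a, b) L)"
    using assms by (simp add: rpp_def)
  have "remove_corner p i j = 0" if "(i, j) \<notin> L" for i j
    using toggle_arrays[OF arr, of i j] that by (auto simp: remove_corner_def put_def)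
  moreover have "remove_corner p (i - 1) j \<le> remove_corner p i j \<and> remove_corner p i (j - 1) \<le> remove_corner p i j"
    if "(i, j) \<in> L" for i j
    using toggle_mono[OF disjI2[OF assms] that] corner_maximal[OF that] that new
    by (auto simp: remove_corner_def put_def)
  ultimately show ?thesis
    by (auto simp: rpp_def arrays_def)
qed

lemma add_corner_rpp:
  assumes "p \<in> rpp L"
  shows "add_corner p m \<in> rpp (insert (a, b) L)"
proof -
  have arr: "p \<in> arrays (insert (a, b) L)"
    using assms by (auto simp: rpp_def arrays_def)
  have "add_corner p m i j = 0" if "(i, j) \<notin> insert (a, b) L" for i j
    using toggle_arrays[OF arr, of i j] that by (auto simp: add_corner_def put_def)
  moreover have "add_corner p m (i - 1) j \<le> add_corner p m i j \<and> add_corner p m i (j - 1) \<le> add_corner p m i j"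
    if "(i, j) \<in> L" for i j
  proof -
    have "(i, j) \<noteq> (a, b)" "(i - 1, j) \<noteq> (a, b)" "(i, j - 1) \<noteq> (a, b)"
      using corner_maximal[OF that] idealD(1,2)[OF L that] that new by auto
    then show ?thesis
      using toggle_mono[OF disjI1[OF assms] that] by (auto simp: add_corner_def put_def)
  qed
  moreover have "add_corner p m (a - 1) b \<le> add_corner p m a b \<and> add_corner p m a (b - 1) \<le> add_corner p m a b"
    unfolding pred_corner add_corner_at by linarith
  ultimately show ?thesis
    by (auto simp: rpp_def arrays_def)
qed

lemma add_remove_corner:
  assumes "p \<in> rpp (insert (a, b) L)"
  shows "add_corner (remove_corner p) (excess p) = p"
proof (intro ext)
  fix i j
  show "add_corner (remove_corner p) (excess p) i j = p i j"
  proof (cases "(i, j) = (a, b)")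
    case True
    then show ?thesis
      using rppD[OF assms, of a b] unfolding pred_corner
      by (simp add: add_corner_at excess_def remove_corner_at)
  next
    case False
    then have "add_corner (remove_corner p) (excess p) i j = toggle a b (remove_corner p) i j"
      by (auto simp: add_corner_def put_def)
    also have "\<dots> = p i j"
      by (rule toggle_involution[OF disjI2[OF assms]]) (use False in \<open>auto simp: remove_corner_def put_def\<close>)
    finally show ?thesis .
  qed
qed

lemma remove_add_corner:
  assumes "p \<in> rpp L"
  shows "remove_corner (add_corner p m) = p"
proof (intro ext)
    fix i j
    show "remove_corner (add_corner p m) i j = p i j"
    proof (cases "(i, j) = (a, b)")
      case True
      then show ?thesis
        using assms new by (auto simp: remove_corner_at rpp_def arrays_def)
    next
      case False
      then have "remove_corner (add_corner p m) i j = toggle a b (add_corner p m) i j"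
        by (auto simp: remove_corner_def put_def)
      also have "\<dots> = p i j"
        by (rule toggle_involution[OF disjI1[OF assms]]) (use False in \<open>auto simp: add_corner_def put_def\<close>)
      finally show ?thesis .
    qed
  qed
lemma diagonal_sum_remove_corner_off:
  assumes "i + b \<noteq> j + a"
  shows "diagonal_sum (remove_corner p) i j = diagonal_sum p i j"
proof (rule diagonal_sum_cong)
  fix i' j' assume "i' \<le> i" "j' \<le> j" "i' + j = j' + i"
  then have "i' + b \<noteq> j' + a"
    using assms by linarith
  then show "remove_corner p i' j' = p i' j'"
    by (auto simp: remove_corner_def put_def toggle_def)
qed

text \<open>On the toggled diagonal, old and new entry add up to a minimum over the lower right neighbours plus a maximum over
  the upper left neighbours. The minimum at one box and the maximum at the next box are taken over the same two
  entries, so together they give the sum of both. Summing along the diagonal telescopes into the two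
  adjacent diagonal sums, and only the maximum next to the end is left over.\<close>
lemma diagonal_sum_toggle:
  assumes p: "p \<in> rpp (insert (a, b) L)" and "i + b = j + a" "i < a"
  shows "diagonal_sum (remove_corner p) i j + diagonal_sum p i j + max (p i (Suc j)) (p (Suc i) j)
       = diagonal_sum p i (Suc j) + diagonal_sum p (Suc i) j"
  using assms(2,3)
proof (induction i arbitrary: j)
  case 0
  have "p 0 (Suc j) = 0" "p (Suc 0) 0 = 0"
    using rpp_zero[OF L' p] by simp_all
  then show ?case
    by (cases j) auto
next
  case (Suc i)
  show ?case
  proof (cases j)
    case 0
    then show ?thesis
      using rpp_zero[OF L' p] by simp_all
  next
    case (Suc j')
    have d: "on_diag (Suc i) (Suc j')"
      using Suc.prems Suc by (simp add: on_diag_def)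
    have "diagonal_sum (remove_corner p) i j' + diagonal_sum p i j' + max (p i (Suc j')) (p (Suc i) j')
       = diagonal_sum p i (Suc j') + diagonal_sum p (Suc i) j'"
      by (rule Suc.IH) (use Suc.prems Suc in auto)
    moreover have "remove_corner p (Suc i) (Suc j') + p (Suc i) (Suc j') =
        min (p (Suc (Suc i)) (Suc j')) (p (Suc i) (Suc (Suc j'))) + max (p i (Suc j')) (p (Suc i) j')"
    proof -
      have "remove_corner p (Suc i) (Suc j') = toggle a b p (Suc i) (Suc j')"
        using Suc.prems(2) by (simp add: remove_corner_def put_def)
      also have "\<dots> = min (p (Suc (Suc i)) (Suc j')) (p (Suc i) (Suc (Suc j'))) + max (p i (Suc j')) (p (Suc i) j')
          - p (Suc i) (Suc j')"
        by (simp add: toggle_diag[OF d])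
      finally show ?thesis
        using rpp_diag_bounds(2)[OF d disjI2[OF p]] by linarith
    qed
    ultimately show ?thesis
      by (simp add: Suc)
  qed
qed

text \<open>For the diagonal of the new corner, \<open>diagonal_sum_toggle\<close> and \<open>rect_sum_Suc\<close> have the same shape, with the excess
  as the new array entry. Every other diagonal is untouched by the toggle, and its rectangle does not contain the corner.\<close>
lemma diagonal_bij_add_corner:
  assumes "diagonal_bij L \<Phi>"
  shows "diagonal_bij (insert (a, b) L) (\<lambda>p. put a b (excess p) (\<Phi> (remove_corner p)))"
proof -
  define \<Psi> where "\<Psi> = (\<lambda>p. put a b (excess p) (\<Phi> (remove_corner p)))"
  define \<Theta> where "\<Theta> = inv_into (rpp L) \<Phi>"
  have bij: "bij_betw \<Phi> (rpp L) (arrays L)"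
    and tr: "\<And>p i j. p \<in> rpp L \<Longrightarrow> (i, j) \<in> L \<Longrightarrow> (Suc i, Suc j) \<notin> L \<Longrightarrow> diagonal_sum p i j = rect_sum (\<Phi> p) i j"
    using assms by (auto simp: diagonal_bij_def)
  have \<Phi>: "\<Phi> p \<in> arrays L" if "p \<in> rpp L" for p
    using bij that by (auto simp: bij_betw_def)
  have \<Theta>: "\<Theta> f \<in> rpp L" "\<Phi> (\<Theta> f) = f" if "f \<in> arrays L" for f
    using bij that unfolding \<Theta>_def by (auto simp: bij_betw_def inv_into_into f_inv_into_f)
  have \<Theta>\<Phi>: "\<Theta> (\<Phi> p) = p" if "p \<in> rpp L" for p
    using bij that unfolding \<Theta>_def by (auto simp: bij_betw_def)
  have clear: "put a b 0 (put a b v f) = f" if "f \<in> arrays L" for v f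
    using that new by (auto simp: put_def arrays_def fun_eq_iff)
  have "bij_betw \<Psi> (rpp (insert (a, b) L)) (arrays (insert (a, b) L))"
  proof (rule bij_betw_byWitness[where f' = "\<lambda>f. add_corner (\<Theta> (put a b 0 f)) (f a b)"])
    show "\<forall>p\<in>rpp (insert (a, b) L). add_corner (\<Theta> (put a b 0 (\<Psi> p))) (\<Psi> p a b) = p"
      by (auto simp: \<Psi>_def clear \<Phi> remove_corner_rpp \<Theta>\<Phi> put_def[of a b _ _ a b] add_remove_corner)
    show "\<forall>f\<in>arrays (insert (a, b) L). \<Psi> (add_corner (\<Theta> (put a b 0 f)) (f a b)) = f"
    proof
      fix f assume "f \<in> arrays (insert (a, b) L)"
      then have "put a b 0 f \<in> arrays L"
        by (auto simp: arrays_def put_def)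
      then have "\<Psi> (add_corner (\<Theta> (put a b 0 f)) (f a b)) = put a b (f a b) (put a b 0 f)"
        by (simp add: \<Psi>_def remove_add_corner excess_add_corner \<Theta>)
      also have "\<dots> = f"
        by (auto simp: put_def fun_eq_iff)
      finally show "\<Psi> (add_corner (\<Theta> (put a b 0 f)) (f a b)) = f" .
    qed
    show "\<Psi> ` rpp (insert (a, b) L) \<subseteq> arrays (insert (a, b) L)"
      using \<Phi> remove_corner_rpp by (auto simp: \<Psi>_def arrays_def put_def)
    show "(\<lambda>f. add_corner (\<Theta> (put a b 0 f)) (f a b)) ` arrays (insert (a, b) L) \<subseteq> rpp (insert (a, b) L)"
    proof
      fix q assume "q \<in> (\<lambda>f. add_corner (\<Theta> (put a b 0 f)) (f a b)) ` arrays (insert (a, b) L)"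
      then obtain f where f: "f \<in> arrays (insert (a, b) L)" "q = add_corner (\<Theta> (put a b 0 f)) (f a b)"
        by blast
      have "put a b 0 f \<in> arrays L"
        using f(1) by (auto simp: arrays_def put_def)
      then show "q \<in> rpp (insert (a, b) L)"
        by (simp add: f(2) add_corner_rpp \<Theta>)
    qed
  qed
  moreover have "diagonal_sum p i j = rect_sum (\<Psi> p) i j"
    if p: "p \<in> rpp (insert (a, b) L)" and ij: "(i, j) \<in> insert (a, b) L"
      and rim: "(Suc i, Suc j) \<notin> insert (a, b) L" for p i j
  proof (cases "(i, j) = (a, b)")
    case True
    have agree: "diagonal_sum (remove_corner p) i' j' = rect_sum (\<Psi> p) i' j'"
      if "i' = a \<and> j' = b0 \<or> i' = a0 \<and> j' = b \<or> i' = a0 \<and> j' = b0" for i' j'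
    proof (cases "i' = 0 \<or> j' = 0")
      case False
      have "rect_sum (\<Psi> p) i' j' = rect_sum (\<Phi> (remove_corner p)) i' j'"
        by (rule rect_sum_cong) (use that in \<open>auto simp: \<Psi>_def put_def a b\<close>)
      moreover have "(i', j') \<in> L"
        using idealD(3)[OF L', of a b i' j'] that False a b by auto
      moreover have "(Suc i', Suc j') \<notin> L"
        using corner_maximal[of "Suc i'" "Suc j'"] that a b new by auto
      ultimately show ?thesis
        using tr[OF remove_corner_rpp[OF p]] by simp
    qed auto
    have "diagonal_sum (remove_corner p) a0 b0 + diagonal_sum p a0 b0 + max (p a0 b) (p a b0) = diagonal_sum p a0 b + diagonal_sum p a b0"
      using diagonal_sum_toggle[OF p, of a0 b0] by (simp add: a b)
    moreover have "diagonal_sum p a b = p a b + diagonal_sum p a0 b0"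
      by (simp add: a b)
    moreover have "p a b = excess p + max (p a0 b) (p a b0)"
      using rppD[OF p, of a b] unfolding pred_corner by (simp add: excess_def)
    moreover have "diagonal_sum p a0 b = diagonal_sum (remove_corner p) a0 b" "diagonal_sum p a b0 = diagonal_sum (remove_corner p) a b0"
      by (rule diagonal_sum_remove_corner_off[symmetric], simp add: a b)+
    moreover have "\<Psi> p a b = excess p"
      by (simp add: \<Psi>_def put_def)
    moreover have "rect_sum (\<Psi> p) a b + rect_sum (\<Psi> p) a0 b0 = \<Psi> p a b + rect_sum (\<Psi> p) a0 b + rect_sum (\<Psi> p) a b0"
      unfolding a b by (rule rect_sum_Suc)
    ultimately show ?thesis
      using True agree[of a0 b0] agree[of a b0] agree[of a0 b] by simp
  next
    case False
    then have ijL: "(i, j) \<in> L"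
      using ij by auto
    have "i + b \<noteq> j + a"
    proof
      assume *: "i + b = j + a"
      then have "i < a" "j < b"
        using corner_maximal[OF ijL] by linarith+
      then show False
        using rim idealD(3)[OF L', of a b "Suc i" "Suc j"] by auto
    qed
    then have "diagonal_sum p i j = diagonal_sum (remove_corner p) i j"
      by (simp add: diagonal_sum_remove_corner_off)
    also have "\<dots> = rect_sum (\<Phi> (remove_corner p)) i j"
      using tr[OF remove_corner_rpp[OF p] ijL] rim by auto
    also have "\<dots> = rect_sum (\<Psi> p) i j"
      by (rule rect_sum_cong) (use corner_maximal[OF ijL] in \<open>auto simp: \<Psi>_def put_def\<close>)
    finally show ?thesis .
  qed
  ultimately show ?thesis
    by (simp add: diagonal_bij_def \<Psi>_def)
qed

end

text \<open>A box with maximal coordinate sum can always be removed.\<close>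
lemma ideal_induct [consumes 1, case_names empty add_corner]:
  assumes "ideal L" "P {}"
    and step: "\<And>L a b. ideal L \<Longrightarrow> ideal (insert (Suc a, Suc b) L) \<Longrightarrow> (Suc a, Suc b) \<notin> L \<Longrightarrow> P L
      \<Longrightarrow> P (insert (Suc a, Suc b) L)"
  shows "P L"
  using assms(1)
proof (induction "card L" arbitrary: L)
  case 0
  then show ?case
    using assms(2) by (auto simp: ideal_def)
next
  case (Suc n)
  then have fin: "finite L" and ne: "L \<noteq> {}"
    by (auto simp: ideal_def)
  define M where "M = Max ((\<lambda>d. fst d + snd d) ` L)"
  have "M \<in> (\<lambda>d. fst d + snd d) ` L"
    unfolding M_def by (rule Max_in) (use fin ne in auto)
  then obtain c where cL: "c \<in> L" and cM: "fst c + snd c = M"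
    by auto
  have c: "c \<in> L" "fst d + snd d \<le> fst c + snd c" if "d \<in> L" for d
    using Max_ge[of "(\<lambda>d. fst d + snd d) ` L" "fst d + snd d"] fin that cL cM by (auto simp: M_def)
  obtain a b where ab: "c = (Suc a, Suc b)"
    using idealD(1,2)[OF Suc.prems, of "fst c" "snd c"] cL
    by (cases c; cases "fst c"; cases "snd c") auto
  have "ideal (L - {c})"
  proof (rule idealI)
    fix i j i' j'
    assume ij: "(i, j) \<in> L - {c}" "0 < i'" "i' \<le> i" "0 < j'" "j' \<le> j"
    have "(i', j') \<noteq> c"
    proof
      assume "(i', j') = c"
      then have "i + j \<le> i' + j'"
        using c(2)[of "(i, j)"] ij(1) by auto
      then have "(i, j) = (i', j')"
        using ij by simp
      then show False
        using ij(1) \<open>(i', j') = c\<close> by blast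
    qed
    then show "(i', j') \<in> L - {c}"
      using idealD(3)[OF Suc.prems, of i j i' j'] ij by blast
  next
    fix i j assume "(i, j) \<in> L - {c}"
    then show "0 < i \<and> 0 < j"
      using idealD(1,2)[OF Suc.prems, of i j] by blast
  qed (use fin in simp)
  moreover have "insert (Suc a, Suc b) (L - {c}) = L"
    using cL ab by auto
  moreover have "P (L - {c})"
    by (rule Suc.hyps) (use Suc.hyps(2) cL fin \<open>ideal (L - {c})\<close> in auto)
  ultimately show ?case
    using step[of "L - {c}" a b] ab Suc.prems by auto
qed

theorem ex_diagonal_bij:
  assumes "ideal L"
  shows "\<exists>\<Phi>. diagonal_bij L \<Phi>"
  using assms
proof (induction rule: ideal_induct)
  case empty
  have "rpp {} = {\<lambda>_ _. 0}" "arrays {} = {\<lambda>_ _. 0}"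
    by (auto simp: rpp_def arrays_def fun_eq_iff)
  then have "diagonal_bij {} id"
    by (simp add: diagonal_bij_def)
  then show ?case
    by blast
next
  case (add_corner L a b)
  then show ?case
    using diagonal_bij_add_corner[of L "Suc a" "Suc b" a b] by auto
qed

section \<open>Counting plane partitions by weighted arrays\<close>
definition square :: "nat \<Rightarrow> (nat \<times> nat) set" where
  "square N = {1..N} \<times> {1..N}"

lemma ideal_square: "ideal (square N)"
  by (rule idealI) (auto simp: square_def)

text \<open>Each diagonal of a rectangle ends in its last column or in its last row.\<close>
lemma sum_diagonal_sum_rim:
  "(\<Sum>i\<in>{1..p}. \<Sum>j\<in>{1..q}. f i j) = (\<Sum>i\<in>{1..p}. diagonal_sum f i q) + (\<Sum>j<q. diagonal_sum f p j)"
proof (induction q arbitrary: p)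
  case (Suc q)
  show ?case
  proof (cases p)
    case (Suc p')
    have "(\<Sum>i\<in>{1..p}. diagonal_sum f i (Suc q)) = (\<Sum>i<Suc p'. f (Suc i) (Suc q)) + (\<Sum>i<Suc p'. diagonal_sum f i q)"
      by (simp only: Suc One_nat_def sum.atLeast1_atMost_eq diagonal_sum.simps sum.distrib)
    also have "(\<Sum>i<Suc p'. diagonal_sum f i q) = (\<Sum>i\<in>{1..p'}. diagonal_sum f i q)"
      by (simp only: sum.lessThan_Suc_shift One_nat_def sum.atLeast1_atMost_eq) simp
    also have "(\<Sum>i<Suc p'. f (Suc i) (Suc q)) = (\<Sum>i\<in>{1..p}. f i (Suc q))"
      by (simp only: Suc One_nat_def sum.atLeast1_atMost_eq)
    finally have 1: "(\<Sum>i\<in>{1..p}. diagonal_sum f i (Suc q)) = (\<Sum>i\<in>{1..p}. f i (Suc q)) + (\<Sum>i\<in>{1..p'}. diagonal_sum f i q)" .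
    have "(\<Sum>j<Suc q. diagonal_sum f p j) = (\<Sum>j<q. diagonal_sum f p (Suc j))"
      by (simp only: sum.lessThan_Suc_shift) simp
    also have "\<dots> = (\<Sum>j<q. f p (Suc j)) + (\<Sum>j<q. diagonal_sum f p' j)"
      by (simp add: Suc sum.distrib)
    also have "(\<Sum>j<q. f p (Suc j)) = (\<Sum>j\<in>{1..q}. f p j)"
      by (simp only: One_nat_def sum.atLeast1_atMost_eq)
    finally have 2: "(\<Sum>j<Suc q. diagonal_sum f p j) = (\<Sum>j\<in>{1..q}. f p j) + (\<Sum>j<q. diagonal_sum f p' j)" .
    have "(\<Sum>i\<in>{1..p}. \<Sum>j\<in>{1..Suc q}. f i j) = (\<Sum>i\<in>{1..p}. f i (Suc q)) + (\<Sum>i\<in>{1..p}. \<Sum>j\<in>{1..q}. f i j)"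
      by (simp add: sum.distrib)
    also have "(\<Sum>i\<in>{1..p}. \<Sum>j\<in>{1..q}. f i j) = (\<Sum>j\<in>{1..q}. f p j) + (\<Sum>i\<in>{1..p'}. \<Sum>j\<in>{1..q}. f i j)"
      by (simp add: Suc)
    also have "(\<Sum>i\<in>{1..p'}. \<Sum>j\<in>{1..q}. f i j) = (\<Sum>i\<in>{1..p'}. diagonal_sum f i q) + (\<Sum>j<q. diagonal_sum f p' j)"
      by (rule Suc.IH)
    finally show ?thesis
      using 1 2 by simp
  qed simp
qed simp

text \<open>The entry at \<open>(i, j)\<close> is counted once for each rim box weakly to the lower right of it, and these rim boxes are
  as many as the hook of \<open>(i, j)\<close> has boxes.\<close>
lemma sum_rect_sum_rim:
  "(\<Sum>i\<in>{1..N}. rect_sum f i N) + (\<Sum>j<N. rect_sum f N j) =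
     (\<Sum>i\<in>{1..N}. \<Sum>j\<in>{1..N}. (2 * N + 1 - i - j) * f i j)"
proof -
  have restrict: "(\<Sum>i'\<in>{1..i}. g i') = (\<Sum>i'\<in>{1..N}. if i' \<le> i then g i' else 0)"
    if "i \<le> N" for i and g :: "nat \<Rightarrow> nat"
    by (rule sum.mono_neutral_cong_left) (use that in auto)
  have count: "(\<Sum>i\<in>{1..N}. if i' \<le> i then c else 0) = (N + 1 - i') * c" if "i' \<in> {1..N}" for i' c :: nat
  proof -
    have "(\<Sum>i\<in>{1..N}. if i' \<le> i then c else 0) = (\<Sum>i\<in>{i'..N}. c)"
      by (rule sum.mono_neutral_cong_right) (use that in auto)
    then show ?thesis by simp
  qed
  have count': "(\<Sum>j<N. if j' \<le> j then c else 0) = (N - j') * c" for j' c :: nat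
  proof -
    have "(\<Sum>j<N. if j' \<le> j then c else 0) = (\<Sum>j\<in>{j'..<N}. c)"
      by (rule sum.mono_neutral_cong_right) auto
    then show ?thesis by simp
  qed
  have "(\<Sum>i\<in>{1..N}. rect_sum f i N) =
     (\<Sum>i\<in>{1..N}. \<Sum>i'\<in>{1..N}. if i' \<le> i then (\<Sum>j'\<in>{1..N}. f i' j') else 0)"
    unfolding rect_sum_def by (intro sum.cong refl restrict) auto
  also have "\<dots> = (\<Sum>i'\<in>{1..N}. \<Sum>i\<in>{1..N}. if i' \<le> i then (\<Sum>j'\<in>{1..N}. f i' j') else 0)"
    by (rule sum.swap)
  also have "\<dots> = (\<Sum>i'\<in>{1..N}. (N + 1 - i') * (\<Sum>j'\<in>{1..N}. f i' j'))"
    by (intro sum.cong refl count)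
  finally have 1: "(\<Sum>i\<in>{1..N}. rect_sum f i N) = (\<Sum>i\<in>{1..N}. \<Sum>j\<in>{1..N}. (N + 1 - i) * f i j)"
    by (simp add: sum_distrib_left)
  have "(\<Sum>j<N. rect_sum f N j) = (\<Sum>j<N. \<Sum>i\<in>{1..N}. \<Sum>j'\<in>{1..N}. if j' \<le> j then f i j' else 0)"
    unfolding rect_sum_def by (intro sum.cong refl restrict) auto
  also have "\<dots> = (\<Sum>i\<in>{1..N}. \<Sum>j<N. \<Sum>j'\<in>{1..N}. if j' \<le> j then f i j' else 0)"
    by (rule sum.swap)
  also have "\<dots> = (\<Sum>i\<in>{1..N}. \<Sum>j'\<in>{1..N}. \<Sum>j<N. if j' \<le> j then f i j' else 0)"
    by (rule sum.cong[OF refl], rule sum.swap)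
  also have "\<dots> = (\<Sum>i\<in>{1..N}. \<Sum>j\<in>{1..N}. (N - j) * f i j)"
    by (intro sum.cong refl count')
  finally have 2: "(\<Sum>j<N. rect_sum f N j) = (\<Sum>i\<in>{1..N}. \<Sum>j\<in>{1..N}. (N - j) * f i j)" .
  show ?thesis
    unfolding 1 2 sum.distrib[symmetric] add_mult_distrib[symmetric]
    by (intro sum.cong refl arg_cong2[of _ _ _ _ "(*)"]) auto
qed

lemma card_rpp_square:
  "card {p \<in> rpp (square N). (\<Sum>(i, j)\<in>square N. p i j) = n} =
   card {f \<in> arrays (square N). (\<Sum>(i, j)\<in>square N. (2 * N + 1 - i - j) * f i j) = n}"
proof -
  obtain \<Phi> where "diagonal_bij (square N) \<Phi>"
    using ex_diagonal_bij[OF ideal_square] by blast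
  then have bij: "bij_betw \<Phi> (rpp (square N)) (arrays (square N))"
    and tr: "\<And>p i j. p \<in> rpp (square N) \<Longrightarrow> (i, j) \<in> square N \<Longrightarrow> (Suc i, Suc j) \<notin> square N
      \<Longrightarrow> diagonal_sum p i j = rect_sum (\<Phi> p) i j"
    by (auto simp: diagonal_bij_def)
  have weight: "(\<Sum>(i, j)\<in>square N. p i j) = (\<Sum>(i, j)\<in>square N. (2 * N + 1 - i - j) * \<Phi> p i j)"
    if p: "p \<in> rpp (square N)" for p
  proof -
    have rim: "diagonal_sum p i j = rect_sum (\<Phi> p) i j" if "i = N \<or> j = N" "i \<le> N" "j \<le> N" for i j
    proof (cases "i = 0 \<or> j = 0")
      case False
      then show ?thesis
        using that by (intro tr p) (auto simp: square_def)
    qed auto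
    have "(\<Sum>(i, j)\<in>square N. p i j) = (\<Sum>i\<in>{1..N}. diagonal_sum p i N) + (\<Sum>j<N. diagonal_sum p N j)"
      unfolding square_def sum.cartesian_product[symmetric] by (rule sum_diagonal_sum_rim)
    also have "\<dots> = (\<Sum>i\<in>{1..N}. rect_sum (\<Phi> p) i N) + (\<Sum>j<N. rect_sum (\<Phi> p) N j)"
      by (intro arg_cong2[of _ _ _ _ "(+)"] sum.cong refl rim) auto
    also have "\<dots> = (\<Sum>(i, j)\<in>square N. (2 * N + 1 - i - j) * \<Phi> p i j)"
      unfolding square_def sum.cartesian_product[symmetric] by (rule sum_rect_sum_rim)
    finally show ?thesis .
  qed
  have "bij_betw \<Phi> {p \<in> rpp (square N). (\<Sum>(i, j)\<in>square N. p i j) = n}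
     {f \<in> arrays (square N). (\<Sum>(i, j)\<in>square N. (2 * N + 1 - i - j) * f i j) = n}"
    by (rule bij_betw_Collect[OF bij]) (simp add: weight)
  then show ?thesis
    by (rule bij_betw_same_card)
qed

text \<open>Rotation by half a turn. A plane partition of \<open>n\<close> fits into the square of side \<open>n\<close>, hence into all larger squares.\<close>
lemma PL_eq_card_rpp:
  assumes "n \<le> N"
  shows "PL n = card {p \<in> rpp (square N). (\<Sum>(i, j)\<in>square N. p i j) = n}"
proof -
  define R where "R = (\<lambda>(\<pi> :: nat \<Rightarrow> nat \<Rightarrow> nat) i j. if (i, j) \<in> square N then \<pi> (N - i) (N - j) else 0)"
  define R' where "R' = (\<lambda>(p :: nat \<Rightarrow> nat \<Rightarrow> nat) i j. if i < N \<and> j < N then p (N - i) (N - j) else 0)"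
  have reindex: "(\<Sum>(i, j)\<in>square N. g (N - i) (N - j)) = (\<Sum>(i, j)\<in>{..<N} \<times> {..<N}. g i j)"
    for g :: "nat \<Rightarrow> nat \<Rightarrow> nat"
    by (rule sum.reindex_bij_witness[where i = "\<lambda>(i, j). (N - i, N - j)" and j = "\<lambda>(i, j). (N - i, N - j)"])
      (auto simp: square_def)
  have size: "is_plane_partition n \<pi> \<longleftrightarrow>
      (\<forall>i j. \<pi> i (Suc j) \<le> \<pi> i j) \<and> (\<forall>i j. \<pi> (Suc i) j \<le> \<pi> i j) \<and>
      (\<Sum>(i, j)\<in>{..<N} \<times> {..<N}. \<pi> i j) = n"
    if supp: "{(i, j). \<pi> i j \<noteq> 0} \<subseteq> {..<N} \<times> {..<N}" for \<pi>
  proof -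
    have "(\<Sum>(i, j)\<in>{(i, j). \<pi> i j \<noteq> 0}. \<pi> i j) = (\<Sum>(i, j)\<in>{..<N} \<times> {..<N}. \<pi> i j)"
      by (rule sum.mono_neutral_left) (use supp in auto)
    moreover have "finite {(i, j). \<pi> i j \<noteq> 0}"
      by (rule finite_subset[OF supp]) auto
    ultimately show ?thesis
      by (simp add: is_plane_partition_def)
  qed
  have "bij_betw R {\<pi>. is_plane_partition n \<pi>} {p \<in> rpp (square N). (\<Sum>(i, j)\<in>square N. p i j) = n}"
  proof (rule bij_betw_byWitness[where f' = R'])
    have supp: "{(i, j). \<pi> i j \<noteq> 0} \<subseteq> {..<N} \<times> {..<N}" if "is_plane_partition n \<pi>" for \<pi>
      using is_plane_partition_support[OF that] assms by fastforce
    show "\<forall>\<pi>\<in>{\<pi>. is_plane_partition n \<pi>}. R' (R \<pi>) = \<pi>"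
    proof (safe, intro ext)
      fix \<pi> i j assume "is_plane_partition n \<pi>"
      then have "\<not> (i < N \<and> j < N) \<Longrightarrow> \<pi> i j = 0"
        using supp by blast
      then show "R' (R \<pi>) i j = \<pi> i j"
        by (auto simp: R_def R'_def square_def)
    qed
    show "\<forall>p\<in>{p \<in> rpp (square N). (\<Sum>(i, j)\<in>square N. p i j) = n}. R (R' p) = p"
    proof (safe, intro ext)
      fix p i j assume "p \<in> rpp (square N)"
      then have "(i, j) \<notin> square N \<Longrightarrow> p i j = 0"
        by (simp add: rpp_def arrays_def)
      then show "R (R' p) i j = p i j"
        by (auto simp: R_def R'_def square_def)
    qed
    show "R ` {\<pi>. is_plane_partition n \<pi>} \<subseteq> {p \<in> rpp (square N). (\<Sum>(i, j)\<in>square N. p i j) = n}"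
    proof safe
      fix \<pi> assume pp: "is_plane_partition n \<pi>"
      have "(\<Sum>(i, j)\<in>square N. R \<pi> i j) = (\<Sum>(i, j)\<in>square N. \<pi> (N - i) (N - j))"
        by (intro sum.cong) (auto simp: R_def)
      also have "\<dots> = n"
        unfolding reindex using size[OF supp[OF pp]] pp by blast
      finally show "(\<Sum>(i, j)\<in>square N. R \<pi> i j) = n" .
      have "R \<pi> (i - 1) j \<le> R \<pi> i j \<and> R \<pi> i (j - 1) \<le> R \<pi> i j" if "(i, j) \<in> square N" for i j
      proof -
        have ij: "1 \<le> i" "i \<le> N" "1 \<le> j" "j \<le> N"
          using that by (auto simp: square_def)
        then have "N - (i - 1) = Suc (N - i)" "N - (j - 1) = Suc (N - j)"
          by linarith+
        moreover have "\<pi> (Suc (N - i)) (N - j) \<le> \<pi> (N - i) (N - j)" "\<pi> (N - i) (Suc (N - j)) \<le> \<pi> (N - i) (N - j)"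
          using pp unfolding is_plane_partition_def by blast+
        ultimately show ?thesis
          using that unfolding R_def by simp
      qed
      then show "R \<pi> \<in> rpp (square N)"
        by (auto simp: rpp_def arrays_def R_def)
    qed
    show "R' ` {p \<in> rpp (square N). (\<Sum>(i, j)\<in>square N. p i j) = n} \<subseteq> {\<pi>. is_plane_partition n \<pi>}"
    proof safe
      fix p assume p: "p \<in> rpp (square N)" and n: "n = (\<Sum>(i, j)\<in>square N. p i j)"
      have "(\<Sum>(i, j)\<in>{..<N} \<times> {..<N}. R' p i j) = (\<Sum>(i, j)\<in>square N. R' p (N - i) (N - j))"
        by (rule reindex[symmetric])
      also have "\<dots> = (\<Sum>(i, j)\<in>square N. p i j)"
        by (intro sum.cong) (auto simp: R'_def square_def)
      finally have "(\<Sum>(i, j)\<in>{..<N} \<times> {..<N}. R' p i j) = (\<Sum>(i, j)\<in>square N. p i j)" .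
      moreover have "R' p i (Suc j) \<le> R' p i j" for i j
      proof (cases "i < N \<and> Suc j < N")
        case True
        then have "(N - i, Suc (N - Suc j)) \<in> square N"
          by (auto simp: square_def)
        from rpp_Suc(2)[OF p this] True show ?thesis
          by (simp add: R'_def Suc_diff_Suc)
      qed (auto simp: R'_def)
      moreover have "R' p (Suc i) j \<le> R' p i j" for i j
      proof (cases "Suc i < N \<and> j < N")
        case True
        then have "(Suc (N - Suc i), N - j) \<in> square N"
          by (auto simp: square_def)
        from rpp_Suc(1)[OF p this] True show ?thesis
          by (simp add: R'_def Suc_diff_Suc)
      qed (auto simp: R'_def)
      moreover have "{(i, j). R' p i j \<noteq> 0} \<subseteq> {..<N} \<times> {..<N}"
        by (auto simp: R'_def split: if_splits)
      ultimately show "is_plane_partition (\<Sum>(i, j)\<in>square N. p i j) (R' p)"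
        using size[of "R' p"] unfolding n by blast
    qed
  qed
  then show ?thesis
    unfolding PL_def by (rule bij_betw_same_card)
qed

definition weighted :: "'a set \<Rightarrow> ('a \<Rightarrow> nat) \<Rightarrow> nat \<Rightarrow> ('a \<Rightarrow> nat) set" where
  "weighted L h n = {f. (\<forall>u. u \<notin> L \<longrightarrow> f u = 0) \<and> (\<Sum>u\<in>L. h u * f u) = n}"

lemma weighted_le:
  assumes "finite L" "\<And>u. u \<in> L \<Longrightarrow> 0 < h u" "f \<in> weighted L h n"
  shows "f u \<le> n"
proof (cases "u \<in> L")
  case True
  have "f u \<le> h u * f u"
    using assms(2)[OF True] by simp
  also have "\<dots> \<le> (\<Sum>u\<in>L. h u * f u)"
    by (rule member_le_sum) (use True assms(1) in auto)
  finally show ?thesis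
    using assms(3) by (simp add: weighted_def)
qed (use assms(3) in \<open>simp add: weighted_def\<close>)

lemma finite_weighted:
  assumes "finite L" "\<And>u. u \<in> L \<Longrightarrow> 0 < h u"
  shows "finite (weighted L h n)"
proof (rule finite_subset)
  show "weighted L h n \<subseteq> {f. \<forall>u. (u \<in> L \<longrightarrow> f u \<in> {..n}) \<and> (u \<notin> L \<longrightarrow> f u = 0)}"
    using weighted_le[OF assms] by (auto simp: weighted_def)
  show "finite {f. \<forall>u. (u \<in> L \<longrightarrow> f u \<in> {..n}) \<and> (u \<notin> L \<longrightarrow> f u = 0)}"
    by (rule finite_set_of_finite_funs) (use assms(1) in auto)
qed

text \<open>Subtracting \<open>r\<close> at \<open>u\<close> is a bijection onto the arrays of weight \<open>n - r * h u\<close>.\<close>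
lemma card_weighted_ge:
  assumes "finite L" "u \<in> L"
  shows "card {f \<in> weighted L h n. r \<le> f u} = (if r * h u \<le> n then card (weighted L h (n - r * h u)) else 0)"
proof -
  have upd: "(\<Sum>v\<in>L. h v * (f(u := x)) v) + h u * f u = (\<Sum>v\<in>L. h v * f v) + h u * x" for f x
    by (simp add: sum.remove[OF assms])
  show ?thesis
  proof (cases "r * h u \<le> n")
    case True
    have "bij_betw (\<lambda>f. f(u := f u - r)) {f \<in> weighted L h n. r \<le> f u} (weighted L h (n - r * h u))"
    proof (rule bij_betw_byWitness[where f' = "\<lambda>f. f(u := f u + r)"])
      show "(\<lambda>f. f(u := f u - r)) ` {f \<in> weighted L h n. r \<le> f u} \<subseteq> weighted L h (n - r * h u)"
      proof safe
        fix f assume f: "f \<in> weighted L h n" "r \<le> f u"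
        have "(\<Sum>v\<in>L. h v * (f(u := f u - r)) v) + h u * f u = n + h u * (f u - r)"
          using upd[of f "f u - r"] f(1) by (simp add: weighted_def)
        moreover have "h u * f u = h u * (f u - r) + r * h u"
        proof -
          from f(2) obtain m where "f u = r + m"
            by (auto simp: le_iff_add)
          then show ?thesis
            by (simp add: algebra_simps)
        qed
        ultimately have "(\<Sum>v\<in>L. h v * (f(u := f u - r)) v) = n - r * h u"
          by linarith
        then show "f(u := f u - r) \<in> weighted L h (n - r * h u)"
          using f(1) assms(2) by (auto simp: weighted_def)
      qed
      show "(\<lambda>f. f(u := f u + r)) ` weighted L h (n - r * h u) \<subseteq> {f \<in> weighted L h n. r \<le> f u}"
      proof safe
        fix f assume f: "f \<in> weighted L h (n - r * h u)"
        have "(\<Sum>v\<in>L. h v * (f(u := f u + r)) v) + h u * f u = n - r * h u + h u * (f u + r)"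
          using upd[of f "f u + r"] f by (simp add: weighted_def)
        then have "(\<Sum>v\<in>L. h v * (f(u := f u + r)) v) = n"
          using True by (simp add: algebra_simps)
        then show "f(u := f u + r) \<in> weighted L h n"
          using f assms(2) by (auto simp: weighted_def)
      qed simp
    qed auto
    then show ?thesis
      using True bij_betw_same_card by auto
  next
    case False
    have "h u * f u \<le> n" if "f \<in> weighted L h n" for f
      using member_le_sum[of u L "\<lambda>u. h u * f u"] assms that by (simp add: weighted_def)
    moreover have "r * h u \<le> h u * f u" if "r \<le> f u" for f
      using that by (simp add: mult.commute)
    ultimately have none: "{f \<in> weighted L h n. r \<le> f u} = {}"
      using False le_trans by blast
    show ?thesis
      unfolding none using False by simp
  qed
qed

text \<open>The logarithmic derivative of the product generating function, in counting form: the total weight of all arrays of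
  weight \<open>n\<close> is computed box by box, writing each entry \<open>f u\<close> as the number of \<open>r\<close> with \<open>1 \<le> r \<le> f u\<close>.\<close>
lemma weighted_recurrence:
  assumes "finite L" "\<And>u. u \<in> L \<Longrightarrow> 0 < h u"
  shows "n * card (weighted L h n) =
    (\<Sum>u\<in>L. \<Sum>r\<in>{1..n}. if r * h u \<le> n then h u * card (weighted L h (n - r * h u)) else 0)"
proof -
  let ?W = "weighted L h n"
  note fin = finite_weighted[OF assms]
  have val: "f u = (\<Sum>r\<in>{1..n}. if r \<le> f u then 1 else 0)" if "f \<in> ?W" for f u
  proof -
    have "(\<Sum>r\<in>{1..n}. if r \<le> f u then 1 else 0) = card {r \<in> {1..n}. r \<le> f u}"
      by (simp add: sum.inter_filter[symmetric])
    also have "{r \<in> {1..n}. r \<le> f u} = {1..f u}"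
      using weighted_le[OF assms that, of u] by auto
    finally show ?thesis by simp
  qed
  have "n * card ?W = (\<Sum>f\<in>?W. \<Sum>u\<in>L. h u * f u)"
    by (simp add: weighted_def)
  also have "\<dots> = (\<Sum>u\<in>L. \<Sum>f\<in>?W. h u * f u)"
    by (rule sum.swap)
  also have "\<dots> = (\<Sum>u\<in>L. \<Sum>r\<in>{1..n}. if r * h u \<le> n then h u * card (weighted L h (n - r * h u)) else 0)"
  proof (rule sum.cong[OF refl])
    fix u assume u: "u \<in> L"
    have "(\<Sum>f\<in>?W. h u * f u) = h u * (\<Sum>f\<in>?W. \<Sum>r\<in>{1..n}. if r \<le> f u then 1 else 0)"
      unfolding sum_distrib_left[symmetric] by (intro arg_cong2[of _ _ _ _ "(*)"] refl sum.cong val)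
    also have "(\<Sum>f\<in>?W. \<Sum>r\<in>{1..n}. if r \<le> f u then 1 else 0) = (\<Sum>r\<in>{1..n}. card {f \<in> ?W. r \<le> f u})"
      by (subst sum.swap) (simp add: sum.inter_filter[symmetric] fin)
    also have "\<dots> = (\<Sum>r\<in>{1..n}. if r * h u \<le> n then card (weighted L h (n - r * h u)) else 0)"
      by (simp add: card_weighted_ge[OF assms(1) u])
    finally show "(\<Sum>f\<in>?W. h u * f u) =
        (\<Sum>r\<in>{1..n}. if r * h u \<le> n then h u * card (weighted L h (n - r * h u)) else 0)"
      by (simp add: sum_distrib_left if_distrib cong: if_cong)
  qed
  finally show ?thesis .
qed

lemma PL_eq_card_weighted:
  assumes "n \<le> N"
  shows "PL n = card (weighted (square N) (\<lambda>(i, j). 2 * N + 1 - i - j) n)"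
proof -
  have "bij_betw (\<lambda>f. case_prod f) {f \<in> arrays (square N). (\<Sum>(i, j)\<in>square N. (2 * N + 1 - i - j) * f i j) = n}
     (weighted (square N) (\<lambda>(i, j). 2 * N + 1 - i - j) n)"
    by (rule bij_betw_byWitness[where f' = curry])
      (auto simp: weighted_def arrays_def case_prod_unfold curry_def)
  then show ?thesis
    unfolding PL_eq_card_rpp[OF assms] card_rpp_square by (rule bij_betw_same_card)
qed

definition sigma2 :: "nat \<Rightarrow> nat" where
  "sigma2 k = (\<Sum>d | d dvd k. d ^ 2)"

lemma PL_0: "PL 0 = 1"
proof -
  have "weighted (square 0) (\<lambda>(i, j). 2 * 0 + 1 - i - j) 0 = {\<lambda>_. 0}"
    by (auto simp: weighted_def square_def)
  then show ?thesis
    by (simp add: PL_eq_card_weighted[of 0 0])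
qed

text \<open>In the square of side \<open>n\<close> there are exactly \<open>k\<close> boxes of hook length \<open>k \<le> n\<close>, each contributing a factor \<open>k\<close>
  for every multiple of \<open>k\<close>; collecting the multiples gives the divisor sums.\<close>
theorem PL_recurrence: "n * PL n = (\<Sum>k\<in>{1..n}. sigma2 k * PL (n - k))"
proof -
  let ?h = "\<lambda>(i, j). 2 * n + 1 - i - j"
  let ?T = "\<lambda>k. \<Sum>r\<in>{1..n}. if r * k \<le> n then k * PL (n - r * k) else 0"
  have "n * PL n = (\<Sum>u\<in>square n. \<Sum>r\<in>{1..n}.
      if r * ?h u \<le> n then ?h u * card (weighted (square n) ?h (n - r * ?h u)) else 0)"
    unfolding PL_eq_card_weighted[OF order_refl]
    by (rule weighted_recurrence) (auto simp: square_def)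
  also have "\<dots> = (\<Sum>u\<in>square n. ?T (?h u))"
    by (intro sum.cong refl if_cong) (simp add: PL_eq_card_weighted[of _ n])
  also have "\<dots> = (\<Sum>u\<in>{u\<in>square n. ?h u \<le> n}. ?T (?h u))"
  proof (rule sum.mono_neutral_right)
    show "\<forall>u\<in>square n - {u \<in> square n. ?h u \<le> n}. ?T (?h u) = 0"
    proof
      fix u assume u: "u \<in> square n - {u \<in> square n. ?h u \<le> n}"
      have "\<not> r * ?h u \<le> n" if "r \<in> {1..n}" for r
      proof -
        have "?h u \<le> r * ?h u"
          using that mult_le_mono1[of 1 r "?h u"] by auto
        moreover have "n < ?h u"
          using u by auto
        ultimately show ?thesis
          by linarith
      qed
      then show "?T (?h u) = 0"
        by simp
    qed
  qed (auto simp: square_def)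
  also have "\<dots> = (\<Sum>k\<in>{1..n}. \<Sum>u\<in>{u\<in>{u\<in>square n. ?h u \<le> n}. ?h u = k}. ?T (?h u))"
    by (rule sum.group[symmetric]) (auto simp: square_def)
  also have "\<dots> = (\<Sum>k\<in>{1..n}. k * ?T k)"
  proof (rule sum.cong[OF refl])
    fix k assume k: "k \<in> {1..n}"
    have "card {u\<in>{u\<in>square n. ?h u \<le> n}. ?h u = k} = card {1..k}"
      by (rule bij_betw_same_card[where f = "\<lambda>(i, j). n + 1 - i"],
          rule bij_betw_byWitness[where f' = "\<lambda>m. (n + 1 - m, n + m - k)"])
        (use k in \<open>auto simp: square_def\<close>)
    moreover have "(\<Sum>u\<in>{u\<in>{u\<in>square n. ?h u \<le> n}. ?h u = k}. ?T (?h u)) =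
        (\<Sum>u\<in>{u\<in>{u\<in>square n. ?h u \<le> n}. ?h u = k}. ?T k)"
      by (rule sum.cong[OF refl]) (simp only: mem_Collect_eq)
    ultimately show "(\<Sum>u\<in>{u\<in>{u\<in>square n. ?h u \<le> n}. ?h u = k}. ?T (?h u)) = k * ?T k"
      by (simp only: sum_constant card_atLeastAtMost) simp
  qed
  also have "\<dots> = (\<Sum>k\<in>{1..n}. \<Sum>r\<in>{1..n}. \<Sum>m\<in>{1..n}. if m = r * k then k ^ 2 * PL (n - m) else 0)"
    unfolding sum_distrib_left by (intro sum.cong refl) (auto simp: power2_eq_square sum.delta)
  also have "\<dots> = (\<Sum>k\<in>{1..n}. \<Sum>m\<in>{1..n}. \<Sum>r\<in>{1..n}. if m = r * k then k ^ 2 * PL (n - m) else 0)"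
    by (rule sum.cong[OF refl], rule sum.swap)
  also have "\<dots> = (\<Sum>m\<in>{1..n}. \<Sum>k\<in>{1..n}. \<Sum>r\<in>{1..n}. if m = r * k then k ^ 2 * PL (n - m) else 0)"
    by (rule sum.swap)
  also have "\<dots> = (\<Sum>m\<in>{1..n}. sigma2 m * PL (n - m))"
  proof (rule sum.cong[OF refl])
    fix m assume m: "m \<in> {1..n}"
    have "(\<Sum>r\<in>{1..n}. if m = r * k then k ^ 2 * PL (n - m) else 0) = (if k dvd m then k ^ 2 * PL (n - m) else 0)"
      if k: "k \<in> {1..n}" for k
    proof (cases "k dvd m")
      case True
      then obtain r where r: "m = k * r" ..
      have "r dvd m" "0 < m"
        using m r by auto
      then have "r \<in> {1..n}"
        using m dvd_imp_le[of r m] dvd_pos_nat[of m r] by auto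
      moreover have "m = r' * k \<longleftrightarrow> r' = r" for r'
        using k by (auto simp: r)
      ultimately show ?thesis
        using True by (simp add: sum.delta)
    next
      case False
      then have "m \<noteq> r * k" for r by auto
      then show ?thesis using False by simp
    qed
    then have "(\<Sum>k\<in>{1..n}. \<Sum>r\<in>{1..n}. if m = r * k then k ^ 2 * PL (n - m) else 0)
       = (\<Sum>k\<in>{1..n}. if k dvd m then k ^ 2 * PL (n - m) else 0)"
      by (intro sum.cong refl)
    also have "\<dots> = (\<Sum>k | k dvd m. k ^ 2 * PL (n - m))"
    proof (rule sum.mono_neutral_cong_right)
      show "{k. k dvd m} \<subseteq> {1..n}"
      proof
        fix k assume "k \<in> {k. k dvd m}"
        then have "k dvd m" "0 < m"
          using m by auto
        then show "k \<in> {1..n}"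
          using m dvd_imp_le[of k m] dvd_pos_nat[of m k] by auto
      qed
    qed auto
    finally show "(\<Sum>k\<in>{1..n}. \<Sum>r\<in>{1..n}. if m = r * k then k ^ 2 * PL (n - m) else 0) = sigma2 m * PL (n - m)"
      by (simp add: sigma2_def sum_distrib_right)
  qed
  finally show ?thesis .
qed

section \<open>Sums of powers against a geometric weight\<close>
lemma partial_sum_series:
  fixes a :: "nat \<Rightarrow> real"
  assumes q: "0 \<le> q" "q < 1" and a: "\<And>m. 0 \<le> a m" and s: "(\<lambda>m. a m * q ^ m) sums s"
    and b: "\<And>m. b m = (\<Sum>i\<le>m. a i)"
  shows "(\<lambda>m. b m * q ^ m) sums (s / (1 - q))"
proof -
  have "(\<lambda>m. \<Sum>i\<le>m. (a i * q ^ i) * q ^ (m - i)) sums ((\<Sum>m. a m * q ^ m) * (\<Sum>m. q ^ m))"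
    using q a s sums_summable[OF s] by (intro Cauchy_product_sums) (auto simp: abs_mult summable_geometric)
  moreover have "(\<Sum>i\<le>m. (a i * q ^ i) * q ^ (m - i)) = b m * q ^ m" for m
    unfolding b sum_distrib_right by (intro sum.cong refl) (simp add: power_add[symmetric])
  ultimately show ?thesis
    using q sums_unique[OF s] by (simp add: suminf_geometric)
qed

lemma binomial_series:
  fixes q :: real
  assumes q: "0 \<le> q" "q < 1"
  shows "(\<lambda>m. (real m + 1) * q ^ m) sums (1 / (1 - q) ^ 2)"
    "(\<lambda>m. (real m + 1) * (real m + 2) / 2 * q ^ m) sums (1 / (1 - q) ^ 3)"
    "(\<lambda>m. (real m + 1) * (real m + 2) * (real m + 3) / 6 * q ^ m) sums (1 / (1 - q) ^ 4)"
    "(\<lambda>m. (real m + 1) * (real m + 2) * (real m + 3) * (real m + 4) / 24 * q ^ m) sums (1 / (1 - q) ^ 5)"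
proof -
  have 1: "(\<lambda>m. q ^ m) sums (1 / (1 - q))"
    using q by (intro geometric_sums) auto
  have 2: "(\<lambda>m. (real m + 1) * q ^ m) sums (1 / (1 - q) / (1 - q))"
    by (rule partial_sum_series[OF q, of "\<lambda>_. 1"]) (use 1 in auto)
  then show "(\<lambda>m. (real m + 1) * q ^ m) sums (1 / (1 - q) ^ 2)"
    by (simp add: power_numeral_reduce)
  have 3: "(\<lambda>m. (real m + 1) * (real m + 2) / 2 * q ^ m) sums (1 / (1 - q) / (1 - q) / (1 - q))"
  proof (rule partial_sum_series[OF q _ 2])
    show "(real m + 1) * (real m + 2) / 2 = (\<Sum>i\<le>m. real i + 1)" for m
      by (induction m) (simp_all add: field_simps)
  qed simp
  then show "(\<lambda>m. (real m + 1) * (real m + 2) / 2 * q ^ m) sums (1 / (1 - q) ^ 3)"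
    by (simp add: power_numeral_reduce mult.assoc)
  have 4: "(\<lambda>m. (real m + 1) * (real m + 2) * (real m + 3) / 6 * q ^ m)
      sums (1 / (1 - q) / (1 - q) / (1 - q) / (1 - q))"
  proof (rule partial_sum_series[OF q _ 3])
    show "(real m + 1) * (real m + 2) * (real m + 3) / 6 = (\<Sum>i\<le>m. (real i + 1) * (real i + 2) / 2)" for m
      by (induction m) (simp_all add: field_simps)
  qed simp
  then show "(\<lambda>m. (real m + 1) * (real m + 2) * (real m + 3) / 6 * q ^ m) sums (1 / (1 - q) ^ 4)"
    by (simp add: power_numeral_reduce mult.assoc)
  have 5: "(\<lambda>m. (real m + 1) * (real m + 2) * (real m + 3) * (real m + 4) / 24 * q ^ m)
      sums (1 / (1 - q) / (1 - q) / (1 - q) / (1 - q) / (1 - q))"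
  proof (rule partial_sum_series[OF q _ 4])
    show "(real m + 1) * (real m + 2) * (real m + 3) * (real m + 4) / 24 =
        (\<Sum>i\<le>m. (real i + 1) * (real i + 2) * (real i + 3) / 6)" for m
      by (induction m) (simp_all add: field_simps)
  qed simp
  then show "(\<lambda>m. (real m + 1) * (real m + 2) * (real m + 3) * (real m + 4) / 24 * q ^ m) sums (1 / (1 - q) ^ 5)"
    by (simp add: power_numeral_reduce mult.assoc)
qed

text \<open>Powers of \<open>m + 1\<close> are combined from the coefficients of \<open>(1 - q) ^ (- k)\<close>. The closed forms are polynomials in
  \<open>P\<close>, times \<open>R\<close> for even powers; with \<open>q = exp (- x)\<close> one has \<open>P = 1 / (4 * (sinh (x / 2))\<^sup>2)\<close> and
  \<open>R = coth (x / 2)\<close>, so the size of \<open>P\<close> controls them all.\<close>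
lemma sum_power_le:
  fixes q :: real
  assumes q: "0 < q" "q < 1" and P: "P = q / (1 - q)\<^sup>2" and R: "R = (1 + q) / (1 - q)"
  shows "(\<Sum>m\<in>{1..M}. real m ^ 2 * q ^ m) \<le> R * P"
    "(\<Sum>m\<in>{1..M}. real m ^ 3 * q ^ m) \<le> 6 * P\<^sup>2 + P"
    "(\<Sum>m\<in>{1..M}. real m ^ 4 * q ^ m) \<le> R * (P + 12 * P\<^sup>2)"
proof -
  note S = binomial_series[of q]
  have partial: "(\<Sum>m\<in>{1..M}. real m ^ j * q ^ m) \<le> q * s"
    if "(\<lambda>m. (real m + 1) ^ j * q ^ m) sums s" for j s
  proof -
    have "(\<Sum>m\<in>{1..M}. real m ^ j * q ^ m) = q * (\<Sum>m<M. (real m + 1) ^ j * q ^ m)"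
      by (simp add: sum.atLeast1_atMost_eq sum_distrib_left algebra_simps)
    also have "\<dots> \<le> q * s"
      using q sum_le_suminf[OF sums_summable[OF that], of "{..<M}"] sums_unique[OF that]
      by (intro mult_left_mono) auto
    finally show ?thesis .
  qed
  have nz: "1 - q \<noteq> 0"
    using q by simp
  have "(\<lambda>m. 2 * ((real m + 1) * (real m + 2) / 2 * q ^ m) - (real m + 1) * q ^ m) sums
      (2 * (1 / (1 - q) ^ 3) - 1 / (1 - q) ^ 2)"
    by (intro sums_diff sums_mult S) (use q in auto)
  moreover have "2 * ((real m + 1) * (real m + 2) / 2 * q ^ m) - (real m + 1) * q ^ m = (real m + 1) ^ 2 * q ^ m" for m
    by algebra
  ultimately have "(\<lambda>m. (real m + 1) ^ 2 * q ^ m) sums (2 * (1 / (1 - q) ^ 3) - 1 / (1 - q) ^ 2)"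
    by simp
  from partial[OF this] show "(\<Sum>m\<in>{1..M}. real m ^ 2 * q ^ m) \<le> R * P"
    by (rule order_trans) (use nz in \<open>simp add: P R divide_simps, simp add: algebra_simps power_numeral_reduce\<close>)
  have "(\<lambda>m. 6 * ((real m + 1) * (real m + 2) * (real m + 3) / 6 * q ^ m)
        - 6 * ((real m + 1) * (real m + 2) / 2 * q ^ m) + (real m + 1) * q ^ m) sums
      (6 * (1 / (1 - q) ^ 4) - 6 * (1 / (1 - q) ^ 3) + 1 / (1 - q) ^ 2)"
    by (intro sums_add sums_diff sums_mult S) (use q in auto)
  moreover have "6 * ((real m + 1) * (real m + 2) * (real m + 3) / 6 * q ^ m)
        - 6 * ((real m + 1) * (real m + 2) / 2 * q ^ m) + (real m + 1) * q ^ m = (real m + 1) ^ 3 * q ^ m" for m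
    by algebra
  ultimately have "(\<lambda>m. (real m + 1) ^ 3 * q ^ m) sums (6 * (1 / (1 - q) ^ 4) - 6 * (1 / (1 - q) ^ 3) + 1 / (1 - q) ^ 2)"
    by simp
  from partial[OF this] show "(\<Sum>m\<in>{1..M}. real m ^ 3 * q ^ m) \<le> 6 * P\<^sup>2 + P"
    by (rule order_trans) (use nz in \<open>simp add: P R divide_simps, simp add: algebra_simps power_numeral_reduce\<close>)
  have "(\<lambda>m. 24 * ((real m + 1) * (real m + 2) * (real m + 3) * (real m + 4) / 24 * q ^ m)
        - 36 * ((real m + 1) * (real m + 2) * (real m + 3) / 6 * q ^ m)
        + 14 * ((real m + 1) * (real m + 2) / 2 * q ^ m) - (real m + 1) * q ^ m) sums
      (24 * (1 / (1 - q) ^ 5) - 36 * (1 / (1 - q) ^ 4) + 14 * (1 / (1 - q) ^ 3) - 1 / (1 - q) ^ 2)"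
    by (intro sums_add sums_diff sums_mult S) (use q in auto)
  moreover have "24 * ((real m + 1) * (real m + 2) * (real m + 3) * (real m + 4) / 24 * q ^ m)
        - 36 * ((real m + 1) * (real m + 2) * (real m + 3) / 6 * q ^ m)
        + 14 * ((real m + 1) * (real m + 2) / 2 * q ^ m) - (real m + 1) * q ^ m = (real m + 1) ^ 4 * q ^ m" for m
    by algebra
  ultimately have "(\<lambda>m. (real m + 1) ^ 4 * q ^ m) sums
      (24 * (1 / (1 - q) ^ 5) - 36 * (1 / (1 - q) ^ 4) + 14 * (1 / (1 - q) ^ 3) - 1 / (1 - q) ^ 2)"
    by simp
  from partial[OF this] show "(\<Sum>m\<in>{1..M}. real m ^ 4 * q ^ m) \<le> R * (P + 12 * P\<^sup>2)"
    by (rule order_trans) (use nz in \<open>simp add: P R divide_simps, simp add: algebra_simps power_numeral_reduce\<close>)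
qed

lemma exp_add_exp_minus_ge:
  fixes x :: real
  shows "x ^ 2 + x ^ 4 / 12 + x ^ 6 / 360 \<le> exp x + exp (- x) - 2"
proof -
  have "(\<Sum>n\<in>{0, 2, 4, 6}. if even n then x ^ n /\<^sub>R fact n else 0) \<le> (\<Sum>n. if even n then x ^ n /\<^sub>R fact n else 0)"
    by (rule sum_le_suminf) (use cosh_converges[of x] in \<open>auto simp: sums_iff zero_le_even_power\<close>)
  also have "\<dots> = cosh x"
    using cosh_converges[of x] by (simp add: sums_iff)
  finally show ?thesis
    by (simp add: cosh_def fact_numeral field_simps)
qed

text \<open>The value of the Koebe function \<open>z / (1 - z)\<^sup>2\<close> at \<open>exp (- x)\<close> is about \<open>1 / x\<^sup>2\<close>. The two correction
  terms make the bound decay faster than that for large \<open>x\<close>, which the next lemma needs.\<close>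
lemma Koebe_le:
  fixes x :: real
  assumes "0 < x"
  shows "exp (- x) / (1 - exp (- x))\<^sup>2 * x\<^sup>2 \<le> 360 / (360 + 30 * x\<^sup>2 + x ^ 4)"
proof -
  define q where "q = exp (- x)"
  have q: "0 < q" "q < 1"
    using assms by (auto simp: q_def)
  have "exp x = 1 / q"
    by (simp add: q_def exp_minus field_simps)
  then have "x ^ 2 + x ^ 4 / 12 + x ^ 6 / 360 \<le> 1 / q + q - 2"
    using exp_add_exp_minus_ge[of x] by (simp add: q_def)
  also have "\<dots> = (1 - q)\<^sup>2 / q"
    using q by (simp add: field_simps power2_eq_square)
  finally have *: "x\<^sup>2 * (360 + 30 * x\<^sup>2 + x ^ 4) / 360 \<le> (1 - q)\<^sup>2 / q"
    by (simp add: field_simps power_numeral_reduce)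
  have "0 < 360 + 30 * x\<^sup>2 + x ^ 4"
    using assms by (simp add: add_pos_nonneg)
  then show ?thesis
    using * q unfolding q_def[symmetric] by (simp add: field_simps)
qed

text \<open>As \<open>x\<close> tends to 0 the three sums are asymptotic to \<open>j! / x ^ (j + 1)\<close> with \<open>j = 2, 3, 4\<close>. The bounds hold for
  all \<open>x\<close>, with a relative loss that is at most a few percent, or proportional to \<open>x\<close>. After inserting
  \<open>Koebe_le\<close> they become polynomial inequalities in \<open>w = x\<^sup>2\<close>.\<close>
lemma sum_power_exp_le:
  fixes x :: real
  assumes x: "0 < x"
  shows "(\<Sum>m\<in>{1..M}. real m ^ 2 * exp (- x) ^ m) \<le> 2 / x ^ 3"
    "(\<Sum>m\<in>{1..M}. real m ^ 3 * exp (- x) ^ m) \<le> 6.2 / x ^ 4"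
    "(\<Sum>m\<in>{1..M}. real m ^ 4 * exp (- x) ^ m) \<le> (24 + 4 * x) / x ^ 5"
proof -
  define q where "q = exp (- x)"
  define P where "P = q / (1 - q)\<^sup>2"
  define R where "R = (1 + q) / (1 - q)"
  define w where "w = x\<^sup>2"
  define D where "D = 360 + 30 * w + w\<^sup>2"
  define p where "p = P * w"
  have q: "0 < q" "q < 1"
    using x by (auto simp: q_def)
  have pos: "0 < P" "0 < R" "0 < w" "0 < p"
    using q x by (auto simp: P_def R_def w_def p_def)
  have D: "0 < D"
    using pos by (simp add: D_def add_pos_nonneg)
  have p: "p \<le> 360 / D"
    using Koebe_le[OF x] by (simp add: p_def P_def q_def D_def w_def power_mult[symmetric])
  have R2: "(R * x)\<^sup>2 = w + 4 * p"
  proof -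
    have "R\<^sup>2 = 1 + 4 * P"
      using q by (simp add: R_def P_def power_divide divide_simps) (simp add: power2_eq_square algebra_simps)
    then show ?thesis
      by (simp add: p_def w_def power_mult_distrib algebra_simps)
  qed
  note S = sum_power_le[OF q P_def R_def, of M]
  have x3: "x ^ 3 * x = w\<^sup>2" "x ^ 4 = w\<^sup>2" "x ^ 5 = x * w\<^sup>2" "x ^ 3 = x * w"
    by (simp_all add: w_def power_numeral_reduce)
  have "(R * P * x ^ 3)\<^sup>2 = p\<^sup>2 * (w + 4 * p)"
    unfolding R2[symmetric] by (simp add: x3 p_def power_mult_distrib)
  also have "\<dots> \<le> (360 / D)\<^sup>2 * (w + 4 * (360 / D))"
    by (intro mult_mono power_mono add_mono p) (use pos D in auto)
  also have "\<dots> \<le> 2\<^sup>2"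
  proof -
    (* expanded in w, the difference of both sides has nonnegative coefficients only *)
    have "360\<^sup>2 * (w * D + 1440) \<le> 4 * D ^ 3"
      using pos by (simp add: D_def algebra_simps power_numeral_reduce add_pos_nonneg)
    then show ?thesis
      using D by (simp add: field_simps power_numeral_reduce)
  qed
  finally have "R * P * x ^ 3 \<le> 2"
    by (rule power2_le_imp_le) simp
  then show "(\<Sum>m\<in>{1..M}. real m ^ 2 * exp (- x) ^ m) \<le> 2 / x ^ 3"
    using S(1) x unfolding q_def[symmetric] by (simp add: pos_le_divide_eq order_trans mult_right_mono)
  have "(6 * P\<^sup>2 + P) * x ^ 4 = 6 * p\<^sup>2 + p * w"
    by (simp add: x3 p_def algebra_simps power2_eq_square)
  also have "\<dots> \<le> 6 * (360 / D)\<^sup>2 + 360 / D * w"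
    by (intro mult_mono power_mono add_mono p) (use pos D in auto)
  also have "\<dots> \<le> 6.2"
  proof -
    (* the only negative coefficient of this polynomial, that of w^2, is absorbed into squares *)
    have "6.2 * D\<^sup>2 - (6 * 360\<^sup>2 + 360 * w * D) = 6.2 * (w\<^sup>2 - 60)\<^sup>2 + 12 * w * ((w - 1/2)\<^sup>2 + 359.75) + 3600"
      unfolding D_def by (simp add: algebra_simps power_numeral_reduce)
    also have "\<dots> \<ge> 0"
      using pos by (intro add_nonneg_nonneg mult_nonneg_nonneg) auto
    finally have "6 * 360\<^sup>2 + 360 * w * D \<le> 6.2 * D\<^sup>2"
      by simp
    then show ?thesis
      using D by (simp add: field_simps power_numeral_reduce)
  qed
  finally show "(\<Sum>m\<in>{1..M}. real m ^ 3 * exp (- x) ^ m) \<le> 6.2 / x ^ 4"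
    using S(2) x unfolding q_def[symmetric] by (simp add: pos_le_divide_eq order_trans mult_right_mono)
  have "(R * (P + 12 * P\<^sup>2) * x ^ 5)\<^sup>2 = (w + 4 * p) * (p * w + 12 * p\<^sup>2)\<^sup>2"
    unfolding R2[symmetric] by (simp add: x3 p_def power_mult_distrib algebra_simps power2_eq_square)
  also have "\<dots> \<le> (w + 4 * (360 / D)) * (360 / D * w + 12 * (360 / D)\<^sup>2)\<^sup>2"
    by (intro mult_mono power_mono add_mono p) (use pos D in auto)
  also have "\<dots> \<le> (24 + 4 * x)\<^sup>2"
  proof -
    (* again coefficientwise; without the term 16 w the inequality fails, for instance at w = 20, which
       is why the bound for the fourth powers carries an extra term linear in x *)
    have "(w * D + 1440) * (360 * w * D + 12 * 360\<^sup>2)\<^sup>2 \<le> (576 + 16 * w) * D ^ 5"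
      using pos by (simp add: D_def algebra_simps power_numeral_reduce)
    then have "(w + 4 * (360 / D)) * (360 / D * w + 12 * (360 / D)\<^sup>2)\<^sup>2 \<le> 576 + 16 * w"
      using D by (simp add: field_simps power_numeral_reduce)
    also have "\<dots> \<le> (24 + 4 * x)\<^sup>2"
      using x by (simp add: w_def power2_eq_square algebra_simps)
    finally show ?thesis .
  qed
  finally have "R * (P + 12 * P\<^sup>2) * x ^ 5 \<le> 24 + 4 * x"
    by (rule power2_le_imp_le) (use x in simp)
  then show "(\<Sum>m\<in>{1..M}. real m ^ 4 * exp (- x) ^ m) \<le> (24 + 4 * x) / x ^ 5"
    using S(3) x unfolding q_def[symmetric] by (simp add: pos_le_divide_eq order_trans mult_right_mono)
qed

section \<open>Moments of the divisor sums and the saddle point\<close>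

text \<open>The set of divisors of 0 is infinite, so \<open>sigma2 0 = 0\<close>; series over \<open>sigma2\<close> may therefore start at 0.\<close>
lemma sigma2_0: "sigma2 0 = 0"
  by (simp add: sigma2_def infinite_UNIV_nat)

lemma power2_le_sigma2: "0 < k \<Longrightarrow> k ^ 2 \<le> sigma2 k"
  unfolding sigma2_def by (rule member_le_sum[of k "{d. d dvd k}" "\<lambda>d. d ^ 2"]) auto

text \<open>Pairs \<open>(d, m)\<close> with \<open>d * m = k\<close> enumerate the divisors \<open>m\<close> of \<open>k\<close>.\<close>
lemma sum_sigma2_le:
  fixes g :: "nat \<Rightarrow> real"
  assumes "\<And>k. 0 \<le> g k"
  shows "(\<Sum>k\<in>{1..K}. sigma2 k * g k) \<le> (\<Sum>d\<in>{1..K}. \<Sum>m\<in>{1..K}. real m ^ 2 * g (d * m))"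
proof -
  have "(\<Sum>k\<in>{1..K}. sigma2 k * g k) \<le> (\<Sum>k\<in>{1..K}. \<Sum>d\<in>{1..K}. \<Sum>m\<in>{1..K}. if k = d * m then real m ^ 2 * g k else 0)"
  proof (rule sum_mono)
    fix k assume k: "k \<in> {1..K}"
    have "sigma2 k * g k = (\<Sum>m | m dvd k. real m ^ 2 * g k)"
      by (simp add: sigma2_def sum_distrib_right)
    also have "\<dots> \<le> (\<Sum>m\<in>{1..K}. \<Sum>d\<in>{1..K}. if k = d * m then real m ^ 2 * g k else 0)"
    proof (rule sum_le_included[where i = "\<lambda>m. m"])
      show "\<forall>m\<in>{m. m dvd k}. \<exists>m'\<in>{1..K}. m' = m \<and>
          real m ^ 2 * g k \<le> (\<Sum>d\<in>{1..K}. if k = d * m' then real m' ^ 2 * g k else 0)"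
      proof
        fix m assume "m \<in> {m. m dvd k}"
        then obtain d where d: "k = d * m"
          by (auto simp: dvd_def mult.commute)
        have "d dvd k" "m dvd k" "0 < k"
          using d k by auto
        then have "d \<in> {1..K}" "m \<in> {1..K}"
          using k dvd_imp_le[of d k] dvd_imp_le[of m k] dvd_pos_nat[of k d] dvd_pos_nat[of k m] by auto
        moreover from this have "real m ^ 2 * g k \<le> (\<Sum>d\<in>{1..K}. if k = d * m then real m ^ 2 * g k else 0)"
          using member_le_sum[of d "{1..K}" "\<lambda>d. if k = d * m then real m ^ 2 * g k else 0"] assms d by simp
        ultimately show "\<exists>m'\<in>{1..K}. m' = m \<and>
          real m ^ 2 * g k \<le> (\<Sum>d\<in>{1..K}. if k = d * m' then real m' ^ 2 * g k else 0)"
          by blast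
      qed
    qed (use k assms in \<open>auto intro!: sum_nonneg\<close>)
    also have "\<dots> = (\<Sum>d\<in>{1..K}. \<Sum>m\<in>{1..K}. if k = d * m then real m ^ 2 * g k else 0)"
      by (rule sum.swap)
    finally show "sigma2 k * g k \<le> (\<Sum>d\<in>{1..K}. \<Sum>m\<in>{1..K}. if k = d * m then real m ^ 2 * g k else 0)" .
  qed
  also have "\<dots> = (\<Sum>d\<in>{1..K}. \<Sum>k\<in>{1..K}. \<Sum>m\<in>{1..K}. if k = d * m then real m ^ 2 * g k else 0)"
    by (rule sum.swap)
  also have "\<dots> = (\<Sum>d\<in>{1..K}. \<Sum>m\<in>{1..K}. \<Sum>k\<in>{1..K}. if k = d * m then real m ^ 2 * g k else 0)"
    by (rule sum.cong[OF refl], rule sum.swap)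
  also have "\<dots> \<le> (\<Sum>d\<in>{1..K}. \<Sum>m\<in>{1..K}. real m ^ 2 * g (d * m))"
  proof (intro sum_mono)
    fix d m
    have "(\<Sum>k\<in>{1..K}. if k = d * m then real m ^ 2 * g k else 0) = (\<Sum>k\<in>{1..K}. if k = d * m then real m ^ 2 * g (d * m) else 0)"
      by (intro sum.cong refl) auto
    also have "\<dots> \<le> real m ^ 2 * g (d * m)"
      using assms by (simp add: sum.delta)
    finally show "(\<Sum>k\<in>{1..K}. if k = d * m then real m ^ 2 * g k else 0) \<le> real m ^ 2 * g (d * m)" .
  qed
  finally show ?thesis .
qed

text \<open>The constant is an upper bound for \<open>zeta 3 = 1.20205...\<close>. The tail is compared with the telescoping sum of
  \<open>1 / ((d - 1) * d * (d + 1))\<close>, starting at \<open>d = 6\<close>.\<close>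
lemma sum_inverse_cubes_le: "(\<Sum>d\<in>{1..K}. 1 / real d ^ 3) \<le> 1.2024"
proof -
  have "(\<Sum>d\<in>{1..K + 5}. 1 / real d ^ 3) + 1 / (2 * (real K + 5) * (real K + 6)) \<le> 1.2024"
  proof (induction K)
    case 0
    then show ?case
      by (simp add: sum.atLeast1_atMost_eq lessThan_nat_numeral lessThan_Suc numeral_eq_Suc)
  next
    case (Suc K)
    have step: "1 / (real K + 6) ^ 3 + 1 / (2 * (real K + 6) * (real K + 7)) \<le> 1 / (2 * (real K + 5) * (real K + 6))"
      by (simp add: divide_simps) (simp add: algebra_simps power_numeral_reduce)
    have split: "(\<Sum>d\<in>{1..Suc K + 5}. 1 / real d ^ 3) = (\<Sum>d\<in>{1..K + 5}. 1 / real d ^ 3) + 1 / (real K + 6) ^ 3"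
    proof -
      have "{1..Suc K + 5} = insert (Suc K + 5) {1..K + 5}"
        by auto
      then show ?thesis
        by (simp add: add.commute)
    qed
    have shift: "real (Suc K) + 5 = real K + 6" "real (Suc K) + 6 = real K + 7"
      by simp_all
    show ?case
      unfolding split shift using Suc.IH step by linarith
  qed
  moreover have "(\<Sum>d\<in>{1..K}. 1 / real d ^ 3) \<le> (\<Sum>d\<in>{1..K + 5}. 1 / real d ^ 3)"
    by (rule sum_mono2) auto
  moreover have "0 \<le> 1 / (2 * (real K + 5) * (real K + 6))"
    by simp
  ultimately show ?thesis
    by linarith
qed

lemma sum_inverse_squares_le: "(\<Sum>d\<in>{1..K}. 1 / real d ^ 2) \<le> 2"
proof -
  have "(\<Sum>d\<in>{1..Suc K}. 1 / real d ^ 2) \<le> 2 - 1 / (real K + 1)"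
  proof (induction K)
    case (Suc K)
    have "1 / (real K + 2) ^ 2 \<le> 1 / (real K + 1) - 1 / (real K + 2)"
      by (simp add: divide_simps) (simp add: algebra_simps power2_eq_square)
    then show ?case
      using Suc by (simp add: algebra_simps)
  qed simp
  moreover have "(\<Sum>d\<in>{1..K}. 1 / real d ^ 2) \<le> (\<Sum>d\<in>{1..Suc K}. 1 / real d ^ 2)"
    by (rule sum_mono2) auto
  moreover have "0 \<le> 1 / (real K + 1)"
    by simp
  ultimately show ?thesis
    by linarith
qed

text \<open>If plane partitions of size \<open>n\<close> are given the weight \<open>q ^ n\<close>, then \<open>moment j q\<close> is the cumulant of order \<open>j + 1\<close>
  of the size: mean, variance and third cumulant for \<open>j = 0, 1, 2\<close>.\<close>
definition moment :: "nat \<Rightarrow> real \<Rightarrow> real" where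
  "moment j q = (\<Sum>k. sigma2 k * real k ^ j * q ^ k)"

text \<open>Writing \<open>k = d * m\<close>, the inner sum over \<open>m\<close> is one of the sums above at \<open>x = d * t\<close>, and what remains is a sum
  over \<open>1 / d ^ 3\<close>, plus a sum over \<open>1 / d\<^sup>2\<close> that accounts for the relative loss \<open>C' * x\<close>.\<close>
lemma sum_moment_le:
  assumes t: "0 < t" and C: "\<And>x M. 0 < x \<Longrightarrow> (\<Sum>m\<in>{1..M}. real m ^ (j + 2) * exp (- x) ^ m) \<le> (C + C' * x) / x ^ (j + 3)"
    and C0: "0 \<le> C" "0 \<le> C'"
  shows "(\<Sum>k<K. sigma2 k * real k ^ j * exp (- t) ^ k) \<le> (1.2024 * C + 2 * C' * t) / t ^ (j + 3)"
proof -
  let ?f = "\<lambda>k. real k ^ j * exp (- t) ^ k"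
  have "(\<Sum>k<K. sigma2 k * real k ^ j * exp (- t) ^ k) \<le> (\<Sum>k\<in>{0..K}. sigma2 k * ?f k)"
    unfolding mult.assoc by (rule sum_mono2) auto
  also have "\<dots> = (\<Sum>k\<in>{1..K}. sigma2 k * ?f k)"
    by (simp add: sum.atLeast_Suc_atMost sigma2_0)
  also have "\<dots> \<le> (\<Sum>d\<in>{1..K}. \<Sum>m\<in>{1..K}. real m ^ 2 * ?f (d * m))"
    by (rule sum_sigma2_le) simp
  also have "\<dots> \<le> (\<Sum>d\<in>{1..K}. (C * (1 / real d ^ 3) + C' * t * (1 / real d ^ 2)) / t ^ (j + 3))"
  proof (rule sum_mono)
    fix d assume d: "d \<in> {1..K}"
    have "exp (- t) ^ (d * m) = exp (- (real d * t)) ^ m" for m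
      by (simp add: power_mult exp_of_nat_mult[symmetric])
    then have "(\<Sum>m\<in>{1..K}. real m ^ 2 * ?f (d * m)) =
        real d ^ j * (\<Sum>m\<in>{1..K}. real m ^ (j + 2) * exp (- (real d * t)) ^ m)"
      unfolding sum_distrib_left by (intro sum.cong refl) (simp add: power_mult_distrib power_add power2_eq_square)
    also have "\<dots> \<le> real d ^ j * ((C + C' * (real d * t)) / (real d * t) ^ (j + 3))"
      using d t by (intro mult_left_mono C) auto
    also have "\<dots> = (C * (1 / real d ^ 3) + C' * t * (1 / real d ^ 2)) / t ^ (j + 3)"
      using d t by (simp add: power_mult_distrib power_add divide_simps power_numeral_reduce)
    finally show "(\<Sum>m\<in>{1..K}. real m ^ 2 * ?f (d * m)) \<le> \<dots>" .
  qed
  also have "\<dots> = (C * (\<Sum>d\<in>{1..K}. 1 / real d ^ 3) + C' * t * (\<Sum>d\<in>{1..K}. 1 / real d ^ 2)) / t ^ (j + 3)"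
    by (simp only: sum_divide_distrib[symmetric] sum.distrib sum_distrib_left)
  also have "\<dots> \<le> (C * 1.2024 + C' * t * 2) / t ^ (j + 3)"
    using t C0 sum_inverse_cubes_le[of K] sum_inverse_squares_le[of K]
    by (intro divide_right_mono add_mono mult_left_mono) auto
  finally show ?thesis
    by (simp add: algebra_simps)
qed

lemma moment_bound:
  assumes t: "0 < t" and C: "\<And>x M. 0 < x \<Longrightarrow> (\<Sum>m\<in>{1..M}. real m ^ (j + 2) * exp (- x) ^ m) \<le> (C + C' * x) / x ^ (j + 3)"
    and C0: "0 \<le> C" "0 \<le> C'"
  shows "summable (\<lambda>k. sigma2 k * real k ^ j * exp (- t) ^ k)"
    "moment j (exp (- t)) \<le> (1.2024 * C + 2 * C' * t) / t ^ (j + 3)"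
proof -
  show s: "summable (\<lambda>k. sigma2 k * real k ^ j * exp (- t) ^ k)"
    by (rule summableI_nonneg_bounded[OF _ sum_moment_le[OF assms]]) auto
  show "moment j (exp (- t)) \<le> (1.2024 * C + 2 * C' * t) / t ^ (j + 3)"
    unfolding moment_def by (rule suminf_le_const[OF s sum_moment_le[OF assms]])
qed

lemma moment_le:
  assumes "0 < t"
  shows "moment 0 (exp (- t)) \<le> 2.4048 / t ^ 3"
    "moment 1 (exp (- t)) \<le> 7.46 / t ^ 4"
    "t \<le> 0.2 \<Longrightarrow> moment 2 (exp (- t)) \<le> 30.6 / t ^ 5"
    and summable_moment: "summable (\<lambda>k. sigma2 k * exp (- t) ^ k)"
    "summable (\<lambda>k. sigma2 k * real k * exp (- t) ^ k)"
    "summable (\<lambda>k. sigma2 k * real k ^ 2 * exp (- t) ^ k)"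
proof -
  note 0 = moment_bound[where j = 0 and C = 2 and C' = 0, OF assms]
  show "moment 0 (exp (- t)) \<le> 2.4048 / t ^ 3" "summable (\<lambda>k. sigma2 k * exp (- t) ^ k)"
    using 0 sum_power_exp_le(1) by (simp_all add: numeral_eq_Suc)
  note 1 = moment_bound[where j = 1 and C = "6.2" and C' = 0, OF assms]
  have "moment 1 (exp (- t)) \<le> (1.2024 * 6.2 + 2 * 0 * t) / t ^ (1 + 3)"
    by (rule 1) (use sum_power_exp_le(2) in \<open>auto simp: numeral_eq_Suc\<close>)
  also have "\<dots> \<le> 7.46 / t ^ 4"
    using assms by (simp add: divide_simps)
  finally show "moment 1 (exp (- t)) \<le> 7.46 / t ^ 4" .
  show "summable (\<lambda>k. sigma2 k * real k * exp (- t) ^ k)"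
    using 1(1) sum_power_exp_le(2) by (simp add: numeral_eq_Suc)
  note 2 = moment_bound[where j = 2 and C = 24 and C' = 4, OF assms]
  have 3: "(\<Sum>m\<in>{1..M}. real m ^ (2 + 2) * exp (- x) ^ m) \<le> (24 + 4 * x) / x ^ (2 + 3)" if "0 < x" for x M
    using sum_power_exp_le(3)[OF that] by simp
  show "summable (\<lambda>k. sigma2 k * real k ^ 2 * exp (- t) ^ k)"
    by (rule 2(1)[OF 3]) auto
  assume "t \<le> 0.2"
  have "moment 2 (exp (- t)) \<le> (1.2024 * 24 + 2 * 4 * t) / t ^ (2 + 3)"
    by (rule 2(2)[OF 3]) auto
  also have "\<dots> \<le> 30.6 / t ^ (2 + 3)"
    using assms \<open>t \<le> 0.2\<close> by (intro divide_right_mono) auto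
  finally show "moment 2 (exp (- t)) \<le> 30.6 / t ^ 5"
    by simp
qed

lemma summable_moment_q:
  fixes q :: real
  assumes "0 < q" "q < 1"
  shows "summable (\<lambda>k. sigma2 k * q ^ k)" "summable (\<lambda>k. sigma2 k * real k * q ^ k)"
    "summable (\<lambda>k. sigma2 k * real k ^ 2 * q ^ k)"
  using summable_moment[of "- ln q"] assms by (auto simp: exp_minus)

text \<open>At \<open>q = n / (n + 1)\<close> the first moment is at least \<open>q / (1 - q) = n\<close>, so the intermediate value theorem applies.\<close>
lemma saddle_point:
  assumes "0 < n"
  obtains q where "0 < q" "q < 1" "moment 0 q = real n"
proof -
  define r where "r = real n / real (n + 1)"
  have r: "0 < r" "r < 1"
    using assms by (auto simp: r_def)
  have s: "summable (\<lambda>k. sigma2 k * r ^ k)"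
    by (rule summable_moment_q[OF r])
  have c: "continuous_on {0..r} (\<lambda>q. moment 0 q)"
  proof -
    have "isCont (\<lambda>q. \<Sum>k. real (sigma2 k) * q ^ k) q" if "q \<in> {0..r}" for q :: real
      by (rule isCont_powser[of _ "(1 + r) / 2"]) (use that r in \<open>auto intro: summable_moment_q\<close>)
    then show ?thesis
      unfolding moment_def by (intro continuous_at_imp_continuous_on) auto
  qed
  have "real n = (\<Sum>k. r ^ k) - 1"
  proof -
    have "(\<Sum>k. r ^ k) = 1 / (1 - r)"
      using r by (simp add: suminf_geometric)
    then show ?thesis
      using assms by (simp add: r_def divide_simps)
  qed
  also have "(\<Sum>k. r ^ k) - 1 = (\<Sum>k. r ^ Suc k)"
    using suminf_split_head[of "\<lambda>k. r ^ k"] r by (simp add: summable_geometric)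
  also have "\<dots> \<le> (\<Sum>k. sigma2 (Suc k) * r ^ Suc k)"
  proof (rule suminf_le)
    fix k
    have "1 \<le> real (sigma2 (Suc k))"
      using power2_le_sigma2[of "Suc k"] by (simp add: power2_eq_square)
    then show "r ^ Suc k \<le> sigma2 (Suc k) * r ^ Suc k"
      using r by simp
  qed (use s r in \<open>auto simp: summable_geometric summable_Suc_iff[of "\<lambda>k. r ^ k"] summable_Suc_iff[of "\<lambda>k. sigma2 k * r ^ k"] simp del: power_Suc\<close>)
  also have "\<dots> = moment 0 r"
    using suminf_split_head[OF s] by (simp add: moment_def sigma2_0)
  finally have "real n \<le> moment 0 r" .
  moreover have "moment 0 0 = 0"
    unfolding moment_def by (simp add: sigma2_0 powser_zero)
  ultimately obtain q where q: "0 \<le> q" "q \<le> r" "moment 0 q = real n"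
    using IVT'[of "moment 0" 0 "real n" r] c r by auto
  moreover from this have "q \<noteq> 0"
    using \<open>moment 0 0 = 0\<close> assms by auto
  ultimately show ?thesis
    using that[of q] r by auto
qed

section \<open>Decay and phase of the generating function on a circle\<close>

text \<open>With \<open>q\<close> the saddle point for \<open>n\<close>, \<open>decay\<close> and \<open>phase\<close> are minus the real part and the imaginary part of
  \<open>ln (F (q * cis \<theta>) / F q) - \<i> * n * \<theta>\<close>. The linear terms in \<open>phase\<close> sum up to \<open>n * \<theta>\<close>.\<close>
definition decay :: "real \<Rightarrow> real \<Rightarrow> real" where
  "decay q \<theta> = (\<Sum>k. sigma2 k / k * q ^ k * (1 - cos (real k * \<theta>)))"

definition phase :: "real \<Rightarrow> real \<Rightarrow> real" where
  "phase q \<theta> = (\<Sum>k. sigma2 k / k * q ^ k * (sin (real k * \<theta>) - real k * \<theta>))"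

lemma summable_log_coeff:
  fixes q :: real
  assumes "0 < q" "q < 1"
  shows "summable (\<lambda>k. sigma2 k / k * q ^ k)"
proof (rule summable_comparison_test'[OF summable_moment_q(1)[OF assms]])
  fix k :: nat
  have "real (sigma2 k) / real k \<le> real (sigma2 k)"
    by (cases k) (auto simp: divide_simps mult_le_cancel_left1)
  then have "sigma2 k / k * q ^ k \<le> sigma2 k * q ^ k"
    by (rule mult_right_mono) (use assms in simp)
  then show "norm (sigma2 k / k * q ^ k) \<le> sigma2 k * q ^ k"
    unfolding real_norm_def by (subst abs_of_nonneg) (use assms in auto)
qed

lemma summable_log_coeff_mult:
  fixes q :: real
  assumes "0 < q" "q < 1" "\<And>k. \<bar>g k\<bar> \<le> 2"
  shows "summable (\<lambda>k. sigma2 k / k * q ^ k * g k)"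
proof (rule summable_comparison_test')
  show "summable (\<lambda>k. sigma2 k / k * q ^ k * 2)"
    by (rule summable_mult2[OF summable_log_coeff[OF assms(1,2)]])
  fix k
  show "norm (sigma2 k / k * q ^ k * g k) \<le> sigma2 k / k * q ^ k * 2"
    unfolding norm_mult by (rule mult_mono) (use assms in auto)
qed

lemma abs_one_minus_cos_le_2: "\<bar>1 - cos x\<bar> \<le> 2" for x :: real
  using cos_le_one[of x] cos_ge_minus_one[of x] by linarith

lemma abs_sin_le_2: "\<bar>sin x\<bar> \<le> 2" for x :: real
  using abs_sin_le_one[of x] by linarith

lemma summable_decay:
  "0 < q \<Longrightarrow> q < 1 \<Longrightarrow> summable (\<lambda>k. sigma2 k / k * q ^ k * (1 - cos (real k * \<theta>)))"
  by (intro summable_log_coeff_mult abs_one_minus_cos_le_2)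

lemma one_minus_cos_le: "1 - cos x \<le> x\<^sup>2 / 2" for x :: real
proof -
  have "1 - cos x = 2 * (sin (x / 2))\<^sup>2"
    using cos_double_sin[of "x / 2"] by simp
  also have "\<dots> \<le> 2 * (x / 2)\<^sup>2"
    using abs_sin_x_le_abs_x[of "x / 2"] by (intro mult_left_mono) (auto simp flip: abs_le_square_iff)
  finally show ?thesis
    by (simp add: power2_eq_square)
qed

lemma decay_le:
  assumes "0 < q" "q < 1"
  shows "decay q \<theta> \<le> moment 1 q * (\<theta>\<^sup>2 / 2)"
proof -
  have s: "summable (\<lambda>k. sigma2 k * real k * q ^ k)"
    by (rule summable_moment_q[OF assms])
  have "decay q \<theta> \<le> (\<Sum>k. sigma2 k * real k * q ^ k * (\<theta>\<^sup>2 / 2))"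
    unfolding decay_def
  proof (rule suminf_le)
    fix k :: nat
    have "sigma2 k / k * q ^ k * (1 - cos (real k * \<theta>)) \<le> sigma2 k / k * q ^ k * ((real k * \<theta>)\<^sup>2 / 2)"
      using assms one_minus_cos_le by (intro mult_left_mono) auto
    also have "\<dots> = sigma2 k * real k * q ^ k * (\<theta>\<^sup>2 / 2)"
      by (cases "k = 0") (auto simp: power2_eq_square sigma2_0)
    finally show "sigma2 k / k * q ^ k * (1 - cos (real k * \<theta>)) \<le> sigma2 k * real k * q ^ k * (\<theta>\<^sup>2 / 2)" .
  qed (rule summable_decay[OF assms] summable_mult2[OF s])+
  also have "\<dots> = moment 1 q * (\<theta>\<^sup>2 / 2)"
    by (simp only: moment_def power_one_right suminf_mult2[OF s])
  finally show ?thesis .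
qed

lemma abs_sin_minus_le: "\<bar>sin x - x\<bar> \<le> \<bar>x\<bar> ^ 3 / 6" for x :: real
  using Maclaurin_sin_bound[of x 3] by (simp add: sin_coeff_def eval_nat_numeral)

lemma summable_phase:
  assumes "0 < q" "q < 1"
  shows "summable (\<lambda>k. sigma2 k / k * q ^ k * (sin (real k * \<theta>) - real k * \<theta>))"
proof -
  have "summable (\<lambda>k. sigma2 k / k * q ^ k * sin (real k * \<theta>) - sigma2 k * q ^ k * \<theta>)"
    using assms by (intro summable_diff summable_mult2 summable_log_coeff_mult summable_moment_q abs_sin_le_2)
  moreover have "sigma2 k / k * q ^ k * sin (real k * \<theta>) - sigma2 k * q ^ k * \<theta> =
      sigma2 k / k * q ^ k * (sin (real k * \<theta>) - real k * \<theta>)" for k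
    by (cases "k = 0") (simp_all add: sigma2_0 right_diff_distrib)
  ultimately show ?thesis by simp
qed

lemma abs_phase_le:
  assumes "0 < q" "q < 1"
  shows "\<bar>phase q \<theta>\<bar> \<le> moment 2 q * (\<bar>\<theta>\<bar> ^ 3 / 6)"
proof -
  have s: "summable (\<lambda>k. sigma2 k * real k ^ 2 * q ^ k)"
    by (rule summable_moment_q[OF assms])
  have le: "\<bar>sigma2 k / k * q ^ k * (sin (real k * \<theta>) - real k * \<theta>)\<bar> \<le> sigma2 k * real k ^ 2 * q ^ k * (\<bar>\<theta>\<bar> ^ 3 / 6)" for k
  proof -
    have "\<bar>sigma2 k / k * q ^ k * (sin (real k * \<theta>) - real k * \<theta>)\<bar> = sigma2 k / k * q ^ k * \<bar>sin (real k * \<theta>) - real k * \<theta>\<bar>"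
      using assms by (simp add: abs_mult)
    also have "\<dots> \<le> sigma2 k / k * q ^ k * (\<bar>real k * \<theta>\<bar> ^ 3 / 6)"
      using assms abs_sin_minus_le by (intro mult_left_mono) auto
    also have "\<dots> = sigma2 k * real k ^ 2 * q ^ k * (\<bar>\<theta>\<bar> ^ 3 / 6)"
      by (cases "k = 0") (auto simp: abs_mult power_mult_distrib power_numeral_reduce sigma2_0)
    finally show ?thesis .
  qed
  have s': "summable (\<lambda>k. \<bar>sigma2 k / k * q ^ k * (sin (real k * \<theta>) - real k * \<theta>)\<bar>)"
    by (rule summable_comparison_test'[OF summable_mult2[OF s, of "\<bar>\<theta>\<bar> ^ 3 / 6"]])
      (use le in \<open>simp only: real_norm_def abs_idempotent\<close>)
  have "\<bar>phase q \<theta>\<bar> \<le> (\<Sum>k. \<bar>sigma2 k / k * q ^ k * (sin (real k * \<theta>) - real k * \<theta>)\<bar>)"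
    unfolding phase_def by (rule summable_rabs[OF s'])
  also have "\<dots> \<le> (\<Sum>k. sigma2 k * real k ^ 2 * q ^ k * (\<bar>\<theta>\<bar> ^ 3 / 6))"
    by (rule suminf_le[OF le s' summable_mult2[OF s]])
  also have "\<dots> = moment 2 q * (\<bar>\<theta>\<bar> ^ 3 / 6)"
    by (simp only: moment_def power_one_right suminf_mult2[OF s])
  finally show ?thesis .
qed

text \<open>The power series of the Koebe function.\<close>
lemma Koebe_sums:
  fixes z :: "'a :: {real_normed_field, banach}"
  assumes "norm z < 1"
  shows "(\<lambda>k. of_nat k * z ^ k) sums (z / (1 - z)\<^sup>2)"
proof -
  have "(\<lambda>k. z * (of_nat (Suc k) * z ^ k)) sums (z * (1 / (1 - z)\<^sup>2))"
    by (intro sums_mult geometric_deriv_sums assms)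
  then have "(\<lambda>k. of_nat (Suc k) * z ^ Suc k) sums (z / (1 - z)\<^sup>2)"
    by (simp add: mult_ac)
  from sums_Suc[OF this] show ?thesis by simp
qed

text \<open>Multiplying out gives \<open>Re (z / (1 - z)\<^sup>2) = q * (c * (1 + q\<^sup>2) - 2 * q) / D\<^sup>2\<close> with \<open>c = cos \<theta>\<close> and \<open>D = (norm (1 - z))\<^sup>2\<close>. In terms
  of \<open>y\<close>, which measures \<open>\<theta>\<close> in units of \<open>t\<close>, one has \<open>D = (1 - q)\<^sup>2 * (1 + y)\<close>.\<close>
lemma Re_Koebe:
  fixes q \<theta> :: real
  assumes q: "0 < q" "q < 1"
  defines "P \<equiv> q / (1 - q)\<^sup>2" and "z \<equiv> rcis q \<theta>"
  defines "y \<equiv> 4 * P * (sin (\<theta> / 2))\<^sup>2"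
  shows "Re (z / (1 - z)\<^sup>2) \<le> P * (1 - y) / (1 + y)\<^sup>2"
proof -
  define c s u D where "c = cos \<theta>" and "s = sin \<theta>" and "u = (sin (\<theta> / 2))\<^sup>2" and "D = 1 - 2 * q * c + q\<^sup>2"
  have s2: "s\<^sup>2 = 1 - c\<^sup>2"
    using sin_cos_squared_add[of \<theta>] by (simp add: s_def c_def algebra_simps)
  have c: "c = 1 - 2 * u"
    using cos_double_sin[of "\<theta> / 2"] by (simp add: c_def u_def)
  have P: "0 < P" "(1 - q)\<^sup>2 = q / P"
    using q by (auto simp: P_def)
  have D: "D = q / P * (1 + y)"
    unfolding y_def u_def[symmetric] using P q by (simp add: D_def c field_simps) (simp add: power2_eq_square algebra_simps P(2)[symmetric])
  have y: "0 \<le> y"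
    using P by (simp add: y_def)
  have Dpos: "0 < D"
    using P q y by (simp add: D)
  have parts: "Re z = q * c" "Im z = q * s"
    by (simp_all add: z_def c_def s_def rcis_def)
  have "Re (z / (1 - z)\<^sup>2) = q * (c * (1 + q\<^sup>2) - 2 * q) / D\<^sup>2"
  proof -
    have "(Re ((1 - z)\<^sup>2))\<^sup>2 + (Im ((1 - z)\<^sup>2))\<^sup>2 = ((1 - q * c)\<^sup>2 + (q * s)\<^sup>2)\<^sup>2"
      by (simp add: parts power2_eq_square algebra_simps)
    also have "(1 - q * c)\<^sup>2 + (q * s)\<^sup>2 = D"
      by (simp add: power_mult_distrib s2 D_def) (simp add: power2_eq_square algebra_simps)
    finally have den: "(Re ((1 - z)\<^sup>2))\<^sup>2 + (Im ((1 - z)\<^sup>2))\<^sup>2 = D\<^sup>2" .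
    have "Re z * Re ((1 - z)\<^sup>2) + Im z * Im ((1 - z)\<^sup>2) = q * c * ((1 - q * c)\<^sup>2 - q\<^sup>2 * s\<^sup>2) - 2 * q\<^sup>2 * s\<^sup>2 * (1 - q * c)"
      by (simp add: parts power2_eq_square algebra_simps)
    also have "\<dots> = q * (c * (1 + q\<^sup>2) - 2 * q)"
      unfolding s2 by (simp add: power2_eq_square algebra_simps)
    finally show ?thesis
      unfolding Re_divide den by simp
  qed
  also have "\<dots> \<le> q * (q / P * (1 - y)) / D\<^sup>2"
  proof -
    have "c * (1 + q\<^sup>2) - 2 * q \<le> (1 - q)\<^sup>2 - 4 * q * u"
    proof -
      have "0 \<le> u * (1 - q)\<^sup>2"
        by (simp add: u_def)
      then show ?thesis
        unfolding c by (simp add: power2_eq_square algebra_simps)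
    qed
    also have "\<dots> = q / P * (1 - y)"
      using P q by (simp add: y_def u_def[symmetric] field_simps)
    finally show ?thesis
      using q by (intro divide_right_mono mult_left_mono) auto
  qed
  also have "\<dots> = P * (1 - y) / (1 + y)\<^sup>2"
  proof -
    define r where "r = q / P"
    have r: "0 < r" "q = P * r"
      using P q by (auto simp: r_def)
    have "q * (r * (1 - y)) / (r * (1 + y))\<^sup>2 = P * (r\<^sup>2 * (1 - y)) / (r\<^sup>2 * (1 + y)\<^sup>2)"
      by (subst r(2)) (simp add: power2_eq_square algebra_simps)
    also have "\<dots> = P * (1 - y) / (1 + y)\<^sup>2"
      using r(1) by simp
    finally show ?thesis
      by (simp add: D r_def)
  qed
  finally show ?thesis .
qed

text \<open>Since \<open>k\<^sup>2 \<le> sigma2 k\<close>, the Koebe function bounds the decay from below. It captures the fraction \<open>1 / zeta 3\<close>, about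
  five sixths, of the decay near \<open>\<theta> = 0\<close>, and it is uniform up to \<open>\<theta> = pi\<close>.\<close>
lemma decay_ge:
  fixes q \<theta> :: real
  assumes q: "0 < q" "q < 1"
  defines "P \<equiv> q / (1 - q)\<^sup>2"
  defines "y \<equiv> 4 * P * (sin (\<theta> / 2))\<^sup>2"
  shows "P * (y * (y + 3) / (1 + y)\<^sup>2) \<le> decay q \<theta>"
proof -
  define z where "z = rcis q \<theta>"
  have "(\<lambda>k. Re (of_nat k * z ^ k)) sums Re (z / (1 - z)\<^sup>2)"
    by (intro sums_Re Koebe_sums) (use q in \<open>simp add: z_def\<close>)
  then have cos: "(\<lambda>k. real k * q ^ k * cos (real k * \<theta>)) sums Re (z / (1 - z)\<^sup>2)"
    by (simp add: z_def DeMoivre2 mult.assoc)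
  have one: "(\<lambda>k. real k * q ^ k) sums P"
    unfolding P_def by (rule Koebe_sums) (use q in simp)
  have diff: "(\<lambda>k. real k * q ^ k * (1 - cos (real k * \<theta>))) sums (P - Re (z / (1 - z)\<^sup>2))"
    using sums_diff[OF one cos] by (simp add: algebra_simps)
  have "P - P * (1 - y) / (1 + y)\<^sup>2 \<le> P - Re (z / (1 - z)\<^sup>2)"
    using Re_Koebe[OF q, of \<theta>] by (simp add: z_def P_def y_def)
  also have "\<dots> = (\<Sum>k. real k * q ^ k * (1 - cos (real k * \<theta>)))"
    using diff by (simp add: sums_iff)
  also have "\<dots> \<le> decay q \<theta>"
    unfolding decay_def
  proof (rule suminf_le)
    fix k :: nat
    have "real k \<le> sigma2 k / k"
    proof (cases "k = 0")
      case False
      then have "real (k ^ 2) \<le> real (sigma2 k)"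
        using power2_le_sigma2[of k] by (intro of_nat_mono) auto
      then show ?thesis
        using False by (simp add: field_simps power2_eq_square)
    qed simp
    then show "real k * q ^ k * (1 - cos (real k * \<theta>)) \<le> sigma2 k / k * q ^ k * (1 - cos (real k * \<theta>))"
      using q cos_le_one[of "real k * \<theta>"] by (intro mult_right_mono) auto
  qed (rule sums_summable[OF diff] summable_decay[OF q])+
  also have "P - P * (1 - y) / (1 + y)\<^sup>2 = P * (y * (y + 3) / (1 + y)\<^sup>2)"
  proof -
    have "0 \<le> y"
      using q by (simp add: y_def P_def)
    then have "P - P * (1 - y) / (1 + y)\<^sup>2 = (P * (1 + y)\<^sup>2 - P * (1 - y)) / (1 + y)\<^sup>2"
      by (simp add: diff_divide_distrib)
    also have "P * (1 + y)\<^sup>2 - P * (1 - y) = P * (y * (y + 3))"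
      by (simp add: power2_eq_square algebra_simps)
    finally show ?thesis
      by simp
  qed
  finally show ?thesis .
qed

section \<open>The second difference as an integral\<close>
definition log_fps :: "complex fps" where
  "log_fps = Abs_fps (\<lambda>k. of_real (sigma2 k / k))"

definition macmahon :: "complex \<Rightarrow> complex" where
  "macmahon z = exp (eval_fps log_fps z)"

lemma log_fps_conv_radius: "1 \<le> fps_conv_radius log_fps"
  unfolding fps_conv_radius_def one_ereal_def
proof (rule conv_radius_geI_ex')
  fix r :: real assume "0 < r" "ereal r < ereal 1"
  then have "summable (\<lambda>k. complex_of_real (sigma2 k / k * r ^ k))"
    by (subst summable_complex_of_real) (use summable_log_coeff[of r] in auto)
  then show "summable (\<lambda>k. fps_nth log_fps k * complex_of_real r ^ k)"
    by (simp add: log_fps_def)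
qed

lemma log_fps_0: "fps_nth log_fps 0 = 0"
  by (simp add: log_fps_def)

lemma fps_nth_log: "of_nat k * fps_nth log_fps k = of_nat (sigma2 k)"
  by (cases "k = 0") (simp_all add: log_fps_def sigma2_0)

text \<open>The derivative of the exponential of a power series gives the recurrence that \<open>PL\<close> satisfies.\<close>
lemma fps_nth_exp_log: "fps_nth (fps_compose (fps_exp 1) log_fps) n = of_nat (PL n)"
proof (induction n rule: less_induct)
  case (less n)
  let ?F = "fps_compose (fps_exp 1) log_fps"
  show ?case
  proof (cases n)
    case 0
    then show ?thesis
      by (simp add: PL_0)
  next
    case (Suc m)
    have deriv: "fps_deriv ?F = ?F * fps_deriv log_fps"
      by (simp add: fps_compose_deriv log_fps_0)
    have "of_nat n * fps_nth ?F n = fps_nth (fps_deriv ?F) m"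
      by (simp add: Suc)
    also have "\<dots> = (\<Sum>i\<in>{0..m}. fps_nth ?F i * (of_nat (Suc (m - i)) * fps_nth log_fps (Suc (m - i))))"
      unfolding deriv fps_mult_nth by simp
    also have "\<dots> = (\<Sum>i\<in>{0..m}. of_nat (sigma2 (n - i) * PL i))"
    proof (rule sum.cong[OF refl])
      fix i assume i: "i \<in> {0..m}"
      then have "Suc (m - i) = n - i"
        by (simp add: Suc Suc_diff_le)
      moreover have "fps_nth ?F i = of_nat (PL i)"
        by (rule less) (use i Suc in auto)
      ultimately show "fps_nth ?F i * (of_nat (Suc (m - i)) * fps_nth log_fps (Suc (m - i))) = of_nat (sigma2 (n - i) * PL i)"
        by (simp only: fps_nth_log of_nat_mult mult.commute)
    qed
    also have "\<dots> = of_nat (\<Sum>k\<in>{1..n}. sigma2 k * PL (n - k))"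
      unfolding of_nat_sum[symmetric]
      by (rule arg_cong[of _ _ of_nat], rule sum.reindex_bij_witness[where i = "\<lambda>k. n - k" and j = "\<lambda>i. n - i"])
        (auto simp: Suc)
    also have "\<dots> = of_nat n * of_nat (PL n)"
      by (simp only: PL_recurrence[symmetric] of_nat_mult)
    finally show ?thesis
      using Suc by (simp del: of_nat_Suc)
  qed
qed

lemma macmahon_has_fps_expansion:
  "macmahon has_fps_expansion fps_compose (fps_exp 1) log_fps"
proof -
  have "0 < fps_conv_radius log_fps"
    using log_fps_conv_radius by (rule less_le_trans[rotated]) simp
  then have "(exp \<circ> eval_fps log_fps) has_fps_expansion fps_compose (fps_exp 1) log_fps"
    by (intro has_fps_expansion_compose eval_fps_has_fps_expansion has_fps_expansion_exp1 log_fps_0)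
  then show ?thesis
    by (simp add: macmahon_def[abs_def] comp_def)
qed

lemma macmahon_holomorphic: "macmahon holomorphic_on ball 0 1"
proof -
  have "ball 0 1 \<subseteq> eball (0 :: complex) (fps_conv_radius log_fps)"
  proof
    fix z :: complex assume "z \<in> ball 0 1"
    then have "ereal (norm z) < 1"
      by simp
    then show "z \<in> eball 0 (fps_conv_radius log_fps)"
      using less_le_trans[OF _ log_fps_conv_radius] by (simp add: in_eball_iff)
  qed
  then show ?thesis
    unfolding macmahon_def[abs_def] by (intro holomorphic_intros)
qed

lemma PL_fourier:
  fixes q :: real
  assumes q: "0 < q" "q < 1"
  shows "((\<lambda>x. macmahon (rcis q (2 * pi * x)) * cis (- (real m * (2 * pi * x)))) has_integral of_real (PL m * q ^ m)) {0..1}"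
proof -
  have deriv: "(deriv ^^ m) macmahon 0 / fact m = of_nat (PL m)"
    using fps_nth_fps_expansion[OF macmahon_has_fps_expansion, of m] by (simp add: fps_nth_exp_log)
  have hol: "macmahon holomorphic_on cball 0 q"
    by (rule holomorphic_on_subset[OF macmahon_holomorphic]) (use q in auto)
  have "((\<lambda>u. macmahon u / (u - 0) ^ Suc m) has_contour_integral (2 * pi * \<i>) / fact m * (deriv ^^ m) macmahon 0) (circlepath 0 q)"
    by (rule Cauchy_has_contour_integral_higher_derivative_circlepath)
      (use q hol in \<open>auto intro: holomorphic_on_imp_continuous_on holomorphic_on_subset\<close>)
  then have "((\<lambda>x. macmahon (circlepath 0 q x) / circlepath 0 q x ^ Suc m *
      vector_derivative (circlepath 0 q) (at x within {0..1})) has_integral 2 * pi * \<i> * of_nat (PL m)) {0..1}"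
    unfolding has_contour_integral_def deriv[symmetric] by simp
  moreover have "macmahon (circlepath 0 q x) / circlepath 0 q x ^ Suc m * vector_derivative (circlepath 0 q) (at x within {0..1})
     = 2 * pi * \<i> / of_real (q ^ m) * (macmahon (rcis q (2 * pi * x)) * cis (- (real m * (2 * pi * x))))"
    if "x \<in> {0..1}" for x
  proof -
    define u where "u = cis (2 * pi * x)"
    have e: "exp (2 * of_real pi * \<i> * of_real x) = u"
      by (simp add: u_def cis_conv_exp mult_ac)
    have c: "circlepath 0 q x = of_real q * u"
      by (simp add: circlepath e)
    have v: "vector_derivative (circlepath 0 q) (at x within {0..1}) = 2 * pi * \<i> * of_real q * u"
      using that by (simp add: vector_derivative_circlepath01 e)
    have r: "rcis q (2 * pi * x) = of_real q * u"
      by (simp add: rcis_def u_def)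
    have i: "cis (- (real m * (2 * pi * x))) = inverse (u ^ m)"
      by (simp only: u_def Complex.DeMoivre cis_inverse)
    have "u \<noteq> 0"
      by (simp add: u_def)
    then show ?thesis
      using q unfolding c v r i by (simp add: power_mult_distrib field_simps)
  qed
  ultimately have "((\<lambda>x. 2 * pi * \<i> / of_real (q ^ m) * (macmahon (rcis q (2 * pi * x)) * cis (- (real m * (2 * pi * x)))))
      has_integral 2 * pi * \<i> * of_nat (PL m)) {0..1}"
    by (rule has_integral_eq[rotated]) 
  from has_integral_mult_right[OF this, of "of_real (q ^ m) / (2 * pi * \<i>)"]
  show ?thesis
    using q by (simp add: field_simps)
qed

definition log_cos :: "real \<Rightarrow> real \<Rightarrow> real" where
  "log_cos q \<theta> = (\<Sum>k. sigma2 k / k * q ^ k * cos (real k * \<theta>))"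

definition log_sin :: "real \<Rightarrow> real \<Rightarrow> real" where
  "log_sin q \<theta> = (\<Sum>k. sigma2 k / k * q ^ k * sin (real k * \<theta>))"

lemma abs_cos_le_2: "\<bar>cos x\<bar> \<le> 2" for x :: real
  using abs_cos_le_one[of x] by linarith

lemma eval_log_fps:
  assumes q: "0 < q" "q < 1"
  shows "eval_fps log_fps (rcis q \<theta>) = Complex (log_cos q \<theta>) (log_sin q \<theta>)"
proof -
  have "(\<lambda>k. Complex (sigma2 k / k * q ^ k * cos (real k * \<theta>)) (sigma2 k / k * q ^ k * sin (real k * \<theta>)))
      sums Complex (log_cos q \<theta>) (log_sin q \<theta>)"
    unfolding sums_complex_iff log_cos_def log_sin_def
    unfolding complex.sel by (intro conjI summable_sums summable_log_coeff_mult abs_cos_le_2 abs_sin_le_2 q)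
  moreover have "Complex (sigma2 k / k * q ^ k * cos (real k * \<theta>)) (sigma2 k / k * q ^ k * sin (real k * \<theta>)) =
      fps_nth log_fps k * rcis q \<theta> ^ k" for k
    by (simp add: log_fps_def DeMoivre2 complex_eq_iff)
  ultimately show ?thesis
    unfolding eval_fps_def by (simp add: sums_iff)
qed

lemma Re_macmahon:
  assumes q: "0 < q" "q < 1"
  shows "Re (macmahon (rcis q \<theta>) * cis (- (a * \<theta>))) = exp (log_cos q \<theta>) * cos (log_sin q \<theta> - a * \<theta>)"
proof -
  have "macmahon (rcis q \<theta>) * cis (- (a * \<theta>)) = of_real (exp (log_cos q \<theta>)) * cis (log_sin q \<theta> - a * \<theta>)"
    unfolding macmahon_def eval_log_fps[OF q] by (simp add: exp_eq_polar cis_mult[symmetric] mult.assoc)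
      (simp add: cis_mult)
  then show ?thesis
    by simp
qed

lemma log_cos_decay:
  assumes q: "0 < q" "q < 1"
  shows "log_cos q \<theta> = log_cos q 0 - decay q \<theta>"
proof -
  have s: "summable (\<lambda>k. sigma2 k / k * q ^ k * cos (real k * \<theta>))" for \<theta>
    by (intro summable_log_coeff_mult q abs_cos_le_2)
  have "log_cos q 0 - log_cos q \<theta> = decay q \<theta>"
    unfolding log_cos_def decay_def suminf_diff[OF s s]
    by (intro suminf_cong) (simp add: right_diff_distrib)
  then show ?thesis by simp
qed

lemma log_sin_phase:
  assumes q: "0 < q" "q < 1"
  shows "log_sin q \<theta> - moment 0 q * \<theta> = phase q \<theta>"
proof -
  have s: "summable (\<lambda>k. sigma2 k / k * q ^ k * sin (real k * \<theta>))"
    by (intro summable_log_coeff_mult q abs_sin_le_2)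
  have m: "summable (\<lambda>k. sigma2 k * q ^ k)"
    by (rule summable_moment_q[OF q])
  have "moment 0 q * \<theta> = (\<Sum>k. sigma2 k * q ^ k * \<theta>)"
    unfolding moment_def using suminf_mult2[OF m] by simp
  then have "log_sin q \<theta> - moment 0 q * \<theta> =
      (\<Sum>k. sigma2 k / k * q ^ k * sin (real k * \<theta>) - sigma2 k * q ^ k * \<theta>)"
    unfolding log_sin_def using suminf_diff[OF s summable_mult2[OF m]] by simp
  also have "\<dots> = phase q \<theta>"
    unfolding phase_def
  proof (intro suminf_cong)
    fix k
    show "sigma2 k / k * q ^ k * sin (real k * \<theta>) - sigma2 k * q ^ k * \<theta> =
      sigma2 k / k * q ^ k * (sin (real k * \<theta>) - real k * \<theta>)"
      by (cases "k = 0") (simp_all add: sigma2_0 right_diff_distrib)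
  qed
  finally show ?thesis .
qed

text \<open>The three Fourier coefficients at \<open>n - 1\<close>, \<open>n\<close> and \<open>n + 1\<close> combine to the kernel \<open>2 - 2 * cos \<theta>\<close>. Since the left-hand side is
  real, only the real part of the integrand counts, and this is even about \<open>\<theta> = pi\<close>.\<close>
lemma second_difference_integral:
  fixes q :: real
  assumes q: "0 < q" "q < 1" and n: "moment 0 q = real n" "0 < n"
  shows "((\<lambda>\<theta>. exp (- decay q \<theta>) * cos (phase q \<theta>) * (1 - cos \<theta>)) has_integral
     (pi * exp (- log_cos q 0) / 2 * (2 * (PL n * q ^ n) - PL (n - 1) * q ^ (n - 1) - PL (n + 1) * q ^ (n + 1)))) {0..pi}"
proof -
  define \<psi> where "\<psi> = (\<lambda>\<theta>. exp (log_cos q \<theta>) * cos (log_sin q \<theta> - real n * \<theta>) * (2 - 2 * cos \<theta>))"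
  define I where "I = 2 * (PL n * q ^ n) - PL (n - 1) * q ^ (n - 1) - PL (n + 1) * q ^ (n + 1)"
  have "((\<lambda>x. 2 * (macmahon (rcis q (2 * pi * x)) * cis (- (real n * (2 * pi * x))))
      - macmahon (rcis q (2 * pi * x)) * cis (- (real (n - 1) * (2 * pi * x)))
      - macmahon (rcis q (2 * pi * x)) * cis (- (real (n + 1) * (2 * pi * x)))) has_integral
      (2 * of_real (PL n * q ^ n) - of_real (PL (n - 1) * q ^ (n - 1)) - of_real (PL (n + 1) * q ^ (n + 1)))) {0..1}"
    by (intro has_integral_diff has_integral_mult_right PL_fourier q)
  also have "(2 * of_real (PL n * q ^ n) - of_real (PL (n - 1) * q ^ (n - 1)) - of_real (PL (n + 1) * q ^ (n + 1))) = complex_of_real I"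
    by (simp add: I_def)
  finally have "((\<lambda>x. Re (2 * (macmahon (rcis q (2 * pi * x)) * cis (- (real n * (2 * pi * x))))
      - macmahon (rcis q (2 * pi * x)) * cis (- (real (n - 1) * (2 * pi * x)))
      - macmahon (rcis q (2 * pi * x)) * cis (- (real (n + 1) * (2 * pi * x))))) has_integral I) {0..1}"
    by (drule_tac has_integral_linear[OF _ bounded_linear_Re]) (simp add: comp_def)
  moreover have "Re (2 * (macmahon (rcis q (2 * pi * x)) * cis (- (real n * (2 * pi * x))))
      - macmahon (rcis q (2 * pi * x)) * cis (- (real (n - 1) * (2 * pi * x)))
      - macmahon (rcis q (2 * pi * x)) * cis (- (real (n + 1) * (2 * pi * x)))) = \<psi> (2 * pi * x)" for x
  proof -
    define \<theta> where "\<theta> = 2 * pi * x"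
    define a where "a = log_sin q \<theta> - real n * \<theta>"
    have "real (n - 1) = real n - 1"
      using n by (simp add: of_nat_diff)
    then have shift: "log_sin q \<theta> - real (n - 1) * \<theta> = a + \<theta>" "log_sin q \<theta> - real (n + 1) * \<theta> = a - \<theta>"
      by (simp_all add: a_def algebra_simps)
    have two: "Re (2 * w) = 2 * Re w" for w
      by simp
    show ?thesis
      unfolding minus_complex.sel two \<theta>_def[symmetric] Re_macmahon[OF q] shift a_def[symmetric] \<psi>_def
      by (simp add: cos_add cos_diff algebra_simps)
  qed
  ultimately have "((\<lambda>x. \<psi> (2 * pi * x)) has_integral I) (cbox 0 1)"
    by simp
  from has_integral_affinity'[OF this, of "1 / (2 * pi)" 0]
  have total: "(\<psi> has_integral 2 * pi * I) {0..2 * pi}"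
    by (simp add: field_simps)
  have refl: "\<psi> (2 * pi - \<theta>) = \<psi> \<theta>" for \<theta>
  proof -
    have trig: "cos (real k * (2 * pi - \<theta>)) = cos (real k * \<theta>)" "sin (real k * (2 * pi - \<theta>)) = - sin (real k * \<theta>)" for k
    proof -
      have "real k * (2 * pi - \<theta>) = 2 * real k * pi - real k * \<theta>"
        by (simp add: algebra_simps)
      then show "cos (real k * (2 * pi - \<theta>)) = cos (real k * \<theta>)" "sin (real k * (2 * pi - \<theta>)) = - sin (real k * \<theta>)"
        by (simp_all only: cos_diff sin_diff cos_2npi sin_2npi)
    qed
    have "log_cos q (2 * pi - \<theta>) = log_cos q \<theta>"
      by (simp add: log_cos_def trig)
    moreover have "log_sin q (2 * pi - \<theta>) = - log_sin q \<theta>"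
    proof -
      have "summable (\<lambda>k. sigma2 k / k * q ^ k * sin (real k * \<theta>))"
        by (intro summable_log_coeff_mult q abs_sin_le_2)
      then show ?thesis
        by (simp add: log_sin_def trig suminf_minus)
    qed
    moreover have "cos (- log_sin q \<theta> - real n * (2 * pi - \<theta>)) = cos (log_sin q \<theta> - real n * \<theta>)"
    proof -
      have "- log_sin q \<theta> - real n * (2 * pi - \<theta>) = - (log_sin q \<theta> - real n * \<theta>) - 2 * real n * pi"
        by (simp add: algebra_simps)
      then show ?thesis
        by (simp only: cos_diff[of "- _"] cos_2npi sin_2npi cos_minus)
    qed
    moreover have "cos (2 * pi - \<theta>) = cos \<theta>"
      using trig(1)[of 1] by simp
    ultimately show ?thesis
      by (simp add: \<psi>_def)
  qed
  have int: "\<psi> integrable_on {0..pi}"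
    by (rule integrable_subinterval_real[OF has_integral_integrable[OF total]]) auto
  then have half: "(\<psi> has_integral integral {0..pi} \<psi>) {0..pi}"
    by (rule integrable_integral)
  have "((\<lambda>x. \<psi> ((-1) *\<^sub>R x + 2 * pi)) has_integral (1 / (\<bar>-1\<bar> ^ DIM(real))) *\<^sub>R integral {0..pi} \<psi>)
      ((\<lambda>x. (1 / (-1)) *\<^sub>R x + - ((1 / (-1)) *\<^sub>R (2 * pi))) ` cbox 0 pi)"
    by (rule has_integral_affinity) (use half in auto)
  also have "(\<lambda>x. (1 / (-1)) *\<^sub>R x + - ((1 / (-1)) *\<^sub>R (2 * pi))) ` cbox 0 pi = {pi..2 * pi}"
    using image_affinity_atLeastAtMost[of "-1" "2 * pi" 0 pi] by (simp add: )
  finally have "((\<lambda>x. \<psi> (2 * pi - x)) has_integral integral {0..pi} \<psi>) {pi..2 * pi}"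
    by simp
  then have "(\<psi> has_integral integral {0..pi} \<psi>) {pi..2 * pi}"
    by (simp add: refl)
  from has_integral_combine[OF _ _ half this]
  have "(\<psi> has_integral integral {0..pi} \<psi> + integral {0..pi} \<psi>) {0..2 * pi}"
    by simp
  from has_integral_unique[OF this total] have "integral {0..pi} \<psi> = pi * I"
    by simp
  with half have "(\<psi> has_integral pi * I) {0..pi}"
    by simp
  from has_integral_mult_right[OF this, of "exp (- log_cos q 0) / 2"]
  have "((\<lambda>\<theta>. exp (- log_cos q 0) / 2 * \<psi> \<theta>) has_integral pi * exp (- log_cos q 0) / 2 * I) {0..pi}"
    by (simp add: mult_ac)
  moreover have "exp (- log_cos q 0) / 2 * \<psi> \<theta> = exp (- decay q \<theta>) * cos (phase q \<theta>) * (1 - cos \<theta>)" for \<theta>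
  proof -
    have "exp (log_cos q \<theta>) = exp (log_cos q 0) * exp (- decay q \<theta>)"
      by (simp add: log_cos_decay[OF q, of \<theta>] exp_add[symmetric])
    then have "exp (- log_cos q 0) * exp (log_cos q \<theta>) = exp (- decay q \<theta>)"
      by (simp add: exp_minus)
    then show ?thesis
      using log_sin_phase[OF q, of \<theta>] by (simp add: \<psi>_def n(1) algebra_simps)
  qed
  ultimately show ?thesis
    by (simp add: I_def)
qed

section \<open>Positivity of the saddle point integral\<close>
lemma exp_ge_partial_sum:
  fixes x :: real
  assumes "0 \<le> x"
  shows "(\<Sum>k<n. x ^ k / fact k) \<le> exp x"
  using sum_le_suminf[OF summable_exp[of x], of "{..<n}"] assms
  by (simp add: exp_def divide_inverse mult.commute)

text \<open>With \<open>s\<close> proportional to \<open>1 / t\<^sup>2\<close> this turns an exponentially small error into a small multiple of \<open>t ^ 6\<close>, the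
  order of the main term, uniformly in \<open>t\<close>.\<close>
lemma exp_minus_mult_le:
  fixes X s :: real
  assumes "3 \<le> X" "1 \<le> s"
  shows "exp (- (X * s)) \<le> exp (- X) / s ^ 3"
proof -
  have "s ^ 3 \<le> exp (s - 1) ^ 3"
    using exp_ge_add_one_self[of "s - 1"] assms by (intro power_mono) auto
  also have "\<dots> = exp (3 * (s - 1))"
    by (simp add: exp_of_nat_mult[symmetric])
  also have "\<dots> \<le> exp (X * (s - 1))"
    using assms by (intro exp_le_cancel_iff[THEN iffD2] mult_right_mono) auto
  finally have "s ^ 3 \<le> exp (X * (s - 1))" .
  moreover have "exp (- (X * s)) = exp (- X) / exp (X * (s - 1))"
    by (simp add: exp_diff[symmetric] algebra_simps)
  ultimately show ?thesis
    using assms by (simp add: frac_le)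
qed

text \<open>The cube, in contrast to the square that occurs in \<open>1 - cos \<theta>\<close>, has an elementary antiderivative. On
  \<open>{0..y}\<close> one has \<open>\<theta> ^ 3 / y \<le> \<theta>\<^sup>2\<close>, and \<open>\<theta>\<^sup>2 \<le> \<theta> ^ 3 / x\<close> from \<open>x\<close> on; both lose only a constant factor on the
  scale \<open>\<theta> ~ t\<^sup>2\<close>.\<close>
lemma cube_gauss_integral:
  fixes a :: real
  assumes "0 < a" "x \<le> y"
  shows "((\<lambda>\<theta>. \<theta> ^ 3 * exp (- (a * \<theta>\<^sup>2))) has_integral
     ((1 + a * x\<^sup>2) * exp (- (a * x\<^sup>2)) - (1 + a * y\<^sup>2) * exp (- (a * y\<^sup>2))) / (2 * a\<^sup>2)) {x..y}"
proof -
  define F where "F = (\<lambda>\<theta>. - ((1 + a * \<theta>\<^sup>2) * exp (- (a * \<theta>\<^sup>2))) / (2 * a\<^sup>2))"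
  have "(F has_real_derivative \<theta> ^ 3 * exp (- (a * \<theta>\<^sup>2))) (at \<theta> within {x..y})" for \<theta>
    unfolding F_def using assms(1)
    by (auto intro!: derivative_eq_intros simp: field_simps power_numeral_reduce)
  then have "((\<lambda>\<theta>. \<theta> ^ 3 * exp (- (a * \<theta>\<^sup>2))) has_integral (F y - F x)) {x..y}"
    by (intro fundamental_theorem_of_calculus assms) (simp add: has_real_derivative_iff_has_vector_derivative)
  also have "F y - F x = ((1 + a * x\<^sup>2) * exp (- (a * x\<^sup>2)) - (1 + a * y\<^sup>2) * exp (- (a * y\<^sup>2))) / (2 * a\<^sup>2)"
    by (simp add: F_def diff_divide_distrib)
  finally show ?thesis .
qed

lemma Koebe_exp_bounds:
  fixes t :: real
  assumes t: "0 < t" "t \<le> 1/5"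
  defines "P \<equiv> exp (- t) / (1 - exp (- t))\<^sup>2"
  shows "P \<le> 1 / t\<^sup>2" "0.995 / t\<^sup>2 \<le> P"
proof -
  have "P * t\<^sup>2 \<le> 360 / (360 + 30 * t\<^sup>2 + t ^ 4)"
    unfolding P_def by (rule Koebe_le[OF t(1)])
  also have "\<dots> \<le> 1"
    by (simp add: divide_le_eq_1 add_pos_nonneg)
  finally show "P \<le> 1 / t\<^sup>2"
    using t by (simp add: field_simps)
  have exp_le: "exp s \<le> 1.24" if "s \<le> 1/5" for s :: real
  proof -
    have "exp s \<le> exp (1/5)"
      using that by simp
    also have "\<dots> \<le> 1.24"
      using exp_bound[of "1/5"] by (simp add: power2_eq_square)
    finally show ?thesis .
  qed
  obtain u where u: "\<bar>u\<bar> \<le> \<bar>t\<bar>" "exp t = (\<Sum>m<4. t ^ m / fact m) + exp u / fact 4 * t ^ 4"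
    using Maclaurin_exp_le[of t 4] by auto
  obtain v where v: "\<bar>v\<bar> \<le> \<bar>-t\<bar>" "exp (- t) = (\<Sum>m<4. (- t) ^ m / fact m) + exp v / fact 4 * (- t) ^ 4"
    using Maclaurin_exp_le[of "- t" 4] by auto
  have "exp t + exp (- t) - 2 = t\<^sup>2 + (exp u + exp v) * t ^ 4 / 24"
    unfolding u(2) v(2) by (simp add: lessThan_nat_numeral fact_numeral algebra_simps power_numeral_reduce)
  also have "\<dots> \<le> t\<^sup>2 + (1.24 + 1.24) * t ^ 4 / 24"
    using u(1) v(1) t by (intro add_left_mono divide_right_mono mult_right_mono add_mono exp_le) auto
  also have "\<dots> = t\<^sup>2 * (1 + 2.48 / 24 * t\<^sup>2)"
    by (simp add: algebra_simps power_numeral_reduce)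
  also have "\<dots> \<le> t\<^sup>2 * (1 + 2.48 / 24 * (1/5)\<^sup>2)"
    using t by (intro mult_left_mono add_left_mono power_mono) auto
  also have "\<dots> \<le> t\<^sup>2 / 0.995"
    using t by (simp add: power2_eq_square)
  finally have *: "exp t + exp (- t) - 2 \<le> t\<^sup>2 / 0.995" .
  define q where "q = exp (- t)"
  have q: "0 < q" "q < 1"
    using t by (auto simp: q_def)
  have "exp t = 1 / q"
    by (simp add: q_def exp_minus field_simps)
  then have "exp t + exp (- t) - 2 = (1 - q)\<^sup>2 / q"
    using q by (simp add: q_def[symmetric] field_simps power2_eq_square)
  then have "(1 - q)\<^sup>2 / q \<le> t\<^sup>2 / 0.995"
    using * by simp
  then show "0.995 / t\<^sup>2 \<le> P"
    using q t unfolding P_def q_def[symmetric] by (simp add: field_simps)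
qed

lemma sin_ge:
  fixes x e :: real
  assumes "0 \<le> x" "x\<^sup>2 \<le> 6 * e"
  shows "(1 - e) * x \<le> sin x"
proof -
  have "\<bar>sin x - x\<bar> \<le> x ^ 3 / 6"
    using abs_sin_minus_le[of x] assms(1) by simp
  then have "x - x ^ 3 / 6 \<le> sin x"
    by linarith
  moreover have "x\<^sup>2 * x \<le> 6 * e * x"
    using assms by (intro mult_right_mono)
  ultimately show ?thesis
    by (simp add: power_numeral_reduce algebra_simps)
qed

text \<open>In \<open>decay_ge\<close>, \<open>P\<close> is close to \<open>1 / t\<^sup>2\<close> and \<open>y\<close> is close to \<open>\<theta>\<^sup>2 / t\<^sup>2\<close> for small \<open>\<theta>\<close>. The factor
  \<open>y * (y + 3) / (1 + y)\<^sup>2\<close> starts as \<open>3 * y\<close>, and it exceeds 1/3 from about \<open>y = 0.14\<close> on and 3/4 from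
  about \<open>y = 0.47\<close> on. The three bounds are these three regimes.\<close>
lemma decay_lower:
  fixes t \<theta> :: real
  assumes t: "0 < t" "t \<le> 1/5" and \<theta>: "0 \<le> \<theta>" "\<theta> \<le> pi"
  shows "\<theta> \<le> 0.4 * t \<Longrightarrow> 2.3 * \<theta>\<^sup>2 / t ^ 4 \<le> decay (exp (- t)) \<theta>"
    "0.4 * t \<le> \<theta> \<Longrightarrow> 0.33 / t\<^sup>2 \<le> decay (exp (- t)) \<theta>"
    "0.7 * t \<le> \<theta> \<Longrightarrow> 0.746 / t\<^sup>2 \<le> decay (exp (- t)) \<theta>"
proof -
  define P where "P = exp (- t) / (1 - exp (- t))\<^sup>2"
  define u where "u = (sin (\<theta> / 2))\<^sup>2"
  define y where "y = 4 * P * u"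
  have P: "P \<le> 1 / t\<^sup>2" "0.995 / t\<^sup>2 \<le> P"
    using Koebe_exp_bounds[OF t] by (simp_all add: P_def)
  have P0: "0 < P"
    using P(2) t by (auto intro: less_le_trans[rotated])
  have y0: "0 \<le> y"
    using P0 by (simp add: y_def u_def)
  have D: "P * (y * (y + 3) / (1 + y)\<^sup>2) \<le> decay (exp (- t)) \<theta>"
    using decay_ge[of "exp (- t)" \<theta>] t by (simp add: P_def y_def u_def)
  have t2: "t\<^sup>2 \<le> 0.04"
    using power_mono[OF t(2), of 2] t by (simp add: power2_eq_square)
  have u_ge: "c\<^sup>2 * 0.998 * t\<^sup>2 \<le> u" if c: "0 \<le> c" "c \<le> 0.35" "2 * c * t \<le> \<theta>" for c
  proof -
    have "(c * t)\<^sup>2 \<le> 0.35\<^sup>2 * 0.04"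
      unfolding power_mult_distrib using c t2 by (intro mult_mono power_mono) auto
    then have "(1 - 0.0009) * (c * t) \<le> sin (c * t)"
      using c t by (intro sin_ge) (auto simp: power2_eq_square)
    also have "\<dots> \<le> sin (\<theta> / 2)"
    proof (rule sin_monotone_2pi_le)
      have "0 \<le> c * t"
        using c t by simp
      then show "- (pi / 2) \<le> c * t"
        using pi_gt_zero by linarith
    qed (use c \<theta> in auto)
    finally have "((1 - 0.0009) * (c * t))\<^sup>2 \<le> u"
      unfolding u_def using c t by (intro power_mono) auto
    moreover have "c\<^sup>2 * 0.998 * t\<^sup>2 \<le> ((1 - 0.0009) * (c * t))\<^sup>2"
    proof -
      have "0.998 * (c * t)\<^sup>2 \<le> (1 - 0.0009)\<^sup>2 * (c * t)\<^sup>2"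
        by (intro mult_right_mono) (auto simp: power2_eq_square)
      also have "0.998 * (c * t)\<^sup>2 = c\<^sup>2 * 0.998 * t\<^sup>2"
        by (simp only: power_mult_distrib mult_ac)
      finally show ?thesis
        by (simp only: power_mult_distrib)
    qed
    ultimately show ?thesis
      by linarith
  qed
  have y_ge: "3.972 * c\<^sup>2 \<le> y" if "0 \<le> c" "c \<le> 0.35" "2 * c * t \<le> \<theta>" for c
  proof -
    have "3.972 * c\<^sup>2 \<le> 4 * (0.995 / t\<^sup>2) * (c\<^sup>2 * 0.998 * t\<^sup>2)"
      using t by simp
    also have "\<dots> \<le> y"
      unfolding y_def using P P0 u_ge[OF that] by (intro mult_mono) auto
    finally show ?thesis .
  qed
  {
    assume "0.4 * t \<le> \<theta>"
    then have "3.972 * 0.2\<^sup>2 \<le> y"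
      by (intro y_ge) auto
    then have y: "0.158 \<le> y"
      by (simp add: power2_eq_square)
    have "(1 + y)\<^sup>2 \<le> 3 * (y * (y + 3))"
    proof -
      have "3 * (y * (y + 3)) - (1 + y)\<^sup>2 = 2 * y\<^sup>2 + (7 * y - 1)"
        by (simp add: power2_eq_square algebra_simps)
      moreover have "0 \<le> y\<^sup>2"
        by simp
      moreover have "1 \<le> 7 * y"
        using y by simp
      ultimately show ?thesis
        by linarith
    qed
    then have "1 / 3 \<le> y * (y + 3) / (1 + y)\<^sup>2"
      using y0 by (simp add: field_simps)
    then have "0.995 / t\<^sup>2 * (1 / 3) \<le> P * (y * (y + 3) / (1 + y)\<^sup>2)"
      using P P0 by (intro mult_mono) auto
    moreover have "0.33 / t\<^sup>2 \<le> 0.995 / t\<^sup>2 * (1 / 3)"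
      using t by (simp add: divide_simps)
    ultimately show "0.33 / t\<^sup>2 \<le> decay (exp (- t)) \<theta>"
      using D by linarith
  }
  {
    assume "0.7 * t \<le> \<theta>"
    then have "3.972 * 0.35\<^sup>2 \<le> y"
      by (intro y_ge) auto
    then have y: "0.48 \<le> y"
      by (simp add: power2_eq_square)
    have "3 * (1 + y)\<^sup>2 \<le> 4 * (y * (y + 3))"
    proof -
      have "4 * (y * (y + 3)) - 3 * (1 + y)\<^sup>2 = y\<^sup>2 + (6 * y - 3)"
        by (simp add: power2_eq_square algebra_simps)
      moreover have "0.48\<^sup>2 \<le> y\<^sup>2"
        using y by (intro power_mono) auto
      then have "23 \<le> 100 * y\<^sup>2"
        by (simp add: power2_eq_square)
      moreover have "48 \<le> 100 * y"
        using y by simp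
      ultimately show ?thesis
        by linarith
    qed
    then have "3 / 4 \<le> y * (y + 3) / (1 + y)\<^sup>2"
      using y0 by (simp add: field_simps)
    then have "0.995 / t\<^sup>2 * (3 / 4) \<le> P * (y * (y + 3) / (1 + y)\<^sup>2)"
      using P P0 by (intro mult_mono) auto
    moreover have "0.746 / t\<^sup>2 \<le> 0.995 / t\<^sup>2 * (3 / 4)"
      using t by (simp add: divide_simps)
    ultimately show "0.746 / t\<^sup>2 \<le> decay (exp (- t)) \<theta>"
      using D by linarith
  }
  {
    assume le: "\<theta> \<le> 0.4 * t"
    define c where "c = \<theta> / (2 * t)"
    have c: "0 \<le> c" "c \<le> 0.35" "2 * c * t \<le> \<theta>"
      using t \<theta> le by (auto simp: c_def field_simps)
    have y1: "3.972 * c\<^sup>2 \<le> y"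
      by (rule y_ge[OF c])
    have "u \<le> (\<theta> / 2)\<^sup>2"
      unfolding u_def using abs_sin_x_le_abs_x[of "\<theta> / 2"] by (simp flip: abs_le_square_iff)
    then have "y \<le> 4 * (1 / t\<^sup>2) * (\<theta> / 2)\<^sup>2"
      unfolding y_def using P P0 by (intro mult_mono) (auto simp: u_def)
    also have "\<dots> \<le> 4 * (1 / t\<^sup>2) * (0.2 * t)\<^sup>2"
      using le \<theta> by (intro mult_left_mono power_mono) auto
    also have "\<dots> = 0.16"
      using t by (simp add: power2_eq_square)
    finally have y2: "y \<le> 0.16" .
    have "2.348 * (1 + y)\<^sup>2 \<le> y + 3"
    proof -
      have "y * y \<le> 0.16 * y"
        using y0 y2 by (intro mult_right_mono)
      then show ?thesis
        using y2 by (simp add: power2_eq_square algebra_simps)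
    qed
    then have "2.348 \<le> (y + 3) / (1 + y)\<^sup>2"
      using y0 by (simp add: field_simps)
    then have "0.995 / t\<^sup>2 * (3.972 * c\<^sup>2 * 2.348) \<le> P * (y * ((y + 3) / (1 + y)\<^sup>2))"
      using P P0 y0 y1 by (intro mult_mono) auto
    moreover have "2.3 * \<theta>\<^sup>2 / t ^ 4 \<le> 0.995 / t\<^sup>2 * (3.972 * c\<^sup>2 * 2.348)"
    proof -
      have "0.995 / t\<^sup>2 * (3.972 * c\<^sup>2 * 2.348) = (0.995 * 3.972 * 2.348 / 4) * (\<theta>\<^sup>2 / t ^ 4)"
        using t by (simp add: c_def power_divide power_mult_distrib power_numeral_reduce)
      moreover have "2.3 * (\<theta>\<^sup>2 / t ^ 4) \<le> (0.995 * 3.972 * 2.348 / 4) * (\<theta>\<^sup>2 / t ^ 4)"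
        by (intro mult_right_mono) auto
      ultimately show ?thesis
        by simp
    qed
    ultimately show "2.3 * \<theta>\<^sup>2 / t ^ 4 \<le> decay (exp (- t)) \<theta>"
      using D by simp
  }
qed

lemma exp_numerics:
  "exp (- 2.3872 :: real) \<le> 0.0925" "exp (- 3.04175 :: real) \<le> 0.048"
  "exp (- 8.25 :: real) \<le> 1 / 3700" "exp (- 18.65 :: real) \<le> 1 / 10 ^ 8"
proof -
  have inv: "exp (- x) \<le> 1 / c" if "0 < c" "c \<le> exp x" for x c :: real
    using that by (simp add: exp_minus divide_inverse)
  have "(1 / 0.0925 :: real) \<le> (\<Sum>k<10. 2.3872 ^ k / fact k)"
    by (simp add: lessThan_nat_numeral fact_numeral power_divide)
  also have "\<dots> \<le> exp 2.3872"
    by (rule exp_ge_partial_sum) simp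
  finally show "exp (- 2.3872 :: real) \<le> 0.0925"
    using inv[of "1 / 0.0925" "2.3872"] by simp
  have "(1 / 0.048 :: real) \<le> (\<Sum>k<12. 3.04175 ^ k / fact k)"
    by (simp add: lessThan_nat_numeral fact_numeral power_divide)
  also have "\<dots> \<le> exp 3.04175"
    by (rule exp_ge_partial_sum) simp
  finally show "exp (- 3.04175 :: real) \<le> 0.048"
    using inv[of "1 / 0.048" "3.04175"] by simp
  have "(7.8 :: real) \<le> (\<Sum>k<10. 2.0625 ^ k / fact k)"
    by (simp add: lessThan_nat_numeral fact_numeral power_divide)
  also have "\<dots> \<le> exp 2.0625"
    by (rule exp_ge_partial_sum) simp
  finally have "(7.8 :: real) ^ 4 \<le> exp 2.0625 ^ 4"
    by (rule power_mono) simp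
  also have "\<dots> = exp 8.25"
    by (simp add: exp_of_nat_mult[symmetric])
  finally have "(3700 :: real) \<le> exp 8.25"
    by (simp add: power_divide)
  then show "exp (- 8.25 :: real) \<le> 1 / 3700"
    by (rule inv[rotated]) simp
  have "(10 :: real) \<le> (\<Sum>k<10. 2.33125 ^ k / fact k)"
    by (simp add: lessThan_nat_numeral fact_numeral power_divide)
  also have "\<dots> \<le> exp 2.33125"
    by (rule exp_ge_partial_sum) simp
  finally have "(10 :: real) ^ 8 \<le> exp 2.33125 ^ 8"
    by (rule power_mono) simp
  also have "\<dots> = exp 18.65"
    by (simp add: exp_of_nat_mult[symmetric])
  finally show "exp (- 18.65 :: real) \<le> 1 / 10 ^ 8"
    by (intro inv) auto
qed

lemma has_integral_le_integral:
  fixes f g :: "real \<Rightarrow> real"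
  assumes "f integrable_on {a..b}" "(g has_integral I) {a..b}" "\<And>x. x \<in> {a..b} \<Longrightarrow> g x \<le> f x"
  shows "I \<le> integral {a..b} f"
  using has_integral_le[OF assms(2) integrable_integral[OF assms(1)] assms(3)] .

text \<open>The interval is cut at \<open>0.8 * t\<^sup>2\<close>, \<open>1.15 * t\<^sup>2\<close>, \<open>0.4 * t\<close> and \<open>0.7 * t\<close>. On the first piece the phase is at
  most 0.53 and contributes the main term, at least \<open>0.01307 * t ^ 6\<close>. The second piece reaches to where the phase
  may come near \<open>pi / 2\<close>; its contribution is nonnegative and is dropped. On the last three pieces the integrand
  is bounded by \<open>exp (- decay) * (1 - cos \<theta>)\<close>, with total at most \<open>0.01148 * t ^ 6\<close> by the three regimes of
  \<open>decay_lower\<close>.\<close>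
lemma saddle_integral_nonneg:
  fixes t :: real
  assumes t: "0 < t" "t \<le> 1/5"
  defines "f \<equiv> \<lambda>\<theta>. exp (- decay (exp (- t)) \<theta>) * cos (phase (exp (- t)) \<theta>) * (1 - cos \<theta>)"
  assumes int: "f integrable_on {0..pi}"
  shows "0 \<le> integral {0..pi} f"
proof -
  define q where "q = exp (- t)"
  have q: "0 < q" "q < 1"
    using t by (auto simp: q_def)
  have f: "f \<theta> = exp (- decay q \<theta>) * cos (phase q \<theta>) * (1 - cos \<theta>)" for \<theta>
    by (simp add: f_def q_def)
  define x1 x2 x3 x4 where "x1 = 0.8 * t\<^sup>2" and "x2 = 1.15 * t\<^sup>2" and "x3 = 0.4 * t" and "x4 = 0.7 * t"
  have t2: "t\<^sup>2 \<le> 0.2 * t"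
    using t by (simp add: power2_eq_square)
  have ordered: "0 \<le> x1" "x1 \<le> x2" "x2 \<le> x3" "x3 \<le> x4" "x4 \<le> pi"
    using t t2 pi_gt3 by (auto simp: x1_def x2_def x3_def x4_def)
  have sub: "f integrable_on {a..b}" if "0 \<le> a" "b \<le> pi" for a b
    by (rule integrable_subinterval_real[OF int]) (use that in auto)
  have phase_le: "\<bar>phase q \<theta>\<bar> \<le> 5.1 * \<theta> ^ 3 / t ^ 5" if "0 \<le> \<theta>" for \<theta>
  proof -
    have "\<bar>phase q \<theta>\<bar> \<le> moment 2 q * (\<theta> ^ 3 / 6)"
      using abs_phase_le[OF q, of \<theta>] that by simp
    also have "\<dots> \<le> 30.6 / t ^ 5 * (\<theta> ^ 3 / 6)"
      using moment_le(3)[OF t(1)] t that by (intro mult_right_mono) (auto simp: q_def)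
    finally show ?thesis by simp
  qed
  have lower: "- (exp (- decay q \<theta>) * (1 - cos \<theta>)) \<le> f \<theta>" for \<theta>
  proof -
    have "(- 1) * (exp (- decay q \<theta>) * (1 - cos \<theta>)) \<le> cos (phase q \<theta>) * (exp (- decay q \<theta>) * (1 - cos \<theta>))"
      by (intro mult_right_mono) auto
    then show ?thesis
      by (simp add: f mult_ac)
  qed
  have I1: "0.01307 * t ^ 6 \<le> integral {0..x1} f"
  proof -
    (* 3.73 is half the constant 7.46 in the bound for the variance *)
    define a where "a = 3.73 / t ^ 4"
    have a: "0 < a" "a * x1\<^sup>2 = 2.3872" "a\<^sup>2 = 3.73\<^sup>2 / t ^ 8"
      using t by (simp_all add: a_def x1_def power_mult_distrib power_divide flip: power_mult)
    (* cos phase >= 0.86, 1 - cos theta >= 0.499 theta^2 and theta^2 >= theta^3 / (0.8 t^2),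
       and 0.86 * 0.499 / 0.8 > 0.53 *)
    have "0.01307 * t ^ 6 \<le> 0.53 / t\<^sup>2 * ((1 - (1 + 2.3872) * 0.0925) / (2 * (3.73\<^sup>2 / t ^ 8)))"
      using t by (simp add: power_numeral_reduce divide_simps)
    also have "\<dots> \<le> 0.53 / t\<^sup>2 * (((1 + a * 0\<^sup>2) * exp (- (a * 0\<^sup>2)) - (1 + a * x1\<^sup>2) * exp (- (a * x1\<^sup>2))) / (2 * a\<^sup>2))"
      unfolding a(2,3) using t exp_numerics(1) by (intro mult_left_mono divide_right_mono) auto
    also have "\<dots> \<le> integral {0..x1} f"
    proof (rule has_integral_le_integral)
      show "((\<lambda>\<theta>. 0.53 / t\<^sup>2 * (\<theta> ^ 3 * exp (- (a * \<theta>\<^sup>2)))) has_integral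
          0.53 / t\<^sup>2 * (((1 + a * 0\<^sup>2) * exp (- (a * 0\<^sup>2)) - (1 + a * x1\<^sup>2) * exp (- (a * x1\<^sup>2))) / (2 * a\<^sup>2))) {0..x1}"
        by (intro has_integral_mult_right cube_gauss_integral a ordered)
      fix \<theta> assume \<theta>: "\<theta> \<in> {0..x1}"
      have x1': "x1 \<le> 0.032"
        using power_mono[OF t(2), of 2] t by (simp add: x1_def power2_eq_square)
      have "\<bar>phase q \<theta>\<bar> \<le> 5.1 * \<theta> ^ 3 / t ^ 5"
        using phase_le \<theta> by simp
      also have "\<dots> \<le> 5.1 * x1 ^ 3 / t ^ 5"
        using \<theta> t by (intro divide_right_mono mult_left_mono power_mono) auto
      also have "\<dots> = 2.6112 * t"
        using t by (simp add: x1_def power_mult_distrib power_numeral_reduce)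
      finally have ph: "\<bar>phase q \<theta>\<bar> \<le> 0.5223"
        using t by simp
      have "(phase q \<theta>)\<^sup>2 \<le> 0.5223\<^sup>2"
        using power_mono[OF ph, of 2] by simp
      then have cos1: "0.86 \<le> cos (phase q \<theta>)"
        using one_minus_cos_le[of "phase q \<theta>"] by (simp add: power2_eq_square)
      have "(1 - 0.0001) * (\<theta> / 2) \<le> sin (\<theta> / 2)"
      proof (rule sin_ge)
        have "(\<theta> / 2)\<^sup>2 \<le> 0.016\<^sup>2"
          using \<theta> x1' by (intro power_mono) auto
        then show "(\<theta> / 2)\<^sup>2 \<le> 6 * 0.0001"
          by (simp add: power2_eq_square)
      qed (use \<theta> in auto)
      then have sq: "((1 - 0.0001) * (\<theta> / 2))\<^sup>2 \<le> (sin (\<theta> / 2))\<^sup>2"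
        using \<theta> by (intro power_mono) auto
      have "2499 * \<theta>\<^sup>2 \<le> 10000 * ((1 - 0.0001) * (\<theta> / 2))\<^sup>2"
        by (simp add: power_mult_distrib power_divide)
      also have "\<dots> \<le> 10000 * (sin (\<theta> / 2))\<^sup>2"
        by (rule mult_left_mono[OF sq]) simp
      finally have "2499 * \<theta>\<^sup>2 \<le> 10000 * (sin (\<theta> / 2))\<^sup>2" .
      moreover have "499 * Q \<le> 1000 * (2 * S)" if "2499 * Q \<le> 10000 * S" "0 \<le> Q" for Q S :: real
        using that by linarith
      ultimately have "499 * \<theta>\<^sup>2 \<le> 1000 * (2 * (sin (\<theta> / 2))\<^sup>2)"
        using zero_le_power2 by blast
      also have "2 * (sin (\<theta> / 2))\<^sup>2 = 1 - cos \<theta>"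
        using cos_double_sin[of "\<theta> / 2"] by simp
      finally have "499 * \<theta>\<^sup>2 \<le> 1000 * (1 - cos \<theta>)" .
      then have quad: "0.499 * \<theta>\<^sup>2 \<le> 1 - cos \<theta>"
        by simp
      have cube: "\<theta> ^ 3 \<le> 0.8 * t\<^sup>2 * \<theta>\<^sup>2"
        using \<theta> mult_right_mono[of \<theta> x1 "\<theta>\<^sup>2"] by (simp add: x1_def power_numeral_reduce)
      have "0.53 / t\<^sup>2 * \<theta> ^ 3 \<le> 0.53 / t\<^sup>2 * (0.8 * t\<^sup>2 * \<theta>\<^sup>2)"
        by (rule mult_left_mono[OF cube]) simp
      also have "\<dots> = 0.424 * \<theta>\<^sup>2"
        using t by simp
      also have "\<dots> \<le> 0.86 * (0.499 * \<theta>\<^sup>2)"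
        by simp
      also have "\<dots> \<le> 0.86 * (1 - cos \<theta>)"
        using quad by (intro mult_left_mono) auto
      finally have "0.53 / t\<^sup>2 * \<theta> ^ 3 \<le> 0.86 * (1 - cos \<theta>)" .
      moreover have "exp (- (a * \<theta>\<^sup>2)) \<le> exp (- decay q \<theta>)"
      proof -
        have "decay q \<theta> \<le> moment 1 q * (\<theta>\<^sup>2 / 2)"
          by (rule decay_le[OF q])
        also have "\<dots> \<le> 7.46 / t ^ 4 * (\<theta>\<^sup>2 / 2)"
          using moment_le(2)[OF t(1)] by (intro mult_right_mono) (auto simp: q_def)
        finally show ?thesis
          by (simp add: a_def)
      qed
      ultimately have "(0.53 / t\<^sup>2 * \<theta> ^ 3) * exp (- (a * \<theta>\<^sup>2)) \<le> (0.86 * (1 - cos \<theta>)) * exp (- decay q \<theta>)"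
        by (rule mult_mono) auto
      also have "\<dots> \<le> (cos (phase q \<theta>) * (1 - cos \<theta>)) * exp (- decay q \<theta>)"
        using cos1 by (intro mult_right_mono) auto
      finally show "0.53 / t\<^sup>2 * (\<theta> ^ 3 * exp (- (a * \<theta>\<^sup>2))) \<le> f \<theta>"
        by (simp add: f mult_ac)
    qed (use ordered in \<open>auto intro: sub\<close>)
    finally show ?thesis .
  qed
  have I2: "0 \<le> integral {x1..x2} f"
  proof (rule Henstock_Kurzweil_Integration.integral_nonneg)
    fix \<theta> assume \<theta>: "\<theta> \<in> {x1..x2}"
    then have pos: "0 \<le> \<theta>"
      using ordered by auto
    have "\<bar>phase q \<theta>\<bar> \<le> 5.1 * \<theta> ^ 3 / t ^ 5"
      using phase_le pos by simp
    also have "\<dots> \<le> 5.1 * x2 ^ 3 / t ^ 5"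
      using \<theta> pos t by (intro divide_right_mono mult_left_mono power_mono) auto
    also have "\<dots> = 5.1 * 1.15 ^ 3 * t"
      using t by (simp add: x2_def power_mult_distrib power_numeral_reduce)
    also have "\<dots> \<le> pi / 2"
      using t pi_approx by (simp add: power_numeral_reduce)
    finally have "0 \<le> cos (phase q \<theta>)"
      by (intro cos_ge_zero) auto
    then show "0 \<le> f \<theta>"
      by (simp add: f)
  qed (use ordered in \<open>auto intro: sub\<close>)
  have I3: "- 0.00798 * t ^ 6 \<le> integral {x2..x3} f"
  proof -
    define a where "a = 2.3 / t ^ 4"
    have a: "0 < a" "a * x2\<^sup>2 = 3.04175" "a\<^sup>2 = 2.3\<^sup>2 / t ^ 8"
      using t by (simp_all add: a_def x2_def power_mult_distrib power_divide flip: power_mult)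
    have x2: "0 < x2"
      using t by (simp add: x2_def)
    have "((1 + a * x2\<^sup>2) * exp (- (a * x2\<^sup>2)) - (1 + a * x3\<^sup>2) * exp (- (a * x3\<^sup>2))) / (2 * a\<^sup>2)
        \<le> ((1 + 3.04175) * 0.048) / (2 * a\<^sup>2)"
    proof (rule divide_right_mono)
      have "0 \<le> (1 + a * x3\<^sup>2) * exp (- (a * x3\<^sup>2))"
        using a by (intro mult_nonneg_nonneg) auto
      then show "(1 + a * x2\<^sup>2) * exp (- (a * x2\<^sup>2)) - (1 + a * x3\<^sup>2) * exp (- (a * x3\<^sup>2)) \<le> (1 + 3.04175) * 0.048"
        unfolding a(2) using exp_numerics(2) by simp
    qed simp
    then have "1 / (2 * x2) * (((1 + a * x2\<^sup>2) * exp (- (a * x2\<^sup>2)) - (1 + a * x3\<^sup>2) * exp (- (a * x3\<^sup>2))) / (2 * a\<^sup>2))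
        \<le> 1 / (2 * x2) * (((1 + 3.04175) * 0.048) / (2 * a\<^sup>2))"
      using x2 by (intro mult_left_mono) auto
    also have "\<dots> \<le> 0.00798 * t ^ 6"
      unfolding a(3) x2_def using t by (simp add: power_numeral_reduce divide_simps)
    finally have "- 0.00798 * t ^ 6 \<le> - (1 / (2 * x2) * (((1 + a * x2\<^sup>2) * exp (- (a * x2\<^sup>2)) - (1 + a * x3\<^sup>2) * exp (- (a * x3\<^sup>2))) / (2 * a\<^sup>2)))"
      by linarith
    also have "\<dots> \<le> integral {x2..x3} f"
    proof (rule has_integral_le_integral)
      show "((\<lambda>\<theta>. - (1 / (2 * x2) * (\<theta> ^ 3 * exp (- (a * \<theta>\<^sup>2))))) has_integral
         - (1 / (2 * x2) * (((1 + a * x2\<^sup>2) * exp (- (a * x2\<^sup>2)) - (1 + a * x3\<^sup>2) * exp (- (a * x3\<^sup>2))) / (2 * a\<^sup>2)))) {x2..x3}"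
        by (intro has_integral_neg has_integral_mult_right cube_gauss_integral a ordered)
      fix \<theta> assume \<theta>: "\<theta> \<in> {x2..x3}"
      have "exp (- decay q \<theta>) * (1 - cos \<theta>) \<le> exp (- (a * \<theta>\<^sup>2)) * (\<theta>\<^sup>2 / 2)"
        using decay_lower(1)[OF t, of \<theta>] \<theta> ordered one_minus_cos_le[of \<theta>]
        by (intro mult_mono) (auto simp: a_def x3_def q_def)
      also have "\<theta>\<^sup>2 / 2 \<le> 1 / (2 * x2) * \<theta> ^ 3"
        using \<theta> x2 mult_right_mono[of x2 \<theta> "\<theta>\<^sup>2"] by (simp add: field_simps power_numeral_reduce)
      finally have "exp (- decay q \<theta>) * (1 - cos \<theta>) \<le> 1 / (2 * x2) * (\<theta> ^ 3 * exp (- (a * \<theta>\<^sup>2)))"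
        by (simp add: mult_ac)
      then show "- (1 / (2 * x2) * (\<theta> ^ 3 * exp (- (a * \<theta>\<^sup>2)))) \<le> f \<theta>"
        using lower[of \<theta>] by linarith
    qed (use ordered in \<open>auto intro: sub\<close>)
    finally show ?thesis .
  qed
  (* s >= 1 expresses t <= 1/5 *)
  define s where "s = 0.04 / t\<^sup>2"
  have s: "1 \<le> s" "1 / s ^ 3 = 15625 * t ^ 6"
    using t power_mono[OF t(2), of 2] by (simp_all add: s_def power_divide power_numeral_reduce)
  have const: "- (c * E) * (b - a) \<le> integral {a..b} f"
    if ab: "0 \<le> a" "a \<le> b" "b \<le> pi"
      and dec: "\<And>\<theta>. \<theta> \<in> {a..b} \<Longrightarrow> exp (- decay q \<theta>) \<le> E"
      and c: "\<And>\<theta>. \<theta> \<in> {a..b} \<Longrightarrow> 1 - cos \<theta> \<le> c" for a b c E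
  proof (rule has_integral_le_integral)
    show "((\<lambda>\<theta>. - (c * E)) has_integral - (c * E) * (b - a)) {a..b}"
      using has_integral_const_real[of "- (c * E)" a b] ab by (simp add: mult.commute)
    fix \<theta> assume \<theta>: "\<theta> \<in> {a..b}"
    have "exp (- decay q \<theta>) * (1 - cos \<theta>) \<le> E * c"
      using dec[OF \<theta>] c[OF \<theta>] by (intro mult_mono) (auto intro: order_trans[rotated])
    then show "- (c * E) \<le> f \<theta>"
      using lower[of \<theta>] by (simp add: mult.commute)
  qed (use ab in \<open>auto intro: sub\<close>)
  have I4: "- 0.0025 * t ^ 6 \<le> integral {x3..x4} f"
  proof -
    have "- 0.0025 * t ^ 6 \<le> - (x4\<^sup>2 / 2 * (15625 * t ^ 6 / 3700)) * (x4 - x3)"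
    proof -
      have "t ^ 3 \<le> (1/5) ^ 3"
        using t by (intro power_mono) auto
      then have "t ^ 3 * t ^ 6 \<le> 0.008 * t ^ 6"
        by (intro mult_right_mono) (auto simp: power_divide)
      then have "0.0735 * 15625 / 3700 * (t ^ 3 * t ^ 6) \<le> 0.0735 * 15625 / 3700 * (0.008 * t ^ 6)"
        by (rule mult_left_mono) simp
      also have "\<dots> \<le> 0.0025 * t ^ 6"
        by simp
      also have "0.0735 * 15625 / 3700 * (t ^ 3 * t ^ 6) = (x4\<^sup>2 / 2 * (15625 * t ^ 6 / 3700)) * (x4 - x3)"
        by (simp add: x3_def x4_def power2_eq_square power3_eq_cube)
      finally show ?thesis
        by simp
    qed
    also have "\<dots> \<le> integral {x3..x4} f"
    proof (rule const)
      fix \<theta> assume \<theta>: "\<theta> \<in> {x3..x4}"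
      have "8.25 * s \<le> decay q \<theta>"
        using decay_lower(2)[OF t, of \<theta>] \<theta> ordered by (simp add: x3_def q_def s_def)
      then have "exp (- decay q \<theta>) \<le> exp (- (8.25 * s))"
        by simp
      also have "\<dots> \<le> exp (- 8.25) / s ^ 3"
        using s by (intro exp_minus_mult_le) auto
      also have "\<dots> = exp (- 8.25) * (15625 * t ^ 6)"
        unfolding s(2)[symmetric] by simp
      also have "\<dots> \<le> 1 / 3700 * (15625 * t ^ 6)"
        using exp_numerics(3) t by (intro mult_right_mono) auto
      finally show "exp (- decay q \<theta>) \<le> 15625 * t ^ 6 / 3700"
        by simp
      have "\<theta>\<^sup>2 \<le> x4\<^sup>2"
        using \<theta> ordered by (intro power_mono) auto
      then show "1 - cos \<theta> \<le> x4\<^sup>2 / 2"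
        using one_minus_cos_le[of \<theta>] by linarith
    qed (use ordered in auto)
    finally show ?thesis .
  qed
  have I5: "- 0.001 * t ^ 6 \<le> integral {x4..pi} f"
  proof -
    have "2 * (15625 * t ^ 6 / 10 ^ 8) * (pi - x4) \<le> 2 * (15625 * t ^ 6 / 10 ^ 8) * 3.2"
      using t pi_approx by (intro mult_left_mono) (auto simp: x4_def)
    also have "\<dots> \<le> 0.001 * t ^ 6"
      using t by simp
    finally have "- 0.001 * t ^ 6 \<le> - (2 * (15625 * t ^ 6 / 10 ^ 8)) * (pi - x4)"
      by simp
    also have "\<dots> \<le> integral {x4..pi} f"
    proof (rule const)
      fix \<theta> assume \<theta>: "\<theta> \<in> {x4..pi}"
      have "18.65 * s \<le> decay q \<theta>"
        using decay_lower(3)[OF t, of \<theta>] \<theta> ordered by (simp add: x4_def q_def s_def)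
      then have "exp (- decay q \<theta>) \<le> exp (- (18.65 * s))"
        by simp
      also have "\<dots> \<le> exp (- 18.65) / s ^ 3"
        using s by (intro exp_minus_mult_le) auto
      also have "\<dots> = exp (- 18.65) * (15625 * t ^ 6)"
        unfolding s(2)[symmetric] by simp
      also have "\<dots> \<le> 1 / 10 ^ 8 * (15625 * t ^ 6)"
        using exp_numerics(4) t by (intro mult_right_mono) auto
      finally show "exp (- decay q \<theta>) \<le> 15625 * t ^ 6 / 10 ^ 8"
        by simp
      show "1 - cos \<theta> \<le> 2"
        using abs_one_minus_cos_le_2[of \<theta>] by linarith
    qed (use ordered in auto)
    finally show ?thesis .
  qed
  have comb: "integral {a..b} f = integral {a..c} f + integral {c..b} f" if "0 \<le> a" "a \<le> c" "c \<le> b" "b \<le> pi" for a b c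
    using Henstock_Kurzweil_Integration.integral_combine[OF that(2,3) sub] that by simp
  have "0 \<le> 0.01307 * t ^ 6 + 0 + - 0.00798 * t ^ 6 + - 0.0025 * t ^ 6 + - 0.001 * t ^ 6"
    by simp
  also have "\<dots> \<le> integral {0..x1} f + integral {x1..x2} f + integral {x2..x3} f + integral {x3..x4} f + integral {x4..pi} f"
    by (intro add_mono I1 I2 I3 I4 I5)
  also have "\<dots> = integral {0..pi} f"
    using ordered comb[of 0 x1 pi] comb[of x1 x2 pi] comb[of x2 x3 pi] comb[of x3 x4 pi] by simp
  finally show ?thesis .
qed

section \<open>Log-concavity for large and for small sizes\<close>

text \<open>The mean size is at most \<open>2.4048 / t ^ 3\<close>, which is below 301 for \<open>t > 1/5\<close>.\<close>
lemma saddle_parameter_small: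
  assumes "0 < t" "301 \<le> moment 0 (exp (- t))"
  shows "t \<le> 1/5"
proof (rule ccontr)
  assume "\<not> t \<le> 1/5"
  then have "(1/5) ^ 3 \<le> t ^ 3"
    by (intro power_mono) auto
  then have "301 * (1/5) ^ 3 \<le> 301 * t ^ 3"
    by simp
  also have "301 * t ^ 3 \<le> 2.4048"
    using order_trans[OF assms(2) moment_le(1)[OF assms(1)]] assms(1) by (simp add: pos_le_divide_eq)
  finally show False
    by (simp add: power_divide)
qed

text \<open>The arithmetic-geometric mean argument: \<open>4 * A * B \<le> (A + B)\<^sup>2 \<le> (2 * M)\<^sup>2\<close>, and the powers of \<open>q\<close> cancel
  from \<open>A * B \<le> M\<^sup>2\<close>.\<close>
lemma PL_log_concave_large:
  assumes "301 \<le> n"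
  shows "PL (n - 1) * PL (n + 1) \<le> (PL n)\<^sup>2"
proof -
  obtain q where q: "0 < q" "q < 1" "moment 0 q = real n"
    using saddle_point[of n] assms by auto
  define t where "t = - ln q"
  have qt: "q = exp (- t)" "0 < t"
    using q by (auto simp: t_def)
  have t: "t \<le> 1/5"
    by (rule saddle_parameter_small) (use q qt assms in auto)
  define A B M where "A = PL (n - 1) * q ^ (n - 1)" and "B = PL (n + 1) * q ^ (n + 1)" and "M = PL n * q ^ n"
  have int: "((\<lambda>\<theta>. exp (- decay q \<theta>) * cos (phase q \<theta>) * (1 - cos \<theta>)) has_integral
     (pi * exp (- log_cos q 0) / 2 * (2 * M - A - B))) {0..pi}"
    using second_difference_integral[OF q(1,2,3)] assms by (simp add: A_def B_def M_def)
  have "0 \<le> pi * exp (- log_cos q 0) / 2 * (2 * M - A - B)"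
    using saddle_integral_nonneg[OF qt(2) t] int unfolding qt(1)[symmetric] by (auto simp: has_integral_iff)
  moreover have "0 < pi * exp (- log_cos q 0) / 2"
    by simp
  ultimately have "A + B \<le> 2 * M"
    unfolding zero_le_mult_iff by linarith
  moreover have "0 \<le> A" "0 \<le> B"
    using q by (simp_all add: A_def B_def)
  ultimately have "(A + B)\<^sup>2 \<le> (2 * M)\<^sup>2"
    by (intro power_mono) auto
  moreover have "4 * (A * B) \<le> (A + B)\<^sup>2"
    using zero_le_power2[of "A - B"] by (simp add: power2_eq_square algebra_simps)
  ultimately have "A * B \<le> M\<^sup>2"
    by (simp add: power_mult_distrib)
  moreover have "A * B = real (PL (n - 1) * PL (n + 1)) * q ^ (2 * n)"
  proof -
    have "q ^ (n - 1) * q ^ (n + 1) = q ^ (2 * n)"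
    proof -
      have "n - 1 + (n + 1) = 2 * n"
        using assms by simp
      then show ?thesis
        by (simp only: power_add[symmetric])
    qed
    then show ?thesis
      by (simp add: A_def B_def mult_ac)
  qed
  moreover have "M\<^sup>2 = real ((PL n)\<^sup>2) * q ^ (2 * n)"
    by (simp add: M_def power_mult_distrib power_mult[symmetric] mult.commute)
  ultimately have "real (PL (n - 1) * PL (n + 1)) \<le> real ((PL n)\<^sup>2)"
    using q(1) by (simp add: mult_le_cancel_right)
  then show ?thesis
    by (simp only: of_nat_le_iff)
qed

text \<open>For small sizes, the values of \<open>PL\<close> are tabulated in descending order, so that the tail of a table is again such a table
  and pairs with the divisor sums in ascending order. Integers are used because their binary numerals compute fast by
  rewriting.\<close>
fun dot :: "int list \<Rightarrow> int list \<Rightarrow> int" where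
  "dot (x # xs) (y # ys) = x * y + dot xs ys"
| "dot xs ys = 0"

fun satisfies_recurrence :: "int \<Rightarrow> int list \<Rightarrow> int list \<Rightarrow> bool" where
  "satisfies_recurrence n ss [] = True"
| "satisfies_recurrence n ss [p] = (p = 1)"
| "satisfies_recurrence n ss (p # p' # ps) =
     (n * p = dot ss (p' # ps) \<and> satisfies_recurrence (n - 1) ss (p' # ps))"

fun log_concave :: "int list \<Rightarrow> bool" where
  "log_concave (x # y # z # xs) = (x * z \<le> y * y \<and> log_concave (y # z # xs))"
| "log_concave xs = True"

definition divisor_square_sum :: "int \<Rightarrow> int" where
  "divisor_square_sum k = sum_list (map (\<lambda>d. if k mod d = 0 then d * d else 0) [1..k])"

lemma dot_eq_sum:
  "length ys \<le> length xs \<Longrightarrow> dot xs ys = (\<Sum>i<length ys. xs ! i * ys ! i)"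
proof (induction xs ys rule: dot.induct)
  case (1 x xs y ys)
  then show ?case
    by (simp add: sum.lessThan_Suc_shift del: sum.lessThan_Suc)
qed auto

lemma divisor_square_sum_eq: "divisor_square_sum (int k) = int (sigma2 k)"
proof (cases "k = 0")
  case False
  have "divisor_square_sum (int k) = (\<Sum>d\<in>{1..int k}. if int k mod d = 0 then d * d else 0)"
    by (simp add: divisor_square_sum_def interv_sum_list_conv_sum_set_int)
  also have "\<dots> = (\<Sum>d\<in>int ` {d. d dvd k}. d * d)"
  proof (rule sum.mono_neutral_cong_right)
    show "int ` {d. d dvd k} \<subseteq> {1..int k}"
      using False by (auto dest: dvd_imp_le intro: Suc_leI dvd_pos_nat)
    show "\<forall>d\<in>{1..int k} - int ` {d. d dvd k}. (if int k mod d = 0 then d * d else 0) = 0"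
    proof
      fix d assume d: "d \<in> {1..int k} - int ` {d. d dvd k}"
      then have "d = int (nat d)"
        by simp
      then have "\<not> d dvd int k"
        using d by (metis DiffD2 image_eqI int_dvd_int_iff mem_Collect_eq)
      then show "(if int k mod d = 0 then d * d else 0) = 0"
        by (auto simp: dvd_eq_mod_eq_0)
    qed
    show "(if int k mod d = 0 then d * d else 0) = d * d" if "d \<in> int ` {d. d dvd k}" for d
      using that by (auto simp flip: dvd_eq_mod_eq_0)
  qed simp
  also have "\<dots> = int (sigma2 k)"
    by (subst sum.reindex) (auto simp: sigma2_def power2_eq_square)
  finally show ?thesis .
qed (simp add: divisor_square_sum_def sigma2_def infinite_UNIV_nat)

lemma satisfies_recurrence_imp_PL:
  assumes "satisfies_recurrence (int n) ss ps" "length ps = Suc n"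
    and "n \<le> length ss" "\<And>i. i < length ss \<Longrightarrow> ss ! i = int (sigma2 (Suc i))"
  shows "ps = map (\<lambda>i. int (PL (n - i))) [0..<Suc n]"
  using assms(1-3)
proof (induction n arbitrary: ps)
  case 0
  then obtain p where "ps = [p]"
    by (auto simp: length_Suc_conv)
  with 0 show ?case
    by (simp add: PL_0)
next
  case (Suc n)
  then obtain p p' qs where ps: "ps = p # p' # qs" "length (p' # qs) = Suc n"
    by (auto simp: length_Suc_conv)
  have IH: "p' # qs = map (\<lambda>i. int (PL (n - i))) [0..<Suc n]"
    by (rule Suc.IH) (use Suc.prems ps in auto)
  have "int (Suc n) * p = dot ss (p' # qs)"
    using Suc.prems(1) ps by simp
  also have "\<dots> = (\<Sum>i<Suc n. ss ! i * (p' # qs) ! i)"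
    using dot_eq_sum[of "p' # qs" ss] ps Suc.prems(3) by simp
  also have "\<dots> = (\<Sum>i<Suc n. int (sigma2 (Suc i) * PL (Suc n - Suc i)))"
    unfolding IH using Suc.prems(3) assms(4) by (intro sum.cong refl) (auto simp del: upt_Suc)
  also have "\<dots> = int (\<Sum>k\<in>{1..Suc n}. sigma2 k * PL (Suc n - k))"
    by (simp only: One_nat_def sum.atLeast1_atMost_eq of_nat_sum)
  also have "\<dots> = int (Suc n) * int (PL (Suc n))"
    by (simp only: PL_recurrence[symmetric] of_nat_mult)
  finally have "p = int (PL (Suc n))"
    by (simp del: of_nat_Suc)
  moreover have "map (\<lambda>i. int (PL (Suc n - i))) [0..<Suc (Suc n)] =
      int (PL (Suc n)) # map (\<lambda>i. int (PL (n - i))) [0..<Suc n]"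
    by (simp add: upt_rec[of 0] map_Suc_upt[symmetric] comp_def del: upt_Suc)
  ultimately show ?case
    using ps IH by simp
qed

lemma log_concave_nth:
  "log_concave xs \<Longrightarrow> i + 2 < length xs \<Longrightarrow> xs ! i * xs ! (i + 2) \<le> xs ! (i + 1) * xs ! (i + 1)"
proof (induction xs arbitrary: i rule: log_concave.induct)
  case (1 x y z xs)
  then show ?case
    by (cases i) auto
qed auto

text \<open>The divisor sums \<open>sigma2 1\<close> to \<open>sigma2 301\<close>, and the values \<open>PL 301\<close> down to \<open>PL 0\<close>.\<close>
definition sigma2_table :: "int list" where
  "sigma2_table = [
    1, 5, 10, 21, 26, 50, 50, 85, 91, 130, 122, 210, 170, 250, 260, 341, 290, 455, 362, 546, 500, 610, 530,
    850, 651, 850, 820, 1050, 842, 1300, 962, 1365, 1220, 1450, 1300, 1911, 1370, 1810, 1700, 2210, 1682,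
    2500, 1850, 2562, 2366, 2650, 2210, 3410, 2451, 3255, 2900, 3570, 2810, 4100, 3172, 4250, 3620, 4210,
    3482, 5460, 3722, 4810, 4550, 5461, 4420, 6100, 4490, 6090, 5300, 6500, 5042, 7735, 5330, 6850, 6510,
    7602, 6100, 8500, 6242, 8866, 7381, 8410, 6890, 10500, 7540, 9250, 8420, 10370, 7922, 11830, 8500, 11130,
    9620, 11050, 9412, 13650, 9410, 12255, 11102, 13671, 10202, 14500, 10610, 14450, 13000, 14050, 11450,
    17220, 11882, 15860, 13700, 17050, 12770, 18100, 13780, 17682, 15470, 17410, 14500, 22100, 14763, 18610,
    16820, 20202, 16276, 22750, 16130, 21845, 18500, 22100, 17162, 25620, 18100, 22450, 21320, 24650, 18770,
    26500, 19322, 27300, 22100, 25210, 20740, 31031, 21892, 26650, 24510, 28770, 22202, 32550, 22802, 30770,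
    26390, 30500, 25012, 35700, 24650, 31210, 28100, 35490, 26500, 36905, 26570, 35322, 31720, 34450, 27890,
    42500, 28731, 37700, 32942, 38850, 29930, 42100, 32550, 41602, 34820, 39610, 32042, 49686, 32762, 42500,
    37220, 45050, 35620, 48100, 35380, 46410, 41000, 47060, 36482, 54610, 37250, 47050, 44200, 51471, 38810,
    55510, 39602, 55335, 44900, 51010, 42100, 60900, 43732, 53050, 48230, 57970, 44164, 65000, 44522, 59010,
    50420, 57250, 48100, 69700, 48100, 59410, 53300, 66612, 49300, 68500, 49730, 68250, 59241, 63850, 51530,
    76020, 52442, 68900, 61000, 71570, 54290, 77350, 57460, 73122, 62420, 72500, 57122, 88660, 58082, 73815,
    66430, 78162, 63726, 84100, 61540, 81770, 68900, 81380, 63002, 95550, 64660, 80650, 75400, 87381, 66050,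
    92500, 68500, 92820, 76622, 85810, 69170, 103700, 73060, 90500, 79220, 94290, 72362, 106600, 73442,
    98890, 85000, 93850, 79422, 111300, 76730, 96610, 87542, 110500, 78962, 110500, 80090, 105882, 94120,
    103700, 84100, 124215, 83811, 109460, 94100, 111930, 85850, 122550, 90532, 116450, 100040, 111010, 90100,
    136710, 92500]"

definition PL_table :: "int list" where
  "PL_table = [
    6866054977329187957535648374162070029, 5634370810088084360738497876064693237,
    4622642746683604460629905262200315944, 3791766493596251385687524530606443328,
    3109558805720710859909672746848938692, 2549537975547543398201380257427678286,
    2089918253048391105706953536780661839, 1712780833268924216156805886597047924,
    1403390545423892258095648913480812408, 1149632749338954321886586148049579485,
    941549386263704262725695846634876846, 770956801986881757447520180979498278,
    631130993829150695486303299322274708, 516548439613697583950793490248711287,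
    422672737309249456029257668289335708, 345778994186682772990463233496343445,
    282809316499132352604884918958723460, 231253916577090778569708887377722329,
    189053316587672497268846702421461154, 154517922411928547295053102743948814,
    126261896396707768167577329446424334, 103148798323148967760244145001679906,
    84246909795195833625648909277342872, 68792524912460591129014486044216088,
    56159793206595625381227507626457893, 45835950669848805982034726274706688,
    37400980606719541294612160177435205, 30510915689874993922062302927377010,
    24884132353589850904431276459236861, 20290103757169636288951030921193372,
    16540172326277427124938140759498020, 13479980904186092772629597197181908,
    10983265765011986021785770259961293, 8946767588035295128136488643938462,
    7286059971158757261053828665558926, 5932130825460814726636364599563195,
    4828581404359689218551495611439934, 3929331903227816731256899669283103,
    3196742443830235576980633801014910, 2600074595124129311510815995963121,
    2114232005726486600286218545491156, 1718729750866155029307430963297123,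
    1396851053650552051639076927200348, 1134957477461704446348483858375799,
    921924791673312715212145666208036, 748681723961775500826492306872092, 607832924485822123893420081116554,
    493350840684935119386599911806128, 400323968412722760446468141686973, 324751214106215091031774898485234,
    263373962895350435173338357377159, 213538972275911163088086226855844, 173086460420424707587253301413114,
    140258781844397013268172448125961, 113625921594429705830024546777084, 92024725724615046563584478731076,
    74509347947330573042561084591653, 60310852443923150438900892739116, 48804289326535636033786380494724,
    39481867268986289820919832294271, 31931099766946137745829959599568, 25817007507792006826027006598071,
    20867627758136801661154529517173, 16862219338257349720655647509488, 13621664240071959464038764694637,
    11000658839914877144358923079707, 8881362710513513709597672339491, 7168234319640172848881946807248,
    5783832929851335581259273319447, 4665406841795483719781346865746, 3762121435866081030496207532010,
    3032807640164448145779007383257, 2444133612564090288354086536296, 1969120491470536389092280494152,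
    1585937795871647843849402008990, 1276926055138461505032492934726, 1027804024904709218289857944782,
    827025807334257559833492487881, 665259677043496938997176189822, 534965691234867703307987619534,
    430053457305516919346702164297, 345604925338926784194382192049, 277649914937527474493409880354,
    222984396885926932527581383960, 179023428856652379683083052283, 143682171237258939425796498317,
    115279649727108410268042690718, 92460939029705080758904697590, 74134260246740710038604830675,
    59420148876364902284217078502, 47610389456648186437186342734, 38134850333415945117623961593,
    30534706853519483526719296009, 24440829011666146949400560479, 19556342831744433352864307503,
    15642563801226797675727117578, 12507653836821518395383563116, 9997477314432671394110734650,
    7988232148028524901622558701, 6380513217208512718150568090, 5094531248171978554425113454,
    4066263490068623016919082185, 3244355585674551210485206229, 2587628848248919062602055775,
    2063075295240989518792806192, 1644245526827756819010460077, 1309952904308988596987465058,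
    1043232315595314569428800381, 830503788981492479746361648, 660900879890993309967869495,
    525731551683042340388049309, 418045559687018487091153244, 332287417569898717222320168,
    264018111623671283147441228, 209692021292006169914637474, 166478156557769638392954705,
    132116958551821405730024982, 104805628962565753189854866, 83106337299727088689944730,
    65872767993555537025883953, 52191364299884417719452192, 41334345468569987398570526,
    32722151836985252154268327, 25893437016882057002359861, 20481099381444438788196201,
    16193144538163466498006354, 12797410813969092203145839, 10109382592684890243935339,
    7982470975264499966300332, 6300265198208446181387857, 4970357590933597283199550,
    3919424439726932455481904, 3089308860861156846221058, 2433902807377268551927653,
    1916666163752283499792711, 1508653544221474513081866, 1186945528235280303834757,
    933401943740087821163525, 733671490855787750236063, 576405323141579582309840, 452632842552473370269719,
    355266455497904629804490, 278708811988654889282787, 218541452704160865229938, 171278095963564183185569,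
    134169228912949039287309, 105047401323720214735845, 82204797423730637290803, 64296393934920940728257,
    50263391086791248401862, 39272699737807175034402, 30669139297980503425545, 23937693701256154766802,
    18673722769148876046574, 14559463050357782592634, 11345498830377491493243, 8836158957987629600473,
    6878013156958149667114, 5350814289433647253400, 4160369936832220680802, 3232935070946522416377,
    2510803397346698360787, 1948842842148010077610, 1511774342460095420742, 1172035538726987796895,
    908104498141674012315, 703185077691811744728, 544176437900249995295, 420865709344199816940,
    325295819644181541216, 251270739456205494821, 193968482613020132327, 149638555157335279224,
    115365553885986138909, 88884552727586169570, 68437011759141946361, 52658376905566496345,
    40490449891678761817, 31113108526215845490, 23891135000922598621, 18332833286777843181,
    14057840661556747838, 10772105450365375110, 8248447176613819344, 6311462786100001944,
    4825814464642705036, 3687147014923669040, 2815048804548720144, 2147599898026689140, 1637152176324093054,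
    1247065128647762745, 949182527469523938, 721883096239454718, 548575601658379427, 416537818017241498,
    316021397636306406, 239562215450944137, 181449391626745928, 137316765340748719, 103828804854575647,
    78439293700357398, 59206066030052023, 44648874867815365, 33640433065994170, 25322945742768655,
    19044219737399823, 14308794779412286, 10740594259633282, 8054401761691018, 6034095681424573,
    4516053506209319, 3376508618954817, 2521925777635221, 1881680993051046, 1402498445554353,
    1044226582040722, 776633557947931, 576978362008262, 428171324714100, 317382398602028, 234989042219523,
    173781688194937, 128364196860773, 94701959299374, 69781543686979, 51354666391773, 37745732428153,
    27707354427729, 20311959869076, 14870591703377, 10872114256046, 7937771067795, 5787232662336,
    4213276093961, 3062906627106, 2223312543970, 1611415838202, 1166117605448, 842541287719, 607771804065,
    437699333376, 314689799781, 225863047430, 161825846160, 115737404664, 82623976486, 58874385349,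
    41871334614, 29720561230, 21053676445, 14883573114, 10499640707, 7391026522, 5191304973, 3637993036,
    2543535902, 1774079109, 1234363833, 856667495, 593001267, 409383981, 281846923, 193487501, 132441995,
    90379784, 61484961, 41691046, 28175955, 18974973, 12733429, 8512309, 5668963, 3759612, 2483234, 1632658,
    1068745, 696033, 451194, 290783, 186475, 118794, 75278, 47330, 29601, 18334, 11297, 6879, 4167, 2485,
    1479, 859, 500, 282, 160, 86, 48, 24, 13, 6, 3, 1, 1]"

lemma length_tables: "length sigma2_table = 301" "length PL_table = 302"
  by (simp_all add: sigma2_table_def PL_table_def)

lemma sigma2_table: "sigma2_table = map divisor_square_sum [1..301]"
  unfolding sigma2_table_def by code_simp

lemma PL_table_recurrence: "satisfies_recurrence 301 sigma2_table PL_table"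
  unfolding sigma2_table_def PL_table_def by code_simp

text \<open>The first 291 entries are \<open>PL 301\<close> down to \<open>PL 11\<close>, so the sizes tested are 300 down to 12; at 11 the inequality
  fails.\<close>
lemma PL_table_log_concave: "log_concave (take 291 PL_table)"
  unfolding PL_table_def by code_simp

lemma PL_log_concave_small:
  assumes "12 \<le> n" "n \<le> 300"
  shows "PL (n - 1) * PL (n + 1) \<le> (PL n)\<^sup>2"
proof -
  have sigma: "sigma2_table ! i = int (sigma2 (Suc i))" if "i < length sigma2_table" for i
  proof -
    have "sigma2_table ! i = divisor_square_sum (int (Suc i))"
      using that unfolding length_tables by (simp add: sigma2_table nth_upto)
    then show ?thesis
      by (simp only: divisor_square_sum_eq)
  qed
  have table: "PL_table = map (\<lambda>i. int (PL (301 - i))) [0..<Suc 301]"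
    by (rule satisfies_recurrence_imp_PL[OF _ _ _ sigma])
      (use PL_table_recurrence length_tables in auto)
  have nth: "take 291 PL_table ! i = int (PL (301 - i))" if "i < 291" for i
    unfolding table using that by (simp add: nth_append del: upt_Suc)
  have "take 291 PL_table ! (300 - n) * take 291 PL_table ! (300 - n + 2)
      \<le> take 291 PL_table ! (300 - n + 1) * take 291 PL_table ! (300 - n + 1)"
    by (rule log_concave_nth[OF PL_table_log_concave]) (use assms length_tables in auto)
  also have "take 291 PL_table ! (300 - n) = int (PL (n + 1))"
    using assms by (subst nth) auto
  also have "take 291 PL_table ! (300 - n + 1) = int (PL n)"
    using assms by (subst nth) auto
  also have "take 291 PL_table ! (300 - n + 2) = int (PL (n - 1))"
    using assms by (subst nth) auto
  finally have "int (PL (n - 1) * PL (n + 1)) \<le> int ((PL n)\<^sup>2)"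
    by (simp add: power2_eq_square mult.commute)
  then show ?thesis
    by linarith
qed

theorem theorem1p1:
  fixes n :: nat
  assumes "n \<ge> 12"
  shows "(PL n)\<^sup>2 \<ge> PL (n - 1) * PL (n + 1)"
  using PL_log_concave_small[of n] PL_log_concave_large[of n] assms by linarith

end
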